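(* Let $\theta \in (0, 0.0664\pi]$ and let $\mathcal{P}_{Q_2} = \mathcal{P}_{Q_2}([0,1])$ be an action minimizer connecting the boundary configuration sets $Q_S$ and $Q_{E_2}$, i.e. $\mathcal{P}_{Q_2} \in P(Q_S, Q_{E_2})$ and $\mathcal{A}(\mathcal{P}_{Q_2}) = \inf_{q \in P(Q_S, Q_{E_2})} \mathcal{A}(q)$. Then $\mathcal{P}_{Q_2}$ is collision-free on $[0,1]$, and it can be extended to a periodic or quasi-periodic orbit of the planar equal-mass four-body problem.
   Context: Planar four-body problem with masses $m_1=m_2=m_3=m_4=1$. Positions $q_i=(q_{ix},q_{iy})\in\mathbb{R}^2$ are row vectors, and $q$ is the $4\times 2$ matrix with rows $q_1,\dots,q_4$. Let $\chi=\{q\in\mathbb{R}^{4\times 2} : \sum_{i=1}^4 q_i=0\}$. The Lagrangian action of $q\in H^1([0,1],\chi)$ is $$\mathcal{A}(q)=\int_0^1 \Big[\tfrac12\sum_{i=1}^4|\dot q_i|^2+\sum_{1\le i<j\le 4}\frac{1}{|q_i-q_j|}\Big]dt\in\mathbb{R}\cup\{+\infty\}.$$ Let $R(\theta)=\begin{bmatrix}\cos\theta&\sin\theta\\ -\sin\theta&\cos\theta\end{bmatrix}$ (acting on row vectors from the right). Define $$Q_S=\left\{\begin{bmatrix}-a_1-c_1&0\\ -a_1&0\\ (2a_1+c_1)/2&b_1\\ (2a_1+c_1)/2&-b_1\end{bmatrix} : a_1\in\mathbb{R},\ b_1\ge0,\ c_1\ge0\right\},$$ $$Q_{E_2}=\left\{\begin{bmatrix}-a_2&-b_2\\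 -a_2&b_2\\ a_2&c_2\\ a_2&-c_2\end{bmatrix}R(\theta) : a_2\in\mathbb{R},\ b_2\ge0,\ c_2\ge0\right\},$$ $$P(Q_S,Q_{E_2})=\{q\in H^1([0,1],\chi) : q(0)\in Q_S,\ q(1)\in Q_{E_2}\}.$$ For each $\theta\in(0,\pi/4)$ a minimizer of $\mathcal{A}$ over $P(Q_S,Q_{E_2})$ exists. A path has a collision at time $t$ if $q_i(t)=q_j(t)$ for some $i\ne j$; it is collision-free if it has no collision at any time. An orbit is a classical (collision-free) solution, defined for all $t\in\mathbb{R}$, of Newton's equations $\ddot q_i=\sum_{j\neq i}(q_j-q_i)/|q_j-q_i|^3$, $i=1,\dots,4$; it extends $\mathcal{P}_{Q_2}$ if it coincides with $\mathcal{P}_{Q_2}$ on $[0,1]$. *)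

theory Defs
  imports "HOL-Analysis.Analysis"
begin

section \<open>Sobolev paths\<close>

text \<open>\<open>v\<close> is a square-integrable weak derivative of (the continuous representative) \<open>q\<close> on \<open>[0,1]\<close>.
  Only the values of \<open>q\<close> and \<open>v\<close> on \<open>[0,1]\<close> matter.\<close>

definition H1_derivative :: "(real \<Rightarrow> 'a::euclidean_space) \<Rightarrow> (real \<Rightarrow> 'a) \<Rightarrow> bool" where
  "H1_derivative q v \<longleftrightarrow>
     set_borel_measurable lborel {0..1} v \<and>
     (\<integral>\<^sup>+t\<in>{0..1}. ennreal ((norm (v t))\<^sup>2) \<partial>lborel) < \<infinity> \<and>
     (\<forall>t\<in>{0..1}. q t = q 0 + (LINT s:{0..t}|lborel. v s))"

definition H1 :: "(real \<Rightarrow> 'a::euclidean_space) set" where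
  "H1 = {q. \<exists>v. H1_derivative q v}"

lemma AE_zero_real:
  fixes f :: "real \<Rightarrow> real"
  assumes f: "integrable lborel f" and 0: "\<And>x. (LINT s:{..x}|lborel. f s) = 0"
    and tot: "(LINT s|lborel. f s) = 0"
  shows "AE s in lborel. f s = 0"
proof -
  have si: "set_integrable lborel A f" if "A \<in> sets borel" for A
    using that f unfolding set_integrable_def by (intro integrable_mult_indicator) auto
  have "(LINT s:A|lborel. f s) = 0" if "A \<in> sets borel" for A
  proof -
    have G: "Int_stable (range (\<lambda>a::real. {..a}))" by (auto simp: Int_stable_def)
    have eq: "sets borel = sigma_sets UNIV (range (\<lambda>a::real. {..a}))"
      by (subst borel_eq_atMost) simp
    have A: "A \<in> sigma_sets UNIV (range (\<lambda>a::real. {..a}))" using that eq by simp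
    have P: "range (\<lambda>a::real. {..a}) \<subseteq> Pow UNIV" by simp
    show ?thesis
      using G P A
    proof (induction rule: sigma_sets_induct_disjoint)
      case (compl A)
      then have A: "A \<in> sets borel" using eq by simp
      have "(LINT s:A \<union> (UNIV - A)|lborel. f s) = (LINT s:A|lborel. f s) + (LINT s:UNIV - A|lborel. f s)"
        using A by (intro set_integral_Un si) auto
      then show ?case using compl tot by (simp add: set_lebesgue_integral_def Un_Diff_cancel)
    next
      case (union B)
      then have B: "B i \<in> sets borel" for i using eq by auto
      have "(LINT s:(\<Union>i. B i)|lborel. f s) = (\<Sum>i. LINT s:B i|lborel. f s)"
        using B union by (intro lebesgue_integral_countable_add si) (auto simp: disjoint_family_on_def)
      then show ?case using union by simp
    qed (use 0 in \<open>auto simp: set_lebesgue_integral_def\<close>)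
  qed
  then have "AE s in lborel. f s = (\<lambda>_. 0) s"
    by (intro density_unique_real f) (auto simp: set_lebesgue_integral_def)
  then show ?thesis by simp
qed

lemma H1_derivative_set_integrable:
  assumes "H1_derivative q v"
  shows "set_integrable lborel {0..1} v"
proof -
  let ?g = "\<lambda>t. indicator {0..1} t *\<^sub>R v t"
  have m: "?g \<in> borel_measurable lborel"
    using assms unfolding H1_derivative_def set_borel_measurable_def by auto
  have "(\<integral>\<^sup>+t. ennreal (norm (?g t)) \<partial>lborel)
      \<le> (\<integral>\<^sup>+t. indicator {0..1} t + ennreal ((norm (v t))\<^sup>2) * indicator {0..1} t \<partial>lborel)"
  proof (intro nn_integral_mono)
    fix t :: real
    have "norm (v t) \<le> 1 + (norm (v t))\<^sup>2"
      using zero_le_power2[of "norm (v t) - 1/2"] by (simp add: power2_diff power2_eq_square algebra_simps)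
    then have "ennreal (norm (v t)) \<le> 1 + ennreal ((norm (v t))\<^sup>2)"
      by (metis ennreal_1 ennreal_leI ennreal_plus zero_le_one zero_le_power2)
    then show "ennreal (norm (?g t)) \<le> indicator {0..1} t + ennreal ((norm (v t))\<^sup>2) * indicator {0..1} t"
      by (auto split: split_indicator)
  qed
  also have "\<dots> = (\<integral>\<^sup>+t. indicator {0..1::real} t \<partial>lborel) + (\<integral>\<^sup>+t. ennreal ((norm (v t))\<^sup>2) * indicator {0..1} t \<partial>lborel)"
  proof (rule nn_integral_add)
    have "(\<lambda>t. ennreal ((norm (?g t))\<^sup>2)) \<in> borel_measurable lborel" using m by measurable
    moreover have "(\<lambda>t. ennreal ((norm (?g t))\<^sup>2)) = (\<lambda>t. ennreal ((norm (v t))\<^sup>2) * indicator {0..1} t)"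
      by (auto split: split_indicator)
    ultimately show "(\<lambda>t. ennreal ((norm (v t))\<^sup>2) * indicator {0..1} t) \<in> borel_measurable lborel" by (simp only:)
  qed auto
  also have "\<dots> < \<infinity>" using assms unfolding H1_derivative_def by simp
  finally show ?thesis unfolding set_integrable_def using m by (intro integrableI_bounded)
qed

lemma H1_derivative_unique:
  fixes q :: "real \<Rightarrow> 'a::euclidean_space"
  assumes v: "H1_derivative q v" and w: "H1_derivative q w"
  shows "AE t\<in>{0..1} in lborel. v t = w t"
proof -
  let ?g = "\<lambda>t. indicator {0..1} t *\<^sub>R v t - indicator {0..1::real} t *\<^sub>R w t"
  note iv = H1_derivative_set_integrable[OF v] and iw = H1_derivative_set_integrable[OF w]
  have g: "integrable lborel ?g"
    using iv iw unfolding set_integrable_def by (rule Bochner_Integration.integrable_diff)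
  have z: "(LINT s:{..x}|lborel. ?g s) = 0" for x
  proof (cases "x < 0")
    case True
    have e: "(\<lambda>s. indicator {..x} s *\<^sub>R ?g s) = (\<lambda>s. 0)"
      using True by (auto simp: fun_eq_iff split: split_indicator)
    show ?thesis unfolding set_lebesgue_integral_def e by simp
  next
    case False
    define t where "t = min x 1"
    have t: "t \<in> {0..1}" using False by (auto simp: t_def)
    have "set_integrable lborel {0..t} v" "set_integrable lborel {0..t} w"
      using t by (auto intro: set_integrable_subset[OF iv] set_integrable_subset[OF iw])
    moreover have "q t = q 0 + (LINT s:{0..t}|lborel. v s)" "q t = q 0 + (LINT s:{0..t}|lborel. w s)"
      using v w t unfolding H1_derivative_def by blast+
    ultimately have "(LINT s:{0..t}|lborel. v s - w s) = 0" by simp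
    moreover have "(\<lambda>s. indicator {..x} s *\<^sub>R ?g s) = (\<lambda>s. indicator {0..t} s *\<^sub>R (v s - w s))"
      by (auto simp: t_def fun_eq_iff split: split_indicator)
    ultimately show ?thesis unfolding set_lebesgue_integral_def by simp
  qed
  have tot: "(LINT s|lborel. ?g s) = 0"
  proof -
    have "(\<lambda>s. indicator {..1} s *\<^sub>R ?g s) = ?g" by (auto simp: fun_eq_iff split: split_indicator)
    then show ?thesis using z[of 1] unfolding set_lebesgue_integral_def by simp
  qed
  have "AE s in lborel. ?g s \<bullet> b = 0" for b
  proof (rule AE_zero_real)
    show "integrable lborel (\<lambda>s. ?g s \<bullet> b)" using g by (rule integrable_inner_left)
    show "(LINT s|lborel. ?g s \<bullet> b) = 0" using integral_inner_left[OF g, of b] tot by simp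
    fix x
    have "integrable lborel (\<lambda>s. indicator {..x} s *\<^sub>R ?g s)"
      using g by (intro integrable_mult_indicator) auto
    then show "(LINT s:{..x}|lborel. ?g s \<bullet> b) = 0"
      using integral_inner_left[of b lborel "\<lambda>s. indicator {..x} s *\<^sub>R ?g s"] z[of x]
      unfolding set_lebesgue_integral_def by simp
  qed
  then have "AE s in lborel. \<forall>b\<in>Basis. ?g s \<bullet> b = 0" by (intro AE_finite_allI) auto
  then show ?thesis
  proof eventually_elim
    case (elim s)
    have "?g s = 0" by (rule euclidean_eqI) (use elim in simp)
    then show ?case by auto
  qed
qed

text \<open>The choice below is immaterial: the weak derivative is unique almost everywhere,
  see \<open>H1_derivative_unique\<close> and \<open>action_eq\<close>.\<close>

definition weak_deriv :: "(real \<Rightarrow> 'a::euclidean_space) \<Rightarrow> real \<Rightarrow> 'a" where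
  "weak_deriv q = (SOME v. H1_derivative q v)"

section \<open>The planar equal-mass four-body problem\<close>

text \<open>A \<open>4 \<times> 2\<close> matrix; row \<open>i\<close> is the position of body \<open>i\<close>. The index type \<open>4\<close> has the
  elements \<open>1, 2, 3, 4\<close> (with \<open>4 = 0\<close>).\<close>

type_synonym config = "real^2^4"

definition centered :: "config set" where
  "centered = {q. (\<Sum>i\<in>UNIV. q $ i) = 0}"

text \<open>Extended-valued: in \<^typ>\<open>ennreal\<close> the reciprocal of \<open>0\<close> is \<open>\<infinity>\<close>, so the
  potential is infinite at collisions.\<close>

definition potential :: "config \<Rightarrow> ennreal" where
  "potential q = (\<Sum>(i, j)\<in>{(i, j). i < j}. 1 / ennreal (norm (q $ i - q $ j)))"

definition action :: "(real \<Rightarrow> config) \<Rightarrow> ennreal" where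
  "action q =
     (\<integral>\<^sup>+t\<in>{0..1}. (ennreal (1/2 * (\<Sum>i\<in>UNIV. (norm (weak_deriv q t $ i))\<^sup>2)) + potential (q t)) \<partial>lborel)"

lemma action_eq:
  assumes v: "H1_derivative q v"
  shows "action q =
     (\<integral>\<^sup>+t\<in>{0..1}. (ennreal (1/2 * (\<Sum>i\<in>UNIV. (norm (v t $ i))\<^sup>2)) + potential (q t)) \<partial>lborel)"
proof -
  have "H1_derivative q (weak_deriv q)" unfolding weak_deriv_def using v by (metis someI)
  from H1_derivative_unique[OF this v] show ?thesis
    unfolding action_def by (intro nn_integral_cong_AE) (auto elim!: eventually_mono split: split_indicator)
qed
definition collision_at :: "(real \<Rightarrow> config) \<Rightarrow> real \<Rightarrow> bool" where
  "collision_at q t \<longleftrightarrow> (\<exists>i j. i \<noteq> j \<and> q t $ i = q t $ j)"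

definition is_orbit :: "(real \<Rightarrow> config) \<Rightarrow> bool" where
  "is_orbit q \<longleftrightarrow>
     (\<forall>t. \<not> collision_at q t) \<and>
     (\<exists>v. \<forall>t i.
        ((\<lambda>s. q s $ i) has_vector_derivative v t $ i) (at t) \<and>
        ((\<lambda>s. v s $ i) has_vector_derivative
          (\<Sum>j\<in>UNIV - {i}. (1 / norm (q t $ j - q t $ i) ^ 3) *\<^sub>R (q t $ j - q t $ i))) (at t))"

section \<open>Boundary configurations\<close>

definition Rot :: "real \<Rightarrow> real^2^2" where
  "Rot \<theta> = vector [vector [cos \<theta>, sin \<theta>],
                  vector [- sin \<theta>, cos \<theta>]]"

definition Q_S :: "config set" where
  "Q_S = {vector [vector [- a - c, 0],
                  vector [- a, 0],
                  vector [(2 * a + c) / 2, b],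
                  vector [(2 * a + c) / 2, - b]] | a b c. b \<ge> 0 \<and> c \<ge> 0}"

definition Q_E2 :: "real \<Rightarrow> config set" where
  "Q_E2 \<theta> = {(vector [vector [- a, - b],
                      vector [- a, b],
                      vector [a, c],
                      vector [a, - c]] :: config) ** Rot \<theta> | a b c. b \<ge> 0 \<and> c \<ge> 0}"

definition paths :: "real \<Rightarrow> (real \<Rightarrow> config) set" where
  "paths \<theta> = {q \<in> H1. (\<forall>t\<in>{0..1}. q t \<in> centered) \<and> q 0 \<in> Q_S \<and> q 1 \<in> Q_E2 \<theta>}"

section \<open>Periodic and quasi-periodic functions\<close>

definition periodic :: "(real \<Rightarrow> 'a) \<Rightarrow> bool" where
  "periodic q \<longleftrightarrow> (\<exists>T>0. \<forall>t. q (t + T) = q t)"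

text \<open>\<open>q t = F (\<omega>\<^sub>0 t, \<dots>, \<omega>\<^sub>k\<^sub>-\<^sub>1 t)\<close> for a continuous function \<open>F\<close> on the torus \<open>\<real>\<^sup>k / \<int>\<^sup>k\<close>
  and \<open>k \<ge> 2\<close> rationally independent frequencies. A point of \<open>\<real>\<^sup>k\<close> is represented by a function
  on \<open>nat\<close> that vanishes outside \<open>{..<k}\<close>.\<close>

definition quasi_periodic :: "(real \<Rightarrow> 'a::topological_space) \<Rightarrow> bool" where
  "quasi_periodic q \<longleftrightarrow>
     (\<exists>(k::nat) (\<omega> :: nat \<Rightarrow> real) (F :: (nat \<Rightarrow> real) \<Rightarrow> 'a).
        k \<ge> 2 \<and>
        (\<forall>z :: nat \<Rightarrow> int. (\<Sum>i<k. of_int (z i) * \<omega> i) = 0 \<longrightarrow> (\<forall>i<k. z i = 0)) \<and>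
        continuous_on {x. \<forall>i\<ge>k. x i = 0} F \<and>
        (\<forall>x. (\<forall>i\<ge>k. x i = 0) \<longrightarrow> (\<forall>i<k. F (x(i := x i + 1)) = F x)) \<and>
        (\<forall>t. q t = F (\<lambda>i. if i < k then \<omega> i * t else 0)))"

end

theory Submission
  imports Defs
begin

text \<open>For a centered configuration the kinetic energy is one eighth of the sum of the squared relative velocities, so the
  action is the sum of six Kepler actions \<open>\<integral> |r'|\<^sup>2/8 + 1/|r|\<close>, one for each pair. Let \<open>R\<close> be the radius of
  the circular Kepler motion of angular velocity \<open>\<theta>\<close>, i.e. \<open>\<theta>\<^sup>2 R\<^sup>3 = 4\<close>. Linearizing
  \<open>1/|r|\<close> in \<open>|r|\<^sup>2\<close> at \<open>R\<close> reduces lower bounds to the inequality \<open>\<integral> |r'|\<^sup>2 \<ge> \<theta>\<^sup>2 \<integral> |r|\<^sup>2\<close>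
  for paths between two lines at angle \<open>\<theta>\<close>. The boundary conditions put the pairs 12 and 34 and the vector between their
  centers in this situation, and these three vectors carry the total of the four cross pairs. Hence every pair
  contributes at least \<open>3/(2R)\<close>, while a colliding pair contributes at least \<open>1.884\<close>. When a cross pair collides,
  the boundary reflections link the four cross pairs to a Kepler path of duration 4, which costs still more. A tight binary 12
  inside a slowly rotating equilateral triangle has smaller action than any of these, so a minimizer has no
  collision. It is then a classical solution which meets both boundary sets orthogonally and
  extends by reflections; the composition of the two reflections is a rotation by \<open>2\<theta>\<close> combined with an exchange of
  the bodies 1 and 2.\<close>

section \<open>Absolutely continuous paths\<close>

text \<open>The comparison is arranged so that R cancels. The bound for a collision and the bound
  for the test path both contain \<open>15 / (2 * R)\<close>: on one side five pairs at the least
  price 3/(2R), on the other a rigid triangle in which these five pairs are about R apart. What is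
  left is the price of one pair: 1.884 for a collision, against less than 1.75 for the circular
  binary plus at most 0.094 because bodies 1 and 2 sit off their vertex. The bound on \<theta>
  enters through R \<ge> 4.5 and the angular speed pi/2 + \<theta>.

  The obstacle is the cross pairs. The rotation inequality needs boundary conditions on lines, which
  a single cross pair does not satisfy, so only the sum over the four of them is controlled. A
  collision in one of them cannot be priced separately, and the whole cycle has to be estimated.

  The lower bounds must hold for paths through the singularity. They are therefore obtained by
  integrating an explicit continuously differentiable function along an arbitrary path, not by
  studying minimizers of the pair problem.\<close>

lemma set_integrable_inner_continuous:
  fixes c v :: "real \<Rightarrow> 'a::euclidean_space"
  assumes c: "continuous_on {a..b} c" and v: "set_integrable lborel {a..b} v"
  shows "set_integrable lborel {a..b} (\<lambda>t. c t \<bullet> v t)"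
proof -
  obtain B where B: "\<And>t. t \<in> {a..b} \<Longrightarrow> norm (c t) \<le> B"
    using compact_imp_bounded[OF compact_continuous_image[OF c compact_Icc]]
    unfolding bounded_iff by (meson imageI)
  have cm: "(\<lambda>t. indicator {a..b} t *\<^sub>R c t) \<in> borel_measurable lborel"
    using borel_measurable_continuous_on_indicator[OF _ c] by simp
  have vm: "(\<lambda>t. indicator {a..b} t *\<^sub>R v t) \<in> borel_measurable lborel"
    using v unfolding set_integrable_def by (rule borel_measurable_integrable)
  have "(\<lambda>t. (indicator {a..b} t *\<^sub>R c t) \<bullet> (indicator {a..b} t *\<^sub>R v t)) \<in> borel_measurable lborel"
    using cm vm by measurable
  also have "(\<lambda>t. (indicator {a..b} t *\<^sub>R c t) \<bullet> (indicator {a..b} t *\<^sub>R v t))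
      = (\<lambda>t. indicator {a..b} t *\<^sub>R (c t \<bullet> v t))"
    by (auto simp: fun_eq_iff split: split_indicator)
  finally have m: "(\<lambda>t. indicator {a..b} t *\<^sub>R (c t \<bullet> v t)) \<in> borel_measurable lborel" .
  have "integrable lborel (\<lambda>t. \<bar>B\<bar> *\<^sub>R (indicator {a..b} t *\<^sub>R v t))"
    using v unfolding set_integrable_def by (rule integrable_scaleR_right)
  then show ?thesis unfolding set_integrable_def
  proof (rule Bochner_Integration.integrable_bound[OF _ m], intro AE_I2)
    fix t
    have "\<bar>c t \<bullet> v t\<bar> \<le> \<bar>B\<bar> * norm (v t)" if "t \<in> {a..b}"
      using Cauchy_Schwarz_ineq2[of "c t" "v t"] B[OF that]
      by (smt (verit) mult_right_mono norm_ge_zero)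
    then show "norm (indicator {a..b} t *\<^sub>R (c t \<bullet> v t)) \<le> norm (\<bar>B\<bar> *\<^sub>R (indicator {a..b} t *\<^sub>R v t))"
      by (auto split: split_indicator)
  qed
qed

lemma set_integral_split:
  fixes f :: "real \<Rightarrow> 'a::euclidean_space"
  assumes "set_integrable lborel {a..c} f" "a \<le> b" "b \<le> c"
  shows "(LINT t:{a..c}|lborel. f t) = (LINT t:{a..b}|lborel. f t) + (LINT t:{b..c}|lborel. f t)"
proof -
  have f: "f integrable_on {a..c}" using set_borel_integral_eq_integral(1)[OF assms(1)] .
  have s: "set_integrable lborel {a..b} f" "set_integrable lborel {b..c} f"
    using assms by (auto intro: set_integrable_subset[OF assms(1)])
  show ?thesis
    using Henstock_Kurzweil_Integration.integral_combine[OF assms(2,3) f]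
      set_borel_integral_eq_integral(2)[OF assms(1)] s[THEN set_borel_integral_eq_integral(2)]
    by simp
qed

lemma set_integrable_const_Icc: "set_integrable lborel {a..b::real} (\<lambda>_. c::'a::euclidean_space)"
  using borel_integrable_atLeastAtMost'[of a b "\<lambda>_. c"] by simp

lemma set_integral_const_Icc: "a \<le> b \<Longrightarrow> (LINT t:{a..b}|lborel. c::'a::euclidean_space) = (b - a) *\<^sub>R c"
  by (subst set_borel_integral_eq_integral(2)[OF set_integrable_const_Icc]) simp

lemma integral_path_continuous:
  fixes \<gamma> v :: "real \<Rightarrow> 'a::euclidean_space"
  assumes v: "set_integrable lborel {a..b} v"
    and \<gamma>: "\<And>s t. a \<le> s \<Longrightarrow> s \<le> t \<Longrightarrow> t \<le> b \<Longrightarrow> \<gamma> t - \<gamma> s = (LINT r:{s..t}|lborel. v r)"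
  shows "continuous_on {a..b} \<gamma>"
proof -
  have i: "v integrable_on {a..b}" using set_borel_integral_eq_integral(1)[OF v] .
  have "\<gamma> t = \<gamma> a + integral {a..t} v" if "t \<in> {a..b}" for t
  proof -
    have "set_integrable lborel {a..t} v" using that by (auto intro: set_integrable_subset[OF v])
    then show ?thesis using \<gamma>[of a t] that set_borel_integral_eq_integral(2)[of "{a..t}" v]
      by (auto simp: algebra_simps)
  qed
  moreover have "continuous_on {a..b} (\<lambda>t. \<gamma> a + integral {a..t} v)"
    by (intro continuous_on_add continuous_on_const indefinite_integral_continuous_1 i)
  ultimately show ?thesis by (subst continuous_on_cong[OF refl, where g = "\<lambda>t. \<gamma> a + integral {a..t} v"])
qed

text \<open>The pointwise chain rule holds only almost everywhere along an absolutely continuous path, so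
  the increment is estimated on short intervals and the estimate is propagated by bisection.\<close>

proposition chain_rule:
  fixes \<gamma> v :: "real \<Rightarrow> 'a::euclidean_space" and F :: "'a \<Rightarrow> real"
  assumes ab: "a \<le> b" and v: "set_integrable lborel {a..b} v"
    and \<gamma>: "\<And>s t. a \<le> s \<Longrightarrow> s \<le> t \<Longrightarrow> t \<le> b \<Longrightarrow> \<gamma> t - \<gamma> s = (LINT r:{s..t}|lborel. v r)"
    and F: "\<And>x. (F has_derivative (\<lambda>h. F' x \<bullet> h)) (at x)" and F': "continuous_on UNIV F'"
  shows "set_integrable lborel {a..b} (\<lambda>t. F' (\<gamma> t) \<bullet> v t)"
    and "F (\<gamma> b) - F (\<gamma> a) = (LINT t:{a..b}|lborel. F' (\<gamma> t) \<bullet> v t)"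
proof -
  note c = integral_path_continuous[OF v \<gamma>]
  have c': "continuous_on {a..b} (\<lambda>t. F' (\<gamma> t))"
    by (rule continuous_on_compose2[OF F' c]) auto
  show I: "set_integrable lborel {a..b} (\<lambda>t. F' (\<gamma> t) \<bullet> v t)"
    by (rule set_integrable_inner_continuous[OF c' v])
  have nv: "set_integrable lborel {a..b} (\<lambda>t. norm (v t))" using set_integrable_norm[OF v] .
  \<comment> \<open>The defect \<open>E\<close> and the path length \<open>N\<close> are both
    additive over adjacent intervals, so a bound of \<open>E\<close> by a multiple of
    \<open>N\<close> survives bisection.\<close>
  define E where "E s t = F (\<gamma> t) - F (\<gamma> s) - (LINT r:{s..t}|lborel. F' (\<gamma> r) \<bullet> v r)" for s t
  define N where "N s t = (LINT r:{s..t}|lborel. norm (v r))" for s t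
  have E: "\<bar>E a b\<bar> \<le> \<eta> * N a b" if \<eta>: "\<eta> > 0" for \<eta>
  proof -
    define Q where "Q s t \<longleftrightarrow> (a \<le> s \<longrightarrow> s \<le> t \<longrightarrow> t \<le> b \<longrightarrow> \<bar>E s t\<bar> \<le> \<eta> * N s t)" for s t
    have "Q a b" using ab
    proof (induction rule: Bolzano)
      case (trans s t u)
      show ?case unfolding Q_def
      proof (intro impI)
        assume as: "a \<le> s" "s \<le> u" "u \<le> b"
        have "set_integrable lborel {s..u} (\<lambda>t. F' (\<gamma> t) \<bullet> v t)" "set_integrable lborel {s..u} (\<lambda>t. norm (v t))"
          using as by (auto intro: set_integrable_subset[OF I] set_integrable_subset[OF nv])
        note sp = this[THEN set_integral_split, OF trans(3,4)]
        have "E s u = E s t + E t u" "N s u = N s t + N t u"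
          unfolding E_def N_def using sp by simp_all
        then show "\<bar>E s u\<bar> \<le> \<eta> * N s u" using trans as unfolding Q_def by (simp add: distrib_left)
      qed
    next
      case (local x)
      have "isCont F' (\<gamma> x)" using F' by (simp add: continuous_on_eq_continuous_at)
      then obtain e where e: "e > 0" "\<And>y. dist y (\<gamma> x) < e \<Longrightarrow> dist (F' y) (F' (\<gamma> x)) < \<eta>/2"
        using \<eta> half_gt_zero[OF \<eta>] unfolding continuous_at_eps_delta by (auto dest!: spec[of _ "\<eta>/2"])
      obtain d where d: "d > 0" "\<And>t. t \<in> {a..b} \<Longrightarrow> dist t x < d \<Longrightarrow> dist (\<gamma> t) (\<gamma> x) < e"
        using bspec[OF c[unfolded continuous_on_iff], of x] local e(1) by auto
      show ?case unfolding Q_def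
      proof (intro exI[of _ d] conjI allI impI d(1))
        fix s t assume h: "s \<le> x \<and> x \<le> t \<and> t - s < d" and as: "a \<le> s" "s \<le> t" "t \<le> b"
        have b: "\<gamma> r \<in> ball (\<gamma> x) e" if "r \<in> {s..t}" for r
          using d(2)[of r] that h as by (auto simp: dist_real_def dist_commute)
        have vi: "set_integrable lborel {s..t} v" "set_integrable lborel {s..t} (\<lambda>r. F' (\<gamma> r) \<bullet> v r)"
           "set_integrable lborel {s..t} (\<lambda>t. norm (v t))"
          using as by (auto intro: set_integrable_subset[OF v] set_integrable_subset[OF I] set_integrable_subset[OF nv])
        have ci: "set_integrable lborel {s..t} (\<lambda>r. F' (\<gamma> x) \<bullet> v r)"
          by (rule set_integrable_inner_continuous[OF _ vi(1)]) simp
        have ds: "norm (\<gamma> t - \<gamma> s) \<le> N s t"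
          using \<gamma>[OF as] set_integral_norm_bound[OF vi(1)] unfolding N_def by simp
        \<comment> \<open>Half of \<open>\<eta>\<close> is spent here on the nonlinearity of
          \<open>F\<close> near \<open>\<gamma> x\<close>; the other half pays below for freezing
          \<open>F'\<close> at \<open>\<gamma> x\<close> under the integral.\<close>
        have "norm ((F (\<gamma> t) - F' (\<gamma> x) \<bullet> \<gamma> t) - (F (\<gamma> s) - F' (\<gamma> x) \<bullet> \<gamma> s)) \<le> \<eta>/2 * norm (\<gamma> t - \<gamma> s)"
        proof (rule differentiable_bound[of "ball (\<gamma> x) e" "\<lambda>y. F y - F' (\<gamma> x) \<bullet> y" "\<lambda>y h. F' y \<bullet> h - F' (\<gamma> x) \<bullet> h"])
          fix y assume y: "y \<in> ball (\<gamma> x) e"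
          show "((\<lambda>y. F y - F' (\<gamma> x) \<bullet> y) has_derivative (\<lambda>h. F' y \<bullet> h - F' (\<gamma> x) \<bullet> h)) (at y within ball (\<gamma> x) e)"
            by (intro derivative_intros has_derivative_at_withinI[OF F])
          have "norm (F' y - F' (\<gamma> x)) \<le> \<eta>/2"
            using e(2)[of y] y by (simp add: dist_norm norm_minus_commute)
          then show "onorm (\<lambda>h. F' y \<bullet> h - F' (\<gamma> x) \<bullet> h) \<le> \<eta>/2"
          proof (intro onorm_bound)
            fix h
            have "norm ((F' y - F' (\<gamma> x)) \<bullet> h) \<le> norm (F' y - F' (\<gamma> x)) * norm h"
              by (simp add: Cauchy_Schwarz_ineq2)
            also assume "norm (F' y - F' (\<gamma> x)) \<le> \<eta>/2"
            then have "norm (F' y - F' (\<gamma> x)) * norm h \<le> \<eta>/2 * norm h"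
              by (rule mult_right_mono) simp
            finally show "norm (F' y \<bullet> h - F' (\<gamma> x) \<bullet> h) \<le> \<eta>/2 * norm h"
              by (simp only: inner_diff_left)
          qed (use \<eta> in simp)
        next
          show "\<gamma> s \<in> ball (\<gamma> x) e" "\<gamma> t \<in> ball (\<gamma> x) e" using b as by simp_all
        qed simp
        note mvt = this
        have 1: "\<bar>F (\<gamma> t) - F (\<gamma> s) - F' (\<gamma> x) \<bullet> (\<gamma> t - \<gamma> s)\<bar> \<le> \<eta>/2 * N s t"
        proof -
          have "\<eta>/2 * norm (\<gamma> t - \<gamma> s) \<le> \<eta>/2 * N s t" using mult_left_mono[OF ds, of "\<eta>/2"] \<eta> by simp
          moreover have "F (\<gamma> t) - F (\<gamma> s) - F' (\<gamma> x) \<bullet> (\<gamma> t - \<gamma> s)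
              = (F (\<gamma> t) - F' (\<gamma> x) \<bullet> \<gamma> t) - (F (\<gamma> s) - F' (\<gamma> x) \<bullet> \<gamma> s)"
            by (simp add: inner_diff_right)
          ultimately show ?thesis using mvt unfolding real_norm_def by linarith
        qed
        have "F' (\<gamma> x) \<bullet> (\<gamma> t - \<gamma> s) = (LINT r:{s..t}|lborel. F' (\<gamma> x) \<bullet> v r)"
          unfolding \<gamma>[OF as] set_lebesgue_integral_def
          using vi(1) unfolding set_integrable_def by (simp add: integral_inner_right[symmetric])
        then have "(LINT r:{s..t}|lborel. F' (\<gamma> r) \<bullet> v r) - F' (\<gamma> x) \<bullet> (\<gamma> t - \<gamma> s)
            = (LINT r:{s..t}|lborel. F' (\<gamma> r) \<bullet> v r - F' (\<gamma> x) \<bullet> v r)"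
          using vi(2) ci by simp
        also have "norm \<dots> \<le> (LINT r:{s..t}|lborel. norm (F' (\<gamma> r) \<bullet> v r - F' (\<gamma> x) \<bullet> v r))"
          by (rule set_integral_norm_bound) (intro set_integral_diff vi ci)
        also have "\<dots> \<le> (LINT r:{s..t}|lborel. \<eta>/2 * norm (v r))"
        proof (rule set_integral_mono)
          show "set_integrable lborel {s..t} (\<lambda>r. norm (F' (\<gamma> r) \<bullet> v r - F' (\<gamma> x) \<bullet> v r))"
            by (intro set_integrable_norm set_integral_diff vi ci)
          show "set_integrable lborel {s..t} (\<lambda>r. \<eta>/2 * norm (v r))"
            using vi(3) by simp
          fix r assume "r \<in> {s..t}"
          then have "norm (F' (\<gamma> r) - F' (\<gamma> x)) \<le> \<eta>/2"
            using e(2)[of "\<gamma> r"] b by (simp add: dist_norm norm_minus_commute)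
          then show "norm (F' (\<gamma> r) \<bullet> v r - F' (\<gamma> x) \<bullet> v r) \<le> \<eta>/2 * norm (v r)"
            unfolding inner_diff_left[symmetric] real_norm_def
            by (intro order.trans[OF Cauchy_Schwarz_ineq2] mult_right_mono) auto
        qed
        also have "\<dots> = \<eta>/2 * N s t" unfolding N_def by simp
        finally show "\<bar>E s t\<bar> \<le> \<eta> * N s t" using 1 unfolding E_def real_norm_def by linarith
      qed
    qed
    then show ?thesis using ab by (simp add: Q_def)
  qed
  have N0: "N a b \<ge> 0" unfolding N_def set_lebesgue_integral_def by (intro integral_nonneg_AE) auto
  have "\<bar>E a b\<bar> \<le> 0 + \<epsilon>" if "\<epsilon> > 0" for \<epsilon>
  proof -
    have "\<bar>E a b\<bar> \<le> \<epsilon> / (N a b + 1) * N a b" using that N0 by (intro E) auto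
    also have "\<dots> \<le> \<epsilon>" using that N0 by (simp add: field_simps)
    finally show ?thesis by simp
  qed
  then have "E a b = 0" using field_le_epsilon[of "\<bar>E a b\<bar>" 0] by force
  then show "F (\<gamma> b) - F (\<gamma> a) = (LINT t:{a..b}|lborel. F' (\<gamma> t) \<bullet> v t)" unfolding E_def by simp
qed

lemma H1_derivative_integral:
  assumes "H1_derivative q v" "t \<in> {0..1}"
  shows "q t = q 0 + (LINT s:{0..t}|lborel. v s)"
  using assms unfolding H1_derivative_def by blast

lemma H1_derivative_increment:
  assumes q: "H1_derivative q v" and "0 \<le> s" "s \<le> t" "t \<le> 1"
  shows "q t - q s = (LINT r:{s..t}|lborel. v r)"
proof -
  note I = H1_derivative_set_integrable[OF q]
  have "set_integrable lborel {0..t} v" using assms by (auto intro: set_integrable_subset[OF I])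
  from set_integral_split[OF this assms(2,3)]
  have "(LINT r:{0..t}|lborel. v r) = (LINT r:{0..s}|lborel. v r) + (LINT r:{s..t}|lborel. v r)" .
  moreover have "q s = q 0 + (LINT r:{0..s}|lborel. v r)" "q t = q 0 + (LINT r:{0..t}|lborel. v r)"
    using assms(2-4) by (auto intro: H1_derivative_integral[OF q])
  ultimately show ?thesis by (metis add.assoc add_diff_cancel_left')
qed

lemma H1_derivative_continuous:
  assumes q: "H1_derivative q v"
  shows "continuous_on {0..1} q"
  by (rule integral_path_continuous[OF H1_derivative_set_integrable[OF q] H1_derivative_increment[OF q]])

lemma set_borel_measurable_norm_square:
  fixes v :: "real \<Rightarrow> 'a::euclidean_space"
  assumes "set_borel_measurable lborel A v"
  shows "set_borel_measurable lborel A (\<lambda>t. (norm (v t))\<^sup>2)"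
proof -
  have "(\<lambda>t. (norm (indicator A t *\<^sub>R v t))\<^sup>2) \<in> borel_measurable lborel"
    using assms unfolding set_borel_measurable_def by measurable
  also have "(\<lambda>t. (norm (indicator A t *\<^sub>R v t))\<^sup>2) = (\<lambda>t. indicator A t *\<^sub>R (norm (v t))\<^sup>2)"
    by (auto simp: fun_eq_iff split: split_indicator)
  finally show ?thesis unfolding set_borel_measurable_def .
qed

lemma H1_derivative_norm_square_integrable:
  assumes q: "H1_derivative q v"
  shows "set_integrable lborel {0..1} (\<lambda>t. (norm (v t))\<^sup>2)"
proof -
  have m: "set_borel_measurable lborel {0..1} (\<lambda>t. (norm (v t))\<^sup>2)"
    using q unfolding H1_derivative_def by (intro set_borel_measurable_norm_square) simp
  have "(\<integral>\<^sup>+t. ennreal (norm (indicator {0..1} t *\<^sub>R (norm (v t))\<^sup>2)) \<partial>lborel)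
      = (\<integral>\<^sup>+t\<in>{0..1}. ennreal ((norm (v t))\<^sup>2) \<partial>lborel)"
    by (intro nn_integral_cong) (auto split: split_indicator)
  also have "\<dots> < \<infinity>" using q unfolding H1_derivative_def by simp
  finally show ?thesis using m unfolding set_integrable_def set_borel_measurable_def
    by (intro integrableI_bounded) simp_all
qed

lemma H1_derivativeI:
  fixes q v :: "real \<Rightarrow> 'a::euclidean_space"
  assumes "set_integrable lborel {0..1} v" "set_integrable lborel {0..1} (\<lambda>t. (norm (v t))\<^sup>2)"
    and "\<And>t. t \<in> {0..1} \<Longrightarrow> q t = q 0 + (LINT s:{0..t}|lborel. v s)"
  shows "H1_derivative q v"
  unfolding H1_derivative_def
proof (intro conjI ballI)
  show "set_borel_measurable lborel {0..1} v"
    using assms(1) unfolding set_integrable_def set_borel_measurable_def by (rule borel_measurable_integrable)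
  have "(\<integral>\<^sup>+t\<in>{0..1}. ennreal ((norm (v t))\<^sup>2) \<partial>lborel)
     = (\<integral>\<^sup>+t. ennreal (norm (indicator {0..1} t *\<^sub>R (norm (v t))\<^sup>2)) \<partial>lborel)"
    by (intro nn_integral_cong) (auto split: split_indicator)
  also have "\<dots> < \<infinity>" using assms(2) unfolding set_integrable_def integrable_iff_bounded by simp
  finally show "(\<integral>\<^sup>+t\<in>{0..1}. ennreal ((norm (v t))\<^sup>2) \<partial>lborel) < \<infinity>" .
qed (fact assms(3))

lemma H1_derivative_linear:
  fixes q v :: "real \<Rightarrow> 'a::euclidean_space" and L :: "'a \<Rightarrow> 'b::euclidean_space"
  assumes q: "H1_derivative q v" and L: "bounded_linear L"
  shows "H1_derivative (\<lambda>t. L (q t)) (\<lambda>t. L (v t))"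
proof (rule H1_derivativeI)
  note I = H1_derivative_set_integrable[OF q]
  have SI: "set_integrable lborel A (\<lambda>t. L (v t))" and LI: "(LINT t:A|lborel. L (v t)) = L (LINT t:A|lborel. v t)"
    if "A \<in> sets borel" "A \<subseteq> {0..1}" for A
  proof -
    have "set_integrable lborel A v" using that by (auto intro: set_integrable_subset[OF I])
    then have i: "integrable lborel (\<lambda>t. indicator A t *\<^sub>R v t)" unfolding set_integrable_def .
    have e: "indicator A t *\<^sub>R L (v t) = L (indicator A t *\<^sub>R v t)" for t
      using linear_scale[OF bounded_linear.linear[OF L]] by metis
    show "set_integrable lborel A (\<lambda>t. L (v t))"
      unfolding set_integrable_def e by (rule integrable_bounded_linear[OF L i])
    show "(LINT t:A|lborel. L (v t)) = L (LINT t:A|lborel. v t)"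
      unfolding set_lebesgue_integral_def e by (rule integral_bounded_linear[OF L i])
  qed
  show li: "set_integrable lborel {0..1} (\<lambda>t. L (v t))" by (rule SI) auto
  obtain K where K: "\<And>x. norm (L x) \<le> norm x * K" using bounded_linear.bounded[OF L] by blast
  have "set_integrable lborel {0..1} (\<lambda>t. K\<^sup>2 * (norm (v t))\<^sup>2)"
    using H1_derivative_norm_square_integrable[OF q] by simp
  then show "set_integrable lborel {0..1} (\<lambda>t. (norm (L (v t)))\<^sup>2)"
  proof (rule set_integrable_bound)
    show "set_borel_measurable lborel {0..1} (\<lambda>t. (norm (L (v t)))\<^sup>2)"
      using li unfolding set_integrable_def
      by (intro set_borel_measurable_norm_square) (simp add: set_borel_measurable_def borel_measurable_integrable)
    have "(norm (L (v t)))\<^sup>2 \<le> K\<^sup>2 * (norm (v t))\<^sup>2" for t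
      using power_mono[OF K[of "v t"] norm_ge_zero, of 2] by (simp add: power_mult_distrib mult.commute)
    then show "AE t in lborel. t \<in> {0..1} \<longrightarrow> norm ((norm (L (v t)))\<^sup>2) \<le> norm (K\<^sup>2 * (norm (v t))\<^sup>2)"
      by (intro AE_I2 impI) (simp add: abs_mult)
  qed
  fix t :: real assume t: "t \<in> {0..1}"
  have "q t = q 0 + (LINT s:{0..t}|lborel. v s)" using q t unfolding H1_derivative_def by blast
  then show "L (q t) = L (q 0) + (LINT s:{0..t}|lborel. L (v s))"
    using LI[of "{0..t}"] t linear_add[OF bounded_linear.linear[OF L]] by simp
qed

text \<open>Pairing turns sums of paths, integration by parts and explicit time dependence (with the
  clock as one component) into statements about a single path.\<close>

lemma H1_derivative_Pair:
  fixes q v :: "real \<Rightarrow> 'a::euclidean_space" and p w :: "real \<Rightarrow> 'b::euclidean_space"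
  assumes q: "H1_derivative q v" and p: "H1_derivative p w"
  shows "H1_derivative (\<lambda>t. (q t, p t)) (\<lambda>t. (v t, w t))"
proof (rule H1_derivativeI)
  note I = H1_derivative_set_integrable[OF q] H1_derivative_set_integrable[OF p]
  have SI: "has_bochner_integral lborel (\<lambda>t. indicator A t *\<^sub>R (v t, w t)) (LINT t:A|lborel. v t, LINT t:A|lborel. w t)"
    if "A \<in> sets borel" "A \<subseteq> {0..1}" for A
  proof -
    have "set_integrable lborel A v" "set_integrable lborel A w"
      using that by (auto intro: set_integrable_subset[OF I(1)] set_integrable_subset[OF I(2)])
    then have i: "integrable lborel (\<lambda>t. indicator A t *\<^sub>R v t)" "integrable lborel (\<lambda>t. indicator A t *\<^sub>R w t)"
      unfolding set_integrable_def by auto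
    have l: "bounded_linear (\<lambda>x::'a. (x, 0::'b))" "bounded_linear (\<lambda>x::'b. (0::'a, x))"
      by (intro bounded_linear_Pair bounded_linear_ident bounded_linear_zero)+
    have "has_bochner_integral lborel (\<lambda>t. (indicator A t *\<^sub>R v t, 0) + (0, indicator A t *\<^sub>R w t))
       ((LINT t:A|lborel. v t, 0) + (0, LINT t:A|lborel. w t))"
      unfolding set_lebesgue_integral_def
      by (intro has_bochner_integral_add has_bochner_integral_bounded_linear[OF l(1)]
           has_bochner_integral_bounded_linear[OF l(2)] has_bochner_integral_integrable i)
    then show ?thesis by simp
  qed
  show li: "set_integrable lborel {0..1} (\<lambda>t. (v t, w t))"
    unfolding set_integrable_def using SI[of "{0..1}"] by (auto intro: integrable.intros)
  show "set_integrable lborel {0..1} (\<lambda>t. (norm (v t, w t))\<^sup>2)"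
    using H1_derivative_norm_square_integrable[OF q] H1_derivative_norm_square_integrable[OF p]
    by (simp add: norm_Pair)
  fix t :: real assume t: "t \<in> {0..1}"
  have "(LINT s:{0..t}|lborel. (v s, w s)) = (LINT s:{0..t}|lborel. v s, LINT s:{0..t}|lborel. w s)"
    using has_bochner_integral_integral_eq[OF SI[of "{0..t}"]] t unfolding set_lebesgue_integral_def by auto
  then show "(q t, p t) = (q 0, p 0) + (LINT s:{0..t}|lborel. (v s, w s))"
    using H1_derivative_integral[OF q t] H1_derivative_integral[OF p t] by (simp add: plus_prod_def)
qed

lemma H1_derivative_C1:
  fixes q v :: "real \<Rightarrow> 'a::euclidean_space"
  assumes v: "continuous_on {0..1} v"
    and q: "\<And>t. t \<in> {0..1} \<Longrightarrow> (q has_vector_derivative v t) (at t within {0..1})"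
  shows "H1_derivative q v"
proof (rule H1_derivativeI)
  show i: "set_integrable lborel {0..1} v" by (rule borel_integrable_atLeastAtMost'[OF v])
  show "set_integrable lborel {0..1} (\<lambda>t. (norm (v t))\<^sup>2)"
    by (rule borel_integrable_atLeastAtMost') (intro continuous_intros v)
  fix t :: real assume t: "t \<in> {0..1}"
  have "(v has_integral (q t - q 0)) {0..t}"
    using t by (intro fundamental_theorem_of_calculus)
      (auto intro: has_vector_derivative_within_subset[OF q])
  then have "integral {0..t} v = q t - q 0" by (rule integral_unique)
  moreover have "set_integrable lborel {0..t} v" using t by (auto intro: set_integrable_subset[OF i])
  ultimately show "q t = q 0 + (LINT s:{0..t}|lborel. v s)"
    using set_borel_integral_eq_integral(2)[of "{0..t}" v] by simp
qed

lemma H1_chain_rule: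
  fixes q v :: "real \<Rightarrow> 'a::euclidean_space" and F :: "'a \<Rightarrow> real"
  assumes q: "H1_derivative q v" and F: "\<And>x. (F has_derivative (\<lambda>h. F' x \<bullet> h)) (at x)" "continuous_on UNIV F'"
    and "0 \<le> a" "a \<le> b" "b \<le> 1"
  shows "set_integrable lborel {a..b} (\<lambda>t. F' (q t) \<bullet> v t)"
    and "F (q b) - F (q a) = (LINT t:{a..b}|lborel. F' (q t) \<bullet> v t)"
proof -
  have v: "set_integrable lborel {a..b} v"
    using assms by (auto intro: set_integrable_subset[OF H1_derivative_set_integrable[OF q]])
  have i: "q t - q s = (LINT r:{s..t}|lborel. v r)" if "a \<le> s" "s \<le> t" "t \<le> b" for s t
    using H1_derivative_increment[OF q, of s t] that assms by simp
  show "set_integrable lborel {a..b} (\<lambda>t. F' (q t) \<bullet> v t)"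
    by (rule chain_rule(1)[OF assms(5) v i F])
  show "F (q b) - F (q a) = (LINT t:{a..b}|lborel. F' (q t) \<bullet> v t)"
    by (rule chain_rule(2)[OF assms(5) v i F])
qed

section \<open>Lower bounds for the action of a pair\<close>

lemma norm_real2: "(norm (x::real^2))\<^sup>2 = (x$1)\<^sup>2 + (x$2)\<^sup>2"
  unfolding power2_norm_eq_inner inner_vec_def sum_2 by (simp add: power2_eq_square)

text \<open>In the frame rotating with angular velocity \<open>\<theta>\<close> (coordinates \<open>p\<close>, \<open>n\<close>) the function
  \<open>S = 2 \<theta> p n + (1 - t) n\<^sup>2 / 2\<close> is a verification function for the quadratic functional:
  its derivative along any path is at most the integrand, and its increment is nonnegative.\<close>

proposition rotating_line_inequality:
  fixes r v :: "real \<Rightarrow> real^2"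
  assumes r: "H1_derivative r v" and \<theta>: "\<bar>\<theta>\<bar> \<le> 1/4"
    and r0: "r 0 $ 2 * cos \<alpha> = r 0 $ 1 * sin \<alpha>"
    and r1: "r 1 $ 2 * cos (\<alpha> + \<theta>) = r 1 $ 1 * sin (\<alpha> + \<theta>) \<or>
             r 1 $ 1 * cos (\<alpha> + \<theta>) + r 1 $ 2 * sin (\<alpha> + \<theta>) = 0"
  shows "(LINT t:{0..1}|lborel. (norm (v t))\<^sup>2 - \<theta>\<^sup>2 * (norm (r t))\<^sup>2) \<ge> 0"
proof -
  define p where "p z = fst (snd z) * cos (\<alpha> + \<theta> * fst z) + snd (snd z) * sin (\<alpha> + \<theta> * fst z)"
    for z :: "real \<times> real \<times> real"
  define n where "n z = snd (snd z) * cos (\<alpha> + \<theta> * fst z) - fst (snd z) * sin (\<alpha> + \<theta> * fst z)"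
    for z :: "real \<times> real \<times> real"
  define F where "F z = 2 * \<theta> * p z * n z + (1 - fst z) / 2 * (n z)\<^sup>2" for z
  define G where "G z =
     (2 * \<theta>\<^sup>2 * ((n z)\<^sup>2 - (p z)\<^sup>2) - (n z)\<^sup>2 / 2 - (1 - fst z) * \<theta> * n z * p z,
      2 * \<theta> * (cos (\<alpha> + \<theta> * fst z) * n z - p z * sin (\<alpha> + \<theta> * fst z)) - (1 - fst z) * n z * sin (\<alpha> + \<theta> * fst z),
      2 * \<theta> * (sin (\<alpha> + \<theta> * fst z) * n z + p z * cos (\<alpha> + \<theta> * fst z)) + (1 - fst z) * n z * cos (\<alpha> + \<theta> * fst z))"
    for z
  \<comment> \<open>The clock is a coordinate of the path, so the chain rule for functions of
    position also covers the rotating frame.\<close>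
  define \<gamma> where "\<gamma> t = (t, r t $ 1, r t $ 2)" for t
  define w where "w t = (1::real, v t $ 1, v t $ 2)" for t
  have id: "H1_derivative (\<lambda>t. t) (\<lambda>_. 1::real)"
    by (rule H1_derivative_C1) (auto intro!: derivative_eq_intros)
  have \<gamma>: "H1_derivative \<gamma> w"
    unfolding \<gamma>_def w_def
    by (intro H1_derivative_Pair id H1_derivative_linear[OF r] bounded_linear_vec_nth)
  have pd: "(p has_derivative (\<lambda>h. n z * \<theta> * fst h + cos (\<alpha> + \<theta> * fst z) * fst (snd h) + sin (\<alpha> + \<theta> * fst z) * snd (snd h))) (at z)"
    for z unfolding p_def n_def by (auto intro!: derivative_eq_intros simp: algebra_simps)
  have nd: "(n has_derivative (\<lambda>h. - p z * \<theta> * fst h - sin (\<alpha> + \<theta> * fst z) * fst (snd h) + cos (\<alpha> + \<theta> * fst z) * snd (snd h))) (at z)"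
    for z unfolding p_def n_def by (auto intro!: derivative_eq_intros simp: algebra_simps)
  have F: "(F has_derivative (\<lambda>h. G z \<bullet> h)) (at z)" for z
  proof -
    let ?p = "\<lambda>h. n z * \<theta> * fst h + cos (\<alpha> + \<theta> * fst z) * fst (snd h) + sin (\<alpha> + \<theta> * fst z) * snd (snd h)"
    let ?n = "\<lambda>h. - p z * \<theta> * fst h - sin (\<alpha> + \<theta> * fst z) * fst (snd h) + cos (\<alpha> + \<theta> * fst z) * snd (snd h)"
    have "(F has_derivative (\<lambda>h. (2 * \<theta> * (p z * ?n h + ?p h * n z)) +
        ((1 - fst z) / 2 * (n z * ?n h + ?n h * n z) + (0 - fst h) / 2 * (n z * n z)))) (at z)"
      unfolding F_def power2_eq_square mult.assoc[of "2 * \<theta>"]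
      by (intro has_derivative_add has_derivative_mult_right has_derivative_mult pd nd
          bounded_linear.has_derivative[OF bounded_linear_divide] has_derivative_diff has_derivative_const has_derivative_fst has_derivative_ident)
    then show ?thesis
      by (rule has_derivative_eq_rhs) (simp add: G_def inner_prod_def fun_eq_iff power2_eq_square field_simps)
  qed
  have G: "continuous_on UNIV G"
    unfolding G_def p_def n_def by (auto intro!: continuous_intros)
  note C = H1_chain_rule[OF \<gamma> F G order_refl zero_le_one order_refl]
  have le: "G (\<gamma> t) \<bullet> w t \<le> (norm (v t))\<^sup>2 - \<theta>\<^sup>2 * (norm (r t))\<^sup>2" if t: "t \<in> {0..1}" for t
  proof -
    define c s where "c = cos (\<alpha> + \<theta> * t)" and "s = sin (\<alpha> + \<theta> * t)"
    have cs: "s\<^sup>2 = 1 - c\<^sup>2" by (simp add: c_def s_def sin_squared_eq)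
    define vp vn where "vp = v t $ 1 * c + v t $ 2 * s" and "vn = v t $ 2 * c - v t $ 1 * s"
    define P N where "P = r t $ 1 * c + r t $ 2 * s" and "N = r t $ 2 * c - r t $ 1 * s"
    have v: "(norm (v t))\<^sup>2 = vp\<^sup>2 + vn\<^sup>2"
      unfolding norm_real2 vp_def vn_def power2_sum power2_diff power_mult_distrib cs by (simp add: algebra_simps)
    have r: "(norm (r t))\<^sup>2 = P\<^sup>2 + N\<^sup>2"
      unfolding norm_real2 P_def N_def power2_sum power2_diff power_mult_distrib cs by (simp add: algebra_simps)
    have g: "G (\<gamma> t) \<bullet> w t = 2 * \<theta>\<^sup>2 * (N\<^sup>2 - P\<^sup>2) - N\<^sup>2 / 2 - (1 - t) * \<theta> * N * P
        + 2 * \<theta> * (vp * N + P * vn) + (1 - t) * N * vn"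
      by (simp add: G_def \<gamma>_def w_def p_def n_def inner_prod_def c_def[symmetric] s_def[symmetric]
          P_def[symmetric] N_def[symmetric]) (simp add: vp_def vn_def algebra_simps)
    \<comment> \<open>The term 2 \<theta> p n alone would leave a deficit of 4 \<theta>^2 N^2. The
      term (1 - t) n^2 / 2 contributes N^2 / 2 against it, and completing the square takes back ((1
      - t)/2)^2 N^2. The balance is nonnegative because |\<theta>| \<le> 1/4.\<close>
    have th: "\<theta>\<^sup>2 \<le> 1/16" using \<theta> abs_le_square_iff[of \<theta> "1/4"] by (simp add: power2_eq_square)
    have m: "((1 - t)/2)\<^sup>2 \<le> 1/4" using t abs_le_square_iff[of "(1-t)/2" "1/2"] by (simp add: power2_eq_square)
    have "(norm (v t))\<^sup>2 - \<theta>\<^sup>2 * (norm (r t))\<^sup>2 - G (\<gamma> t) \<bullet> w t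
       = (vp - \<theta> * N)\<^sup>2 + (vn - \<theta> * P - (1 - t)/2 * N)\<^sup>2 + (1/2 - 4 * \<theta>\<^sup>2 - ((1 - t)/2)\<^sup>2) * N\<^sup>2"
      unfolding v r g by (simp add: power2_eq_square field_simps)
    also have "\<dots> \<ge> 0" using th m by (intro add_nonneg_nonneg mult_nonneg_nonneg) auto
    finally show ?thesis by simp
  qed
  \<comment> \<open>At t = 0 the path is on its line, so n = 0. At t = 1 the factor 1 - t vanishes
    and either alternative makes p n = 0. The increment is in fact 0.\<close>
  have "0 \<le> F (\<gamma> 1) - F (\<gamma> 0)"
    using r0 r1 by (auto simp: F_def \<gamma>_def p_def n_def)
  also have "\<dots> = (LINT t:{0..1}|lborel. G (\<gamma> t) \<bullet> w t)" by (rule C(2))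
  also have "\<dots> \<le> (LINT t:{0..1}|lborel. (norm (v t))\<^sup>2 - \<theta>\<^sup>2 * (norm (r t))\<^sup>2)"
  proof (rule set_integral_mono[OF C(1) _ le])
    have "set_integrable lborel {0..1} (\<lambda>t. (norm (r t))\<^sup>2)"
      by (intro borel_integrable_atLeastAtMost' continuous_intros H1_derivative_continuous[OF r])
    then show "set_integrable lborel {0..1} (\<lambda>t. (norm (v t))\<^sup>2 - \<theta>\<^sup>2 * (norm (r t))\<^sup>2)"
      using H1_derivative_norm_square_integrable[OF r] by (intro set_integral_diff) simp_all
  qed
  finally show ?thesis .
qed

section \<open>Kepler paths through a collision\<close>

definition kepler_primitive :: "real \<Rightarrow> real \<Rightarrow> real \<Rightarrow> real" where
  "kepler_primitive M \<epsilon> \<rho> = (let y = sqrt (sqrt (\<rho>\<^sup>2 + \<epsilon>\<^sup>2)) in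
     sqrt 2 * (y - y ^ 3 / (6 * M) - y ^ 5 / (10 * M\<^sup>2)))"

text \<open>At the upper end y^2 = M, and 1 - 1/6 - 1/10 = 11/15. At the lower end
  \<open>\<epsilon> = m / 1600\<close> costs at most 1/40, as sqrt 1600 = 40. The product of sqrt 2
  and 11/15 - 1/40 just exceeds 1. The smoothing is there because the chain rule requires
  differentiability at the collision too.\<close>

lemma kepler_primitive_gap:
  assumes m: "m > 0" and e: "\<epsilon> = m / 1600" and M: "M = sqrt (m\<^sup>2 + \<epsilon>\<^sup>2)"
  shows "kepler_primitive M \<epsilon> m - kepler_primitive M \<epsilon> 0 \<ge> sqrt M"
proof -
  have e0: "\<epsilon> > 0" using m e by simp
  have mM: "m \<le> M" unfolding M by (rule real_le_rsqrt) simp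
  have M0: "M > 0" using m mM by simp
  have s2: "sqrt 2 \<ge> 1.414" by (rule real_le_rsqrt) (simp add: power2_eq_square)
  define Y where "Y = sqrt M"
  have Y: "Y\<^sup>2 = M" "Y > 0" using M0 by (auto simp: Y_def)
  have Y3: "Y ^ 3 = M * Y" "Y ^ 5 = M\<^sup>2 * Y" using Y by (auto simp: power2_eq_square eval_nat_numeral)
  have 1: "kepler_primitive M \<epsilon> m = sqrt 2 * (11 / 15 * Y)"
    unfolding kepler_primitive_def Let_def M[symmetric] Y_def[symmetric] Y3
    using M0 by (simp add: field_simps)
  have se: "sqrt \<epsilon> \<le> Y / 40"
  proof -
    have "sqrt 1600 = (40::real)" by (rule real_sqrt_unique) auto
    then have "sqrt \<epsilon> = sqrt m / 40" unfolding e real_sqrt_divide by simp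
    also have "\<dots> \<le> Y / 40" using mM by (simp add: Y_def)
    finally show ?thesis .
  qed
  have "kepler_primitive M \<epsilon> 0 = sqrt 2 * (sqrt \<epsilon> - (sqrt \<epsilon>) ^ 3 / (6 * M) - (sqrt \<epsilon>) ^ 5 / (10 * M\<^sup>2))"
    using e0 by (simp add: kepler_primitive_def Let_def)
  also have "\<dots> \<le> sqrt 2 * (sqrt \<epsilon> - 0 - 0)"
    using e0 M0 by (intro mult_left_mono diff_mono order_refl) auto
  also have "\<dots> \<le> sqrt 2 * (Y / 40)" using se by (intro mult_left_mono) auto
  finally have 2: "kepler_primitive M \<epsilon> 0 \<le> sqrt 2 * (Y / 40)" .
  have "Y * 1 \<le> Y * (sqrt 2 * (11/15 - 1/40))" using s2 Y by (intro mult_left_mono) auto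
  then show ?thesis using 1 2 unfolding Y_def[symmetric] by (simp add: algebra_simps)
qed

text \<open>Since \<open>1 / 0 = 0\<close>, integrability of \<open>1 / norm (r t)\<close> alone
  would admit a path resting at a collision; the almost-everywhere condition excludes this.\<close>

definition pair_path :: "(real \<Rightarrow> 'a::euclidean_space) \<Rightarrow> (real \<Rightarrow> 'a) \<Rightarrow> bool" where
  "pair_path r v \<longleftrightarrow> H1_derivative r v \<and> (AE t\<in>{0..1} in lborel. r t \<noteq> 0) \<and>
     set_integrable lborel {0..1} (\<lambda>t. 1 / norm (r t))"

definition pair_action :: "(real \<Rightarrow> 'a::euclidean_space) \<Rightarrow> (real \<Rightarrow> 'a) \<Rightarrow> real" where
  "pair_action r v = (LINT t:{0..1}|lborel. (norm (v t))\<^sup>2 / 8 + 1 / norm (r t))"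

lemma pair_action_integrable:
  assumes "pair_path r v"
  shows "set_integrable lborel {0..1} (\<lambda>t. (norm (v t))\<^sup>2 / 8 + 1 / norm (r t))"
  using assms unfolding pair_path_def
  by (intro set_integral_add set_integrable_divide H1_derivative_norm_square_integrable) auto

text \<open>Along the path, \<open>kepler_primitive M \<epsilon> |r|\<close> varies at most at the rate
  \<open>|r'|\<^sup>2/8 + 1/|r| - 1/M\<close> by the inequality of arithmetic and geometric means. Without the regularization
  \<open>\<epsilon>\<close>, the primitive of \<open>sqrt ((1/\<rho> - 1/M)/2)\<close> would be optimal; the polynomial comes from replacing
  \<open>sqrt (1 - s)\<close>, \<open>s = \<rho>/M\<close>, by its minorant \<open>(1 - s)(1 + s/2)\<close>.\<close>

proposition pair_action_ge_variation:
  fixes r v :: "real \<Rightarrow> 'a::euclidean_space"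
  assumes r: "pair_path r v" and e: "\<epsilon> > 0" and M: "M > 0"
    and rM: "\<And>t. t \<in> {0..1} \<Longrightarrow> (norm (r t))\<^sup>2 + \<epsilon>\<^sup>2 \<le> M\<^sup>2"
    and s: "s \<in> {0..1}" "s' \<in> {0..1}"
  shows "pair_action r v \<ge> 1 / M + \<bar>kepler_primitive M \<epsilon> (norm (r s)) - kepler_primitive M \<epsilon> (norm (r s'))\<bar>"
  using s
proof (induction s s' rule: linorder_wlog)
  case (sym a b)
  then show ?case by (simp add: abs_minus_commute)
next
  case (le s s')
  have H: "H1_derivative r v" and ae: "AE t\<in>{0..1} in lborel. r t \<noteq> 0" using r by (auto simp: pair_path_def)
  define y where "y x = sqrt (sqrt (x \<bullet> x + \<epsilon>\<^sup>2))" for x :: 'a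
  define F where "F x = sqrt 2 * (y x - y x ^ 3 / (6 * M) - y x ^ 5 / (10 * M\<^sup>2))" for x
  \<comment> \<open>The gradient of \<open>F\<close> at \<open>x\<close> is
    \<open>k x *\<^sub>R x\<close>; it is continuous even at the origin because \<open>y\<close>
    stays positive.\<close>
  define k where "k x = sqrt 2 * (1 - (y x)\<^sup>2 / (2 * M) - y x ^ 4 / (2 * M\<^sup>2)) / (2 * y x ^ 3)" for x
  have pos: "x \<bullet> x + \<epsilon>\<^sup>2 > 0" for x :: 'a using e by (simp add: add_nonneg_pos)
  have y0: "y x > 0" for x using pos by (simp add: y_def)
  have y2: "(y x)\<^sup>2 = sqrt (x \<bullet> x + \<epsilon>\<^sup>2)" for x using pos[of x] by (simp add: y_def)
  have F_eq: "F x = kepler_primitive M \<epsilon> (norm x)" for x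
    by (simp add: F_def y_def kepler_primitive_def Let_def power2_norm_eq_inner)
  have yd: "(y has_derivative (\<lambda>h. (x \<bullet> h) / (2 * y x ^ 3))) (at x)" for x
  proof -
    have "(y has_derivative (\<lambda>h. (2 * (x \<bullet> h)) * inverse (sqrt (x \<bullet> x + \<epsilon>\<^sup>2)) / 2 * inverse (sqrt (sqrt (x \<bullet> x + \<epsilon>\<^sup>2))) / 2)) (at x)"
      unfolding y_def using pos[of x]
      by (auto intro!: derivative_eq_intros simp: inner_commute algebra_simps)
    then show ?thesis
      by (rule has_derivative_eq_rhs)
        (use y0[of x] in \<open>simp add: fun_eq_iff y2[symmetric] flip: y_def, simp add: field_simps eval_nat_numeral\<close>)
  qed
  have F: "(F has_derivative (\<lambda>h. (k x *\<^sub>R x) \<bullet> h)) (at x)" for x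
  proof -
    have "(F has_derivative (\<lambda>h. sqrt 2 * ((x \<bullet> h) / (2 * y x ^ 3) - 3 * (x \<bullet> h) / (2 * y x ^ 3) * (y x)\<^sup>2 / (6 * M)
        - 5 * (x \<bullet> h) / (2 * y x ^ 3) * y x ^ 4 / (10 * M\<^sup>2)))) (at x)"
      unfolding F_def using M
      by (auto intro!: derivative_eq_intros yd simp: algebra_simps fun_eq_iff)
        (simp add: field_simps power2_eq_square power4_eq_xxxx)
    then show ?thesis
      by (rule has_derivative_eq_rhs) (use M y0[of x] in \<open>auto simp: fun_eq_iff k_def field_simps\<close>)
  qed
  have "continuous_on UNIV y" using has_derivative_continuous[OF yd] by (simp add: continuous_at_imp_continuous_on)
  then have kc: "continuous_on UNIV (\<lambda>x. k x *\<^sub>R x)"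
    unfolding k_def using M y0 by (intro continuous_intros) (auto simp: less_le)
  have b: "\<bar>(k x *\<^sub>R x) \<bullet> u\<bar> \<le> (norm u)\<^sup>2 / 8 + (1 / norm x - 1 / M)" and b0: "0 \<le> 1 / norm x - 1 / M"
    if x: "x \<noteq> 0" "(norm x)\<^sup>2 + \<epsilon>\<^sup>2 \<le> M\<^sup>2" for x u
  proof -
    define Y where "Y = y x"
    have Y0: "Y > 0" using y0 by (simp add: Y_def)
    have Y2: "Y\<^sup>2 = sqrt ((norm x)\<^sup>2 + \<epsilon>\<^sup>2)" using y2 by (simp add: Y_def power2_norm_eq_inner)
    have nY: "norm x \<le> Y\<^sup>2" unfolding Y2 by (rule real_le_rsqrt) simp
    have YM: "Y\<^sup>2 \<le> M" unfolding Y2 using x M by (intro real_le_lsqrt) auto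
    define \<sigma> where "\<sigma> = Y\<^sup>2 / M"
    have \<sigma>: "0 \<le> \<sigma>" "\<sigma> \<le> 1" using Y0 YM M by (auto simp: \<sigma>_def)
    have kx: "k x = sqrt 2 * ((1 - \<sigma>) * (1 + \<sigma>/2)) / (2 * Y ^ 3)"
      unfolding k_def Y_def[symmetric] \<sigma>_def using M Y0
      by (simp add: power2_eq_square field_simps eval_nat_numeral)
    define q where "q = (1 - \<sigma>) * (1 + \<sigma>/2) / (sqrt 2 * Y)"
    have q0: "q \<ge> 0" using \<sigma> Y0 by (auto simp: q_def)
    have kq: "k x * Y\<^sup>2 = q"
      using Y0 unfolding kx q_def by (simp add: field_simps eval_nat_numeral)
    have k0: "k x \<ge> 0" using \<sigma> Y0 unfolding kx by auto
    have "\<bar>(k x *\<^sub>R x) \<bullet> u\<bar> \<le> k x * norm x * norm u"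
      using Cauchy_Schwarz_ineq2[of "k x *\<^sub>R x" u] k0 by simp
    also have "\<dots> \<le> k x * Y\<^sup>2 * norm u" using nY k0 by (intro mult_right_mono mult_left_mono) auto
    also have "\<dots> = q * norm u" by (simp add: kq)
    \<comment> \<open>Arithmetic and geometric means, balanced so that the first term is the kinetic
      energy of a pair.\<close>
    also have "\<dots> \<le> (norm u)\<^sup>2 / 8 + 2 * q\<^sup>2"
      using zero_le_power2[of "norm u - 4 * q"] by (simp add: power2_diff power2_eq_square field_simps)
    also have "2 * q\<^sup>2 = (1 - \<sigma>) * ((1 - \<sigma>) * (1 + \<sigma>/2)\<^sup>2) / Y\<^sup>2"
      using Y0 by (simp add: q_def power_mult_distrib power_divide) (simp add: power2_eq_square field_simps)
    also have "\<dots> \<le> (1 - \<sigma>) * 1 / Y\<^sup>2"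
    proof (intro divide_right_mono mult_left_mono)
      \<comment> \<open>The square of (1 - \<sigma>)(1 + \<sigma>/2) \<le> sqrt (1 - \<sigma>), with
        one factor 1 - \<sigma> cancelled.\<close>
      have "(1 - \<sigma>) * (1 + \<sigma>/2)\<^sup>2 = 1 - 3/4 * \<sigma>\<^sup>2 - \<sigma>\<^sup>2 * \<sigma> / 4" by (simp add: power2_eq_square field_simps)
      also have "\<dots> \<le> 1" using \<sigma>(1) mult_nonneg_nonneg[OF zero_le_power2[of \<sigma>] \<sigma>(1)] zero_le_power2[of \<sigma>]
        by linarith
      finally show "(1 - \<sigma>) * (1 + \<sigma>/2)\<^sup>2 \<le> 1" .
    qed (use \<sigma> in auto)
    also have "(1 - \<sigma>) * 1 / Y\<^sup>2 = 1 / Y\<^sup>2 - 1 / M" using Y0 M by (simp add: \<sigma>_def field_simps)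
    also have "\<dots> \<le> 1 / norm x - 1 / M" using nY x Y0 by (intro diff_right_mono divide_left_mono) auto
    finally show "\<bar>(k x *\<^sub>R x) \<bullet> u\<bar> \<le> (norm u)\<^sup>2 / 8 + (1 / norm x - 1 / M)" by simp
    show "0 \<le> 1 / norm x - 1 / M" using nY YM x M by (auto intro!: divide_left_mono)
  qed
  have s: "0 \<le> s" "s \<le> s'" "s' \<le> 1" using le by auto
  note C = H1_chain_rule[OF H F kc s]
  have iM: "set_integrable lborel {0..1::real} (\<lambda>_. 1 / M)" by (rule set_integrable_const_Icc)
  have I: "set_integrable lborel {0..1} (\<lambda>t. ((norm (v t))\<^sup>2 / 8 + 1 / norm (r t)) - 1 / M)"
    by (intro set_integral_diff(1) pair_action_integrable[OF r] iM)
  have "\<bar>F (r s') - F (r s)\<bar> \<le> (LINT t:{s..s'}|lborel. norm ((k (r t) *\<^sub>R r t) \<bullet> v t))"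
    unfolding C(2) using set_integral_norm_bound[OF C(1)] by simp
  \<comment> \<open>The rate on the right is nonnegative by \<open>b0\<close>, so the interval may
    grow to all of {0..1}. This yields the full 1/M wherever \<open>s\<close> and \<open>s'\<close>
    lie.\<close>
  also have "\<dots> \<le> (LINT t:{0..1}|lborel. ((norm (v t))\<^sup>2 / 8 + 1 / norm (r t)) - 1 / M)"
    unfolding set_lebesgue_integral_def
  proof (rule integral_mono_AE)
    show "integrable lborel (\<lambda>t. indicator {s..s'} t *\<^sub>R norm ((k (r t) *\<^sub>R r t) \<bullet> v t))"
      using set_integrable_norm[OF C(1)] unfolding set_integrable_def .
    show "integrable lborel (\<lambda>t. indicator {0..1} t *\<^sub>R (((norm (v t))\<^sup>2 / 8 + 1 / norm (r t)) - 1 / M))"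
      using I unfolding set_integrable_def .
    show "AE t in lborel. indicator {s..s'} t *\<^sub>R norm ((k (r t) *\<^sub>R r t) \<bullet> v t)
        \<le> indicator {0..1} t *\<^sub>R (((norm (v t))\<^sup>2 / 8 + 1 / norm (r t)) - 1 / M)"
      using ae
    proof eventually_elim
      case (elim t)
      show ?case
      proof (cases "t \<in> {0..1}")
        case True
        then have "r t \<noteq> 0" using elim by simp
        note bb = b[OF this rM[OF True], of "v t"] b0[OF this rM[OF True]]
        have "0 \<le> (norm (v t))\<^sup>2 / 8" by simp
        then show ?thesis using True bb by (auto split: split_indicator)
      next
        case False
        then show ?thesis using s by (auto split: split_indicator)
      qed
    qed
  qed
  also have "\<dots> = pair_action r v - 1 / M"
    unfolding pair_action_def
    using pair_action_integrable[OF r] iM set_integral_const_Icc[of 0 1 "1 / M"] by (subst set_integral_diff(2)) simp_all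
  finally show ?case by (simp add: F_eq)
qed

lemma pair_path_continuous: "pair_path r v \<Longrightarrow> continuous_on {0..1} r"
  unfolding pair_path_def by (auto intro: H1_derivative_continuous)

lemma pair_path_nonzero:
  assumes "pair_path r v"
  obtains t where "t \<in> {0..1}" "r t \<noteq> 0"
proof -
  have False if 0: "\<And>t. t \<in> {0..1} \<Longrightarrow> r t = 0"
  proof -
    have "AE t\<in>{0..1} in lborel. r t \<noteq> 0" using assms by (simp add: pair_path_def)
    then have "AE t in lborel. indicator {0..1::real} t = (0::real)"
      by eventually_elim (use 0 in auto)
    then have "(LINT t|lborel. indicator {0..1::real} t :: real) = 0" by (rule integral_eq_zero_AE)
    then show False by simp
  qed
  then show ?thesis using that by blast
qed

text \<open>With y = sqrt M, the functions y + 1/y^2 and y + 4/y^2 have their minima at the cube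
  root of 2 and at 2. The cofactors make the linear terms of the cubics vanish. As 1.256 lies
  slightly below the cube root of 2, the first cubic has a constant term just below 1; the second is
  exact.\<close>

lemma one_plus_sqrt_bound:
  fixes M :: real
  assumes "M > 0"
  shows "1 / M + sqrt M \<ge> 1.884" and "4 / M + sqrt M \<ge> 3"
proof -
  define y where "y = sqrt M"
  have y: "y > 0" "M = y\<^sup>2" using assms by (auto simp: y_def)
  have "0 \<le> (y - 1.256)\<^sup>2 * (y + 0.628)" using y by simp
  then show "1 / M + sqrt M \<ge> 1.884"
    unfolding y_def[symmetric] y(2) using y by (simp add: field_simps power2_eq_square)
  have "0 \<le> (y - 2)\<^sup>2 * (y + 1)" using y by simp
  then show "4 / M + sqrt M \<ge> 3"
    unfolding y_def[symmetric] y(2) using y by (simp add: field_simps power2_eq_square)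
qed

text \<open>The variation is measured between the collision and a time of maximal distance
  \<open>m\<close>. The size of \<open>m\<close> is unknown, so the constant is the minimum over all
  M.\<close>

proposition pair_action_collision:
  assumes r: "pair_path r v" and s: "s \<in> {0..1}" "r s = 0"
  shows "pair_action r v \<ge> 1.884"
proof -
  have "continuous_on {0..1} (\<lambda>t. norm (r t))"
    by (intro continuous_on_norm pair_path_continuous[OF r])
  from continuous_attains_sup[OF compact_Icc _ this]
  obtain t1 where t1: "t1 \<in> {0..1}" "\<And>t. t \<in> {0..1} \<Longrightarrow> norm (r t) \<le> norm (r t1)" by auto
  define m where "m = norm (r t1)"
  obtain t where "t \<in> {0..1}" "r t \<noteq> 0" using pair_path_nonzero[OF r] .
  then have m: "m > 0" using t1(2)[of t] unfolding m_def by (metis order_less_le_trans zero_less_norm_iff)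
  define \<epsilon> M where "\<epsilon> = m / 1600" and "M = sqrt (m\<^sup>2 + \<epsilon>\<^sup>2)"
  have e: "\<epsilon> > 0" using m by (simp add: \<epsilon>_def)
  have M: "M > 0" "M\<^sup>2 = m\<^sup>2 + \<epsilon>\<^sup>2" using m by (auto simp: M_def add_pos_nonneg)
  have "(norm (r t))\<^sup>2 + \<epsilon>\<^sup>2 \<le> M\<^sup>2" if "t \<in> {0..1}" for t
    unfolding M using t1(2)[OF that] by (auto simp: m_def intro: power_mono)
  from pair_action_ge_variation[OF r e M(1) this s(1) t1(1)]
  have "pair_action r v \<ge> 1 / M + \<bar>kepler_primitive M \<epsilon> 0 - kepler_primitive M \<epsilon> m\<bar>"
    using s(2) by (simp add: m_def)
  moreover have "kepler_primitive M \<epsilon> m - kepler_primitive M \<epsilon> 0 \<ge> sqrt M"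
    by (rule kepler_primitive_gap[OF m \<epsilon>_def M_def])
  ultimately show ?thesis using one_plus_sqrt_bound(1)[OF M(1)] by linarith
qed

text \<open>Four paths linked at their ends in a cycle \<open>a \<rightarrow> b \<rightarrow> c \<rightarrow> d \<rightarrow> a\<close> behave like a single path of
  duration 4.\<close>

proposition pair_action_collision_cycle:
  assumes pp: "pair_path a va" "pair_path b vb" "pair_path c vc" "pair_path d vd"
    and link: "norm (a 0) = norm (b 0)" "norm (b 1) = norm (c 1)" "norm (c 0) = norm (d 0)" "norm (d 1) = norm (a 1)"
    and s: "s \<in> {0..1}" "a s = 0"
  shows "pair_action a va + pair_action b vb + pair_action c vc + pair_action d vd \<ge> 3"
proof -
  define f where "f t = max (max (norm (a t)) (norm (b t))) (max (norm (c t)) (norm (d t)))" for t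
  have "continuous_on {0..1} f"
    unfolding f_def by (intro continuous_on_max continuous_on_norm pair_path_continuous[OF pp(1)] pair_path_continuous[OF pp(2)]
        pair_path_continuous[OF pp(3)] pair_path_continuous[OF pp(4)])
  from continuous_attains_sup[OF compact_Icc _ this]
  obtain t1 where t1: "t1 \<in> {0..1}" "\<And>t. t \<in> {0..1} \<Longrightarrow> f t \<le> f t1" by auto
  have fge: "norm (a t) \<le> f t" "norm (b t) \<le> f t" "norm (c t) \<le> f t" "norm (d t) \<le> f t" for t
    by (simp_all add: f_def)
  define m where "m = f t1"
  obtain t where "t \<in> {0..1}" "a t \<noteq> 0" using pair_path_nonzero[OF pp(1)] .
  then have m: "m > 0" using t1(2)[of t] zero_less_norm_iff[of "a t"] fge[of t] unfolding m_def by linarith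
  define \<epsilon> M where "\<epsilon> = m / 1600" and "M = sqrt (m\<^sup>2 + \<epsilon>\<^sup>2)"
  have e: "\<epsilon> > 0" using m by (simp add: \<epsilon>_def)
  have M: "M > 0" "M\<^sup>2 = m\<^sup>2 + \<epsilon>\<^sup>2" using m by (auto simp: M_def add_pos_nonneg)
  have le: "norm (a t) \<le> m" "norm (b t) \<le> m" "norm (c t) \<le> m" "norm (d t) \<le> m" if "t \<in> {0..1}" for t
    using t1(2)[OF that] fge[of t] unfolding m_def by linarith+
  have le2: "(norm (a t))\<^sup>2 + \<epsilon>\<^sup>2 \<le> M\<^sup>2" "(norm (b t))\<^sup>2 + \<epsilon>\<^sup>2 \<le> M\<^sup>2" "(norm (c t))\<^sup>2 + \<epsilon>\<^sup>2 \<le> M\<^sup>2" "(norm (d t))\<^sup>2 + \<epsilon>\<^sup>2 \<le> M\<^sup>2"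
    if "t \<in> {0..1}" for t
    unfolding M using le[OF that] by (auto intro: power_mono)
  define K where "K = kepler_primitive M \<epsilon>"
  have var1: "pair_action a va \<ge> 1 / M + \<bar>K (norm (a s)) - K (norm (a s'))\<bar>" if "s \<in> {0..1}" "s' \<in> {0..1}" for s s'
    unfolding K_def by (rule pair_action_ge_variation[OF pp(1) e M(1) le2(1) that])
  have var2: "pair_action b vb \<ge> 1 / M + \<bar>K (norm (b s)) - K (norm (b s'))\<bar>" if "s \<in> {0..1}" "s' \<in> {0..1}" for s s'
    unfolding K_def by (rule pair_action_ge_variation[OF pp(2) e M(1) le2(2) that])
  have var3: "pair_action c vc \<ge> 1 / M + \<bar>K (norm (c s)) - K (norm (c s'))\<bar>" if "s \<in> {0..1}" "s' \<in> {0..1}" for s s'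
    unfolding K_def by (rule pair_action_ge_variation[OF pp(3) e M(1) le2(3) that])
  have var4: "pair_action d vd \<ge> 1 / M + \<bar>K (norm (d s)) - K (norm (d s'))\<bar>" if "s \<in> {0..1}" "s' \<in> {0..1}" for s s'
    unfolding K_def by (rule pair_action_ge_variation[OF pp(4) e M(1) le2(4) that])
  have I: "(0::real) \<in> {0..1}" "(1::real) \<in> {0..1}" by auto
  have gap: "K m - K 0 \<ge> sqrt M" unfolding K_def by (rule kepler_primitive_gap[OF m \<epsilon>_def M_def])
  have a_s: "norm (a s) = 0" using s by simp
  have att: "norm (a t1) = m \<or> norm (b t1) = m \<or> norm (c t1) = m \<or> norm (d t1) = m"
    unfolding m_def f_def by (auto simp: max_def)
  have q4: "4 / M = 4 * (1 / M)" by simp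
  \<comment> \<open>The variations add up along the chain from the collision to the maximum, because
    the links make the norms agree at the joints. Each of the four paths also pays its own 1/M, and
    a path off the chain is charged only that.\<close>
  have "pair_action a va + pair_action b vb + pair_action c vc + pair_action d vd \<ge> 4 / M + (K m - K 0)"
    using att
  proof (elim disjE)
    assume at: "norm (a t1) = m"
    show ?thesis
      using var1[OF s(1) t1(1)] var2[OF I] var3[OF I] var4[OF I] unfolding a_s link at q4 by linarith
  next
    assume at: "norm (b t1) = m"
    show ?thesis
      using var1[OF s(1) I(1)] var2[OF I(1) t1(1)] var3[OF I] var4[OF I] link unfolding a_s link at q4 by linarith
  next
    assume at: "norm (c t1) = m"
    show ?thesis
      using var1[OF s(1) I(1)] var2[OF I] var3[OF I(2) t1(1)] var4[OF I] link unfolding a_s link at q4 by linarith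
  next
    assume at: "norm (d t1) = m"
    show ?thesis
      using var1[OF s(1) I(2)] var2[OF I] var3[OF I] var4[OF I(2) t1(1)] link unfolding a_s link at q4 by linarith
  qed
  then show ?thesis using gap one_plus_sqrt_bound(2)[OF M(1)] by linarith
qed

section \<open>Comparison with uniform circular motion\<close>

lemma inverse_ge_tangent:
  fixes n R :: real
  assumes "n > 0" "R > 0"
  shows "1 / n \<ge> 3 / (2 * R) - n\<^sup>2 / (2 * R ^ 3)"
proof -
  have "1 / n - (3 / (2 * R) - n\<^sup>2 / (2 * R ^ 3)) = (n - R)\<^sup>2 * (n + 2 * R) / (2 * n * R ^ 3)"
    using assms by (simp add: field_simps power2_eq_square eval_nat_numeral)
  also have "\<dots> \<ge> 0" using assms by auto
  finally show ?thesis by simp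
qed

lemma pair_rotation_integrable:
  assumes "H1_derivative r v"
  shows "set_integrable lborel {0..1} (\<lambda>t. (norm (v t))\<^sup>2 - \<theta>\<^sup>2 * (norm (r t))\<^sup>2)"
proof -
  have "set_integrable lborel {0..1} (\<lambda>t. (norm (r t))\<^sup>2)"
    by (intro borel_integrable_atLeastAtMost' continuous_on_power continuous_on_norm H1_derivative_continuous[OF assms])
  then show ?thesis using H1_derivative_norm_square_integrable[OF assms] by (intro set_integral_diff) simp_all
qed

text \<open>The constant 3/(2R) is the value on the circular motion: 1/(2R) kinetic plus 1/R
  potential. The integral is kept as a remainder because its sign is unknown for a cross pair, where
  only the sum of four remainders can be estimated.\<close>

proposition pair_action_ge_rotation:
  assumes r: "pair_path r v" and R: "R > 0" "\<theta>\<^sup>2 * R ^ 3 = 4"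
  shows "pair_action r v \<ge> 3 / (2 * R) + (LINT t:{0..1}|lborel. (norm (v t))\<^sup>2 - \<theta>\<^sup>2 * (norm (r t))\<^sup>2) / 8"
proof -
  have H: "H1_derivative r v" and ae: "AE t\<in>{0..1} in lborel. r t \<noteq> 0" using r by (auto simp: pair_path_def)
  have c: "set_integrable lborel {0..1::real} (\<lambda>t. 3 / (2 * R))" by (rule set_integrable_const_Icc)
  have d: "set_integrable lborel {0..1} (\<lambda>t. ((norm (v t))\<^sup>2 - \<theta>\<^sup>2 * (norm (r t))\<^sup>2) / 8)"
    by (intro set_integrable_divide pair_rotation_integrable[OF H])
  have "3 / (2 * R) + (LINT t:{0..1}|lborel. (norm (v t))\<^sup>2 - \<theta>\<^sup>2 * (norm (r t))\<^sup>2) / 8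
      = (LINT t:{0..1}|lborel. 3 / (2 * R) + ((norm (v t))\<^sup>2 - \<theta>\<^sup>2 * (norm (r t))\<^sup>2) / 8)"
    using set_integral_const_Icc[of 0 1 "3 / (2 * R)"] by (subst set_integral_add(2)[OF c d]) simp
  also have "\<dots> \<le> pair_action r v"
    unfolding pair_action_def
  proof (rule set_integral_mono_AE[OF set_integral_add(1)[OF c d] pair_action_integrable[OF r]])
    show "AE t\<in>{0..1} in lborel. 3 / (2 * R) + ((norm (v t))\<^sup>2 - \<theta>\<^sup>2 * (norm (r t))\<^sup>2) / 8
        \<le> (norm (v t))\<^sup>2 / 8 + 1 / norm (r t)"
      using ae
    proof eventually_elim
      case (elim t)
      show ?case
      proof
        assume "t \<in> {0..1}"
        then have "norm (r t) > 0" using elim by simp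
        from inverse_ge_tangent[OF this R(1)]
        have "1 / norm (r t) \<ge> 3 / (2 * R) - (norm (r t))\<^sup>2 / (2 * R ^ 3)" .
        moreover have "1 / (2 * R ^ 3) = \<theta>\<^sup>2 / 8" using R by (simp add: field_simps)
        then have "(norm (r t))\<^sup>2 / (2 * R ^ 3) = \<theta>\<^sup>2 * (norm (r t))\<^sup>2 / 8"
          by (metis (no_types, opaque_lifting) mult.commute mult_1 times_divide_eq_left)
        ultimately show "3 / (2 * R) + ((norm (v t))\<^sup>2 - \<theta>\<^sup>2 * (norm (r t))\<^sup>2) / 8
            \<le> (norm (v t))\<^sup>2 / 8 + 1 / norm (r t)" by (simp add: field_simps)
      qed
    qed
  qed
  finally show ?thesis .
qed

section \<open>The action of the four-body problem\<close>

lemma vector_4 [simp]: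
  "(vector [x, y, z, w] :: ('a::zero)^4) $ 1 = x"
  "(vector [x, y, z, w] :: 'a^4) $ 2 = y"
  "(vector [x, y, z, w] :: 'a^4) $ 3 = z"
  "(vector [x, y, z, w] :: 'a^4) $ 4 = w"
  unfolding vector_def by simp_all

text \<open>In the index type the numeral \<open>4\<close> equals \<open>0\<close> and is the least
  element, so body 4 comes first in its pairs.\<close>

lemma less_pairs_4: "{(i::4, j::4). i < j} = {(4,1),(4,2),(4,3),(1,2),(1,3),(2,3)}"
proof -
  have "(0::4) < 1" "(0::4) < 2" "(0::4) < 3" and l: "(1::4) < 2" "(1::4) < 3" "(2::4) < 3"
    by (simp_all add: less_bit0_def bit0.Rep_0 bit0.Rep_1 bit0.Rep_numeral)
  moreover have "(0::4) = 4" by simp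
  ultimately have l4: "(4::4) < 1" "(4::4) < 2" "(4::4) < 3" by metis+
  have n: "\<not> (2::4) < 1" "\<not> (3::4) < 1" "\<not> (3::4) < 2" "\<not> (1::4) < 4" "\<not> (2::4) < 4" "\<not> (3::4) < 4"
    using l l4 by (meson less_asym)+
  have "(i < j) = ((i, j) \<in> {(4,1),(4,2),(4,3),(1,2),(1,3),(2,3)})" for i j :: 4
    using exhaust_4[of i] exhaust_4[of j] l l4 n by (elim disjE) simp_all
  then show ?thesis by (auto simp only: mem_Collect_eq split_beta prod.collapse)
qed

lemma potential_eq:
  "potential q = 1 / ennreal (norm (q $ 2 - q $ 1)) + 1 / ennreal (norm (q $ 3 - q $ 4))
     + 1 / ennreal (norm (q $ 3 - q $ 1)) + 1 / ennreal (norm (q $ 4 - q $ 1))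
     + 1 / ennreal (norm (q $ 3 - q $ 2)) + 1 / ennreal (norm (q $ 4 - q $ 2))"
  unfolding potential_def less_pairs_4 by (simp add: norm_minus_commute ac_simps)

lemma potential_ge_pair:
  assumes "i \<noteq> j"
  shows "1 / ennreal (norm (q $ j - q $ i)) \<le> potential q"
proof -
  have fin: "finite {(i::4, j::4). i < j}" unfolding less_pairs_4 by simp
  have *: "1 / ennreal (norm (q $ i - q $ j)) \<le> potential q" if "i < j" for i j :: 4
  proof -
    have "(\<Sum>(i, j)\<in>{(i, j)}. 1 / ennreal (norm (q $ i - q $ j))) \<le> potential q"
      unfolding potential_def by (rule sum_mono2[OF fin]) (use that in auto)
    then show ?thesis by simp
  qed
  show ?thesis using assms *[of i j] *[of j i] by (metis linorder_neqE norm_minus_commute)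
qed

text \<open>Strict at x = 0, where the real quotient is 0 and the extended one infinite.\<close>

lemma ennreal_inverse_le: "ennreal (1 / x) \<le> 1 / ennreal x" if "x \<ge> 0"
proof (cases "x = 0")
  case False
  then show ?thesis using that by (simp add: divide_ennreal flip: ennreal_1)
qed simp

lemma nn_integral_ge_integral:
  fixes f :: "real \<Rightarrow> real"
  assumes f: "set_integrable lborel A f" and le: "\<And>t. t \<in> A \<Longrightarrow> ennreal (f t) \<le> g t"
  shows "ennreal (LINT t:A|lborel. f t) \<le> (\<integral>\<^sup>+t\<in>A. g t \<partial>lborel)"
proof -
  let ?h = "\<lambda>t. indicator A t *\<^sub>R f t"
  have i: "integrable lborel ?h" using f unfolding set_integrable_def .
  have "ennreal (LINT t:A|lborel. f t) \<le> ennreal (LINT t|lborel. max 0 (?h t))"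
    unfolding set_lebesgue_integral_def using i by (intro ennreal_leI integral_mono) auto
  also have "\<dots> = (\<integral>\<^sup>+t. ennreal (max 0 (?h t)) \<partial>lborel)"
    using i by (intro nn_integral_eq_integral[symmetric]) auto
  also have "\<dots> \<le> (\<integral>\<^sup>+t\<in>A. g t \<partial>lborel)"
    using le by (intro nn_integral_mono) (auto split: split_indicator simp: max_def ennreal_neg)
  finally show ?thesis .
qed

lemma bounded_linear_vec_nth_diff: "bounded_linear (\<lambda>q::'a::euclidean_space^'n. q $ j - q $ i)"
  by (intro bounded_linear_sub bounded_linear_vec_nth)

lemma H1_derivative_diff_nth:
  fixes q :: "real \<Rightarrow> config"
  assumes "H1_derivative q v"
  shows "H1_derivative (\<lambda>t. q t $ j - q t $ i) (\<lambda>t. v t $ j - v t $ i)"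
  using H1_derivative_linear[OF assms bounded_linear_vec_nth_diff] .

lemma pair_path_of_finite_action:
  assumes q: "H1_derivative q v" and fin: "action q < \<infinity>" and ij: "i \<noteq> j"
  shows "pair_path (\<lambda>t. q t $ j - q t $ i) (\<lambda>t. v t $ j - v t $ i)"
proof -
  let ?r = "\<lambda>t. q t $ j - q t $ i"
  have H: "H1_derivative ?r (\<lambda>t. v t $ j - v t $ i)" by (rule H1_derivative_diff_nth[OF q])
  have m0: "(\<lambda>t. indicator {0..1} t *\<^sub>R ?r t) \<in> borel_measurable lborel"
    using borel_measurable_continuous_on_indicator[OF _ H1_derivative_continuous[OF H]] by simp
  \<comment> \<open>Nothing is known of the path outside {0..1}. Cutting it off inside the
    reciprocal makes the function measurable, and the outer indicator removes the infinite values
    this creates.\<close>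
  let ?f = "\<lambda>t. 1 / ennreal (norm (indicator {0..1} t *\<^sub>R ?r t)) * indicator {0..1::real} t"
  have fm: "?f \<in> borel_measurable lborel" using m0 by measurable
  have "(\<integral>\<^sup>+t. ?f t \<partial>lborel) \<le> action q"
    unfolding action_def
  proof (intro nn_integral_mono)
    fix t :: real
    have "1 / ennreal (norm (?r t)) \<le> ennreal (1/2 * (\<Sum>i\<in>UNIV. (norm (weak_deriv q t $ i))\<^sup>2)) + potential (q t)"
      using potential_ge_pair[OF ij, of "q t"] by (rule order.trans) simp
    then show "?f t \<le> (ennreal (1/2 * (\<Sum>i\<in>UNIV. (norm (weak_deriv q t $ i))\<^sup>2)) + potential (q t)) * indicator {0..1} t"
      by (auto split: split_indicator)
  qed
  then have fi: "(\<integral>\<^sup>+t. ?f t \<partial>lborel) \<noteq> \<infinity>" using fin by (auto simp: top_unique)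
  from nn_integral_PInf_AE[OF fm fi] have "AE t\<in>{0..1} in lborel. ?r t \<noteq> 0"
    by (eventually_elim) (auto split: split_indicator_asm)
  moreover have "set_integrable lborel {0..1} (\<lambda>t. 1 / norm (?r t))"
    unfolding set_integrable_def
  proof (rule integrableI_bounded)
    have "(\<lambda>t. indicator {0..1} t *\<^sub>R (1 / norm (indicator {0..1} t *\<^sub>R ?r t))) \<in> borel_measurable lborel"
      using m0 by measurable
    also have "(\<lambda>t. indicator {0..1} t *\<^sub>R (1 / norm (indicator {0..1} t *\<^sub>R ?r t))) = (\<lambda>t. indicator {0..1} t *\<^sub>R (1 / norm (?r t)))"
      by (auto simp: fun_eq_iff split: split_indicator)
    finally show "(\<lambda>t. indicator {0..1} t *\<^sub>R (1 / norm (?r t))) \<in> borel_measurable lborel" .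
    have "(\<integral>\<^sup>+t. ennreal (norm (indicator {0..1} t *\<^sub>R (1 / norm (?r t)))) \<partial>lborel) \<le> (\<integral>\<^sup>+t. ?f t \<partial>lborel)"
    proof (intro nn_integral_mono)
      fix t :: real
      show "ennreal (norm (indicator {0..1} t *\<^sub>R (1 / norm (?r t)))) \<le> ?f t"
        using ennreal_inverse_le[of "norm (?r t)"] by (auto split: split_indicator)
    qed
    also have "\<dots> < \<infinity>" using fi unfolding infinity_ennreal_def less_top .
    finally show "(\<integral>\<^sup>+t. ennreal (norm (indicator {0..1} t *\<^sub>R (1 / norm (?r t)))) \<partial>lborel) < \<infinity>" .
  qed
  ultimately show ?thesis using H unfolding pair_path_def by simp
qed

text \<open>The gap is the square of |a + b + c + d|. The inequality points in the direction that a
  lower bound for the kinetic energy requires.\<close>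

lemma sum_norm_diff_le:
  fixes a b c d :: "'a::real_inner"
  shows "(norm (b - a))\<^sup>2 + (norm (c - d))\<^sup>2 + (norm (c - a))\<^sup>2 + (norm (d - a))\<^sup>2 + (norm (c - b))\<^sup>2 + (norm (d - b))\<^sup>2
    \<le> 4 * ((norm a)\<^sup>2 + (norm b)\<^sup>2 + (norm c)\<^sup>2 + (norm d)\<^sup>2)"
  using zero_le_power2[of "norm (a + b + c + d)"]
  unfolding power2_norm_eq_inner by (simp add: inner_diff inner_add inner_commute algebra_simps)

text \<open>The parallelogram law, applied repeatedly. It is used for velocities and positions
  alike, so it carries over to the remainders of the cross pairs.\<close>

lemma cross_norm_identity:
  fixes a b c d :: "'a::real_inner"
  shows "(norm (c - a))\<^sup>2 + (norm (d - a))\<^sup>2 + (norm (c - b))\<^sup>2 + (norm (d - b))\<^sup>2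
    = (norm (c + d - a - b))\<^sup>2 + (norm (b - a))\<^sup>2 + (norm (c - d))\<^sup>2"
  unfolding power2_norm_eq_inner by (simp add: inner_diff inner_add inner_commute algebra_simps)

lemma action_ge_pair_actions:
  assumes q: "H1_derivative q v" and fin: "action q < \<infinity>"
  defines "A \<equiv> \<lambda>i j. pair_action (\<lambda>t. q t $ j - q t $ i) (\<lambda>t. v t $ j - v t $ i)"
  shows "ennreal (A 1 2 + A 4 3 + A 1 3 + A 1 4 + A 2 3 + A 2 4) \<le> action q"
proof -
  define f where "f i j t = (norm (v t $ j - v t $ i))\<^sup>2 / 8 + 1 / norm (q t $ j - q t $ i)" for i j t
  have fi: "set_integrable lborel {0..1} (f i j)" if "i \<noteq> j" for i j
    unfolding f_def using pair_action_integrable[OF pair_path_of_finite_action[OF q fin that]] .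
  have fA: "A i j = (LINT t:{0..1}|lborel. f i j t)" for i j unfolding A_def f_def pair_action_def ..
  note nf = fi[of 1 2] fi[of 4 3] fi[of 1 3] fi[of 1 4] fi[of 2 3] fi[of 2 4]
  have I: "set_integrable lborel {0..1} (\<lambda>t. f 1 2 t + f 4 3 t + f 1 3 t + f 1 4 t + f 2 3 t + f 2 4 t)"
    by (intro set_integral_add(1) fi) simp_all
  have "A 1 2 + A 4 3 + A 1 3 + A 1 4 + A 2 3 + A 2 4
     = (LINT t:{0..1}|lborel. f 1 2 t + f 4 3 t + f 1 3 t + f 1 4 t + f 2 3 t + f 2 4 t)"
    unfolding fA using nf by simp
  also have "ennreal \<dots> \<le> (\<integral>\<^sup>+t\<in>{0..1}. (ennreal (1/2 * (\<Sum>i\<in>UNIV. (norm (v t $ i))\<^sup>2)) + potential (q t)) \<partial>lborel)"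
  proof (rule nn_integral_ge_integral[OF I])
    fix t :: real
    let ?n = "\<lambda>i j. norm (q t $ j - q t $ i)"
    let ?S = "1 / ?n 1 2 + 1 / ?n 4 3 + 1 / ?n 1 3 + 1 / ?n 1 4 + 1 / ?n 2 3 + 1 / ?n 2 4"
    have "f 1 2 t + f 4 3 t + f 1 3 t + f 1 4 t + f 2 3 t + f 2 4 t
        \<le> 1/2 * (\<Sum>i\<in>UNIV. (norm (v t $ i))\<^sup>2) + ?S"
      using sum_norm_diff_le[of "v t $ 2" "v t $ 1" "v t $ 3" "v t $ 4"] unfolding f_def sum_4 by simp
    then have "ennreal (f 1 2 t + f 4 3 t + f 1 3 t + f 1 4 t + f 2 3 t + f 2 4 t)
        \<le> ennreal (1/2 * (\<Sum>i\<in>UNIV. (norm (v t $ i))\<^sup>2) + ?S)" by (rule ennreal_leI)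
    also have "\<dots> = ennreal (1/2 * (\<Sum>i\<in>UNIV. (norm (v t $ i))\<^sup>2)) + ennreal ?S"
      by (rule ennreal_plus) (auto intro!: sum_nonneg add_nonneg_nonneg)
    also have "ennreal ?S = ennreal (1 / ?n 1 2) + ennreal (1 / ?n 4 3) + ennreal (1 / ?n 1 3) + ennreal (1 / ?n 1 4)
        + ennreal (1 / ?n 2 3) + ennreal (1 / ?n 2 4)"
      by (simp add: ennreal_plus[symmetric] del: ennreal_plus)
    also have "\<dots> \<le> potential (q t)"
      unfolding potential_eq by (intro add_mono ennreal_inverse_le) simp_all
    finally show "ennreal (f 1 2 t + f 4 3 t + f 1 3 t + f 1 4 t + f 2 3 t + f 2 4 t)
       \<le> ennreal (1/2 * (\<Sum>i\<in>UNIV. (norm (v t $ i))\<^sup>2)) + potential (q t)" by simp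
  qed
  also have "\<dots> = action q" using action_eq[OF q] by simp
  finally show ?thesis .
qed

section \<open>Coordinates of the boundary sets and the price of a collision\<close>

lemma config_eq_iff:
  "(p::config) = q \<longleftrightarrow> p$1$1 = q$1$1 \<and> p$1$2 = q$1$2 \<and> p$2$1 = q$2$1 \<and> p$2$2 = q$2$2 \<and>
     p$3$1 = q$3$1 \<and> p$3$2 = q$3$2 \<and> p$4$1 = q$4$1 \<and> p$4$2 = q$4$2"
  unfolding vec_eq_iff forall_4 forall_2 by simp

lemma mem_Q_S_iff:
  "q \<in> Q_S \<longleftrightarrow> (\<exists>a b c. b \<ge> 0 \<and> c \<ge> 0 \<and> q$1$1 = - a - c \<and> q$1$2 = 0 \<and> q$2$1 = - a \<and> q$2$2 = 0 \<and>
     q$3$1 = (2 * a + c) / 2 \<and> q$3$2 = b \<and> q$4$1 = (2 * a + c) / 2 \<and> q$4$2 = - b)"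
  unfolding Q_S_def mem_Collect_eq config_eq_iff vector_4 vector_2 by (intro ex_cong1) auto

lemma mem_Q_E2_iff:
  "q \<in> Q_E2 \<theta> \<longleftrightarrow> (\<exists>a b c. b \<ge> 0 \<and> c \<ge> 0 \<and>
     q$1$1 = - a * cos \<theta> + b * sin \<theta> \<and> q$1$2 = - a * sin \<theta> - b * cos \<theta> \<and>
     q$2$1 = - a * cos \<theta> - b * sin \<theta> \<and> q$2$2 = - a * sin \<theta> + b * cos \<theta> \<and>
     q$3$1 = a * cos \<theta> - c * sin \<theta> \<and> q$3$2 = a * sin \<theta> + c * cos \<theta> \<and>
     q$4$1 = a * cos \<theta> + c * sin \<theta> \<and> q$4$2 = a * sin \<theta> - c * cos \<theta>)"
  unfolding Q_E2_def mem_Collect_eq config_eq_iff matrix_matrix_mult_def Rot_def vec_lambda_beta sum_2 vector_4 vector_2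
  by (intro ex_cong1) auto

lemma norm_real2_eq: "norm (x::real^2) = sqrt ((x$1)\<^sup>2 + (x$2)\<^sup>2)"
  by (metis norm_real2 norm_ge_zero real_sqrt_unique)

proposition collision_action_bound:
  assumes P: "P \<in> paths \<theta>" and v: "H1_derivative P v" and fin: "action P < \<infinity>"
    and \<theta>: "0 < \<theta>" "\<theta> \<le> 1/4" and R: "R \<ge> 4.5" "\<theta>\<^sup>2 * R ^ 3 = 4"
    and s: "s \<in> {0..1}" "collision_at P s"
  shows "action P \<ge> ennreal (1.884 + 15 / (2 * R))"
proof -
  define A where "A i j = pair_action (\<lambda>t. P t $ j - P t $ i) (\<lambda>t. v t $ j - v t $ i)" for i j
  have pp: "pair_path (\<lambda>t. P t $ j - P t $ i) (\<lambda>t. v t $ j - v t $ i)" if "i \<noteq> j" for i j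
    by (rule pair_path_of_finite_action[OF v fin that])
  have low: "ennreal (A 1 2 + A 4 3 + A 1 3 + A 1 4 + A 2 3 + A 2 4) \<le> action P"
    unfolding A_def by (rule action_ge_pair_actions[OF v fin])
  have R0: "R > 0" using R by simp
  have P0: "P 0 \<in> Q_S" and P1: "P 1 \<in> Q_E2 \<theta>" using P by (auto simp: paths_def)
  obtain a0 b0 c0 where P0: "P 0$1$1 = - a0 - c0" "P 0$1$2 = 0" "P 0$2$1 = - a0" "P 0$2$2 = 0"
     "P 0$3$1 = (2 * a0 + c0) / 2" "P 0$3$2 = b0" "P 0$4$1 = (2 * a0 + c0) / 2" "P 0$4$2 = - b0"
    using P0 unfolding mem_Q_S_iff by blast
  obtain a b c where P1: "P 1$1$1 = - a * cos \<theta> + b * sin \<theta>" "P 1$1$2 = - a * sin \<theta> - b * cos \<theta>"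
     "P 1$2$1 = - a * cos \<theta> - b * sin \<theta>" "P 1$2$2 = - a * sin \<theta> + b * cos \<theta>"
     "P 1$3$1 = a * cos \<theta> - c * sin \<theta>" "P 1$3$2 = a * sin \<theta> + c * cos \<theta>"
     "P 1$4$1 = a * cos \<theta> + c * sin \<theta>" "P 1$4$2 = a * sin \<theta> - c * cos \<theta>"
    using P1 unfolding mem_Q_E2_iff by blast
  have \<theta>': "\<bar>\<theta>\<bar> \<le> 1/4" using \<theta> by simp
  define rot where "rot r w = (LINT t:{0..1}|lborel. (norm (w t))\<^sup>2 - \<theta>\<^sup>2 * (norm (r t))\<^sup>2)"
    for r w :: "real \<Rightarrow> real^2"
  define D where "D i j = rot (\<lambda>t. P t $ j - P t $ i) (\<lambda>t. v t $ j - v t $ i)" for i j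
  have AD: "A i j \<ge> 3 / (2 * R) + D i j / 8" if "i \<noteq> j" for i j
    unfolding A_def D_def rot_def by (rule pair_action_ge_rotation[OF pp[OF that] R0 R(2)])
  let ?X = "\<lambda>t. P t $ 3 + P t $ 4 - P t $ 1 - P t $ 2" and ?Y = "\<lambda>t. v t $ 3 + v t $ 4 - v t $ 1 - v t $ 2"
  have HX: "H1_derivative ?X ?Y"
    by (intro H1_derivative_linear[OF v] bounded_linear_sub bounded_linear_add bounded_linear_vec_nth)
  \<comment> \<open>The vector between the centers lies on the rotating line at both ends. The
    vector 12 starts on it and ends perpendicular to it, which is the second alternative. The vector
    34 is perpendicular to it at both ends, hence the angle \<open>pi/2\<close>.\<close>
  have rX: "rot ?X ?Y \<ge> 0" unfolding rot_def
    by (rule rotating_line_inequality[OF HX \<theta>', of 0]) (simp_all add: P0 P1 algebra_simps)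
  have r12: "D 1 2 \<ge> 0" unfolding D_def rot_def
    by (rule rotating_line_inequality[OF H1_derivative_diff_nth[OF v] \<theta>', of _ _ 0]) (simp_all add: P0 P1 algebra_simps)
  have r34: "D 4 3 \<ge> 0" unfolding D_def rot_def
    by (rule rotating_line_inequality[OF H1_derivative_diff_nth[OF v] \<theta>', of _ _ "pi/2"])
      (simp_all add: P0 P1 cos_add sin_add algebra_simps)
  have cross: "D 1 3 + D 1 4 + D 2 3 + D 2 4 = rot ?X ?Y + D 1 2 + D 4 3"
  proof -
    note i = pair_rotation_integrable[OF HX, where \<theta> = \<theta>] pair_rotation_integrable[OF H1_derivative_diff_nth[OF v], where \<theta> = \<theta>]
    have "D 1 3 + D 1 4 + D 2 3 + D 2 4 = (LINT t:{0..1}|lborel.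
       ((norm (v t $ 3 - v t $ 1))\<^sup>2 - \<theta>\<^sup>2 * (norm (P t $ 3 - P t $ 1))\<^sup>2) + ((norm (v t $ 4 - v t $ 1))\<^sup>2 - \<theta>\<^sup>2 * (norm (P t $ 4 - P t $ 1))\<^sup>2)
       + ((norm (v t $ 3 - v t $ 2))\<^sup>2 - \<theta>\<^sup>2 * (norm (P t $ 3 - P t $ 2))\<^sup>2) + ((norm (v t $ 4 - v t $ 2))\<^sup>2 - \<theta>\<^sup>2 * (norm (P t $ 4 - P t $ 2))\<^sup>2))"
      unfolding D_def rot_def
      by (subst set_integral_add(2); (intro set_integral_add(1) i)?)+ (rule refl)
    also have "\<dots> = (LINT t:{0..1}|lborel. ((norm (?Y t))\<^sup>2 - \<theta>\<^sup>2 * (norm (?X t))\<^sup>2)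
      + ((norm (v t $ 2 - v t $ 1))\<^sup>2 - \<theta>\<^sup>2 * (norm (P t $ 2 - P t $ 1))\<^sup>2) + ((norm (v t $ 3 - v t $ 4))\<^sup>2 - \<theta>\<^sup>2 * (norm (P t $ 3 - P t $ 4))\<^sup>2))"
    proof (rule arg_cong[where f = "\<lambda>f. set_lebesgue_integral lborel {0..1} f"], rule ext)
      fix t
      show "((norm (v t $ 3 - v t $ 1))\<^sup>2 - \<theta>\<^sup>2 * (norm (P t $ 3 - P t $ 1))\<^sup>2) + ((norm (v t $ 4 - v t $ 1))\<^sup>2 - \<theta>\<^sup>2 * (norm (P t $ 4 - P t $ 1))\<^sup>2)
       + ((norm (v t $ 3 - v t $ 2))\<^sup>2 - \<theta>\<^sup>2 * (norm (P t $ 3 - P t $ 2))\<^sup>2) + ((norm (v t $ 4 - v t $ 2))\<^sup>2 - \<theta>\<^sup>2 * (norm (P t $ 4 - P t $ 2))\<^sup>2)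
       = ((norm (?Y t))\<^sup>2 - \<theta>\<^sup>2 * (norm (?X t))\<^sup>2)
      + ((norm (v t $ 2 - v t $ 1))\<^sup>2 - \<theta>\<^sup>2 * (norm (P t $ 2 - P t $ 1))\<^sup>2) + ((norm (v t $ 3 - v t $ 4))\<^sup>2 - \<theta>\<^sup>2 * (norm (P t $ 3 - P t $ 4))\<^sup>2)"
        using cross_norm_identity[of "v t $ 3" "v t $ 1" "v t $ 4" "v t $ 2"]
          arg_cong[OF cross_norm_identity[of "P t $ 3" "P t $ 1" "P t $ 4" "P t $ 2"], of "\<lambda>x. \<theta>\<^sup>2 * x"]
        unfolding distrib_left by linarith
    qed
    also have "\<dots> = rot ?X ?Y + D 1 2 + D 4 3"
      unfolding D_def rot_def
      by (subst set_integral_add(2); (intro set_integral_add(1) i)?)+ (rule refl)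
    finally show ?thesis .
  qed
  \<comment> \<open>The reflection at t = 0 exchanges 3 and 4; the one at t = 1 exchanges 1 with 2
    and 3 with 4. Used alternately, they lead through the pairs 13, 14, 23, 24 and back to
    13.\<close>
  have e0: "norm (P 0 $ 3 - P 0 $ 1) = norm (P 0 $ 4 - P 0 $ 1)" "norm (P 0 $ 3 - P 0 $ 2) = norm (P 0 $ 4 - P 0 $ 2)"
    unfolding norm_real2_eq by (simp_all add: P0)
  have e1: "norm (P 1 $ 3 - P 1 $ 1) = norm (P 1 $ 4 - P 1 $ 2)" "norm (P 1 $ 4 - P 1 $ 1) = norm (P 1 $ 3 - P 1 $ 2)"
    unfolding norm_real2_eq by (rule arg_cong[where f = sqrt], simp add: P1, simp add: power2_eq_square algebra_simps)+
  note three = pp[of 1 3] pp[of 1 4] pp[of 2 3] pp[of 2 4]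
  note sums = AD[of 1 2] AD[of 4 3] AD[of 1 3] AD[of 1 4] AD[of 2 3] AD[of 2 4]
  have h15: "15 / (2 * R) = 5 * (3 / (2 * R))" by simp
  have R3: "3 / (2 * R) \<le> 1/3" using R(1) by (simp add: field_simps)
  have "A 1 2 + A 4 3 + A 1 3 + A 1 4 + A 2 3 + A 2 4 \<ge> 1.884 + 15 / (2 * R)"
  proof -
    obtain i j where ij: "i \<noteq> j" "P s $ i = P s $ j" using s unfolding collision_at_def by blast
    then consider "P s $ 2 - P s $ 1 = 0" | "P s $ 3 - P s $ 4 = 0" | "P s $ 3 - P s $ 1 = 0 \<or> P s $ 4 - P s $ 1 = 0 \<or> P s $ 3 - P s $ 2 = 0 \<or> P s $ 4 - P s $ 2 = 0"
      using exhaust_4[of i] exhaust_4[of j] by (elim disjE) simp_all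
    then show ?thesis
    proof cases
      case 1
      have "A 1 2 \<ge> 1.884" unfolding A_def
        by (rule pair_action_collision[OF pp s(1) 1]) simp
      then show ?thesis using sums cross rX r12 r34 unfolding h15 by simp
    next
      case 2
      have "A 4 3 \<ge> 1.884" unfolding A_def
        by (rule pair_action_collision[OF pp s(1) 2]) simp
      then show ?thesis using sums cross rX r12 r34 unfolding h15 by simp
    next
      case 3
      have "A 1 3 + A 1 4 + A 2 3 + A 2 4 \<ge> 3"
        using 3
      proof (elim disjE)
        assume z: "P s $ 3 - P s $ 1 = 0"
        show ?thesis
          using pair_action_collision_cycle[OF three(1,2,3,4) _ _ _ _ s(1) z] e0 e1 unfolding A_def by simp
      next
        assume z: "P s $ 4 - P s $ 1 = 0"
        show ?thesis
          using pair_action_collision_cycle[OF three(2,1,4,3) _ _ _ _ s(1) z] e0 e1 unfolding A_def by simp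
      next
        assume z: "P s $ 3 - P s $ 2 = 0"
        show ?thesis
          using pair_action_collision_cycle[OF three(3,4,1,2) _ _ _ _ s(1) z] e0 e1 unfolding A_def by simp
      next
        assume z: "P s $ 4 - P s $ 2 = 0"
        show ?thesis
          using pair_action_collision_cycle[OF three(4,3,2,1) _ _ _ _ s(1) z] e0 e1 unfolding A_def by simp
      qed
      \<comment> \<open>The pairs 12 and 34 keep 3/(2R) each, so 3 has to exceed 1.884 plus three
        times 3/(2R); by R \<ge> 4.5 the latter is at most 1.\<close>
      then show ?thesis using sums r12 r34 R3 unfolding h15 by simp
    qed
  qed
  then show ?thesis using low by (meson ennreal_leI order.trans)
qed

section \<open>The comparison path\<close>

lemma potential_le:
  assumes "c\<^sub>1 > 0" "c\<^sub>2 > 0" "c\<^sub>3 > 0"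
    and "norm (q $ 2 - q $ 1) \<ge> c\<^sub>1" "norm (q $ 3 - q $ 4) \<ge> c\<^sub>2"
    and "norm (q $ 3 - q $ 1) \<ge> c\<^sub>3" "norm (q $ 4 - q $ 1) \<ge> c\<^sub>3" "norm (q $ 3 - q $ 2) \<ge> c\<^sub>3" "norm (q $ 4 - q $ 2) \<ge> c\<^sub>3"
  shows "potential q \<le> ennreal (1 / c\<^sub>1 + 1 / c\<^sub>2 + 4 / c\<^sub>3)"
proof -
  have le: "1 / ennreal n \<le> ennreal (1 / c)" if "n \<ge> c" "c > 0" for n c
  proof -
    have "1 / ennreal n = ennreal (1 / n)" using that divide_ennreal[of 1 n] by simp
    also have "\<dots> \<le> ennreal (1 / c)" using that by (intro ennreal_leI) (simp add: frac_le)
    finally show ?thesis .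
  qed
  have "potential q \<le> ennreal (1 / c\<^sub>1) + ennreal (1 / c\<^sub>2) + ennreal (1 / c\<^sub>3) + ennreal (1 / c\<^sub>3) + ennreal (1 / c\<^sub>3) + ennreal (1 / c\<^sub>3)"
    unfolding potential_eq by (intro add_mono le assms)
  also have "\<dots> = ennreal (1 / c\<^sub>1 + 1 / c\<^sub>2 + 1 / c\<^sub>3 + 1 / c\<^sub>3 + 1 / c\<^sub>3 + 1 / c\<^sub>3)"
    using assms(1-3) by (simp add: ennreal_plus[symmetric] del: ennreal_plus)
  also have "1 / c\<^sub>1 + 1 / c\<^sub>2 + 1 / c\<^sub>3 + 1 / c\<^sub>3 + 1 / c\<^sub>3 + 1 / c\<^sub>3 = 1 / c\<^sub>1 + 1 / c\<^sub>2 + 4 / c\<^sub>3" by simp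
  finally show ?thesis .
qed

lemma rotated_norm:
  "((r * cos t - s * sin t)\<^sup>2 + (r * sin t + s * cos t)\<^sup>2) = (r::real)\<^sup>2 + s\<^sup>2"
proof -
  have "(r * cos t - s * sin t)\<^sup>2 + (r * sin t + s * cos t)\<^sup>2 = (r\<^sup>2 + s\<^sup>2) * ((sin t)\<^sup>2 + (cos t)\<^sup>2)"
    by (simp add: power2_eq_square algebra_simps del: sin_cos_squared_add sin_cos_squared_add2 sin_cos_squared_add3)
  then show ?thesis by simp
qed

text \<open>The comparison path is a tight circular binary of bodies 1 and 2 (radius \<open>U = 0.43\<close>, close to
  the minimizer of \<open>(\<pi>/2 + \<theta>)\<^sup>2 U\<^sup>2 + 1/(2U)\<close>) that turns by
  \<open>\<pi>/2 + \<theta>\<close>, while its center and the bodies 3 and 4 form an equilateral triangle of side \<open>R\<close> that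
  rotates rigidly by \<open>\<theta>\<close>.\<close>

definition test_path :: "real \<Rightarrow> real \<Rightarrow> real \<Rightarrow> config" where
  "test_path \<theta> R t = (let X = sqrt 3 / 4 * R; W = R / 2; U = 0.43; \<phi> = pi / 2 + \<theta> in
     vector [vector [- X * cos (\<theta> * t) - U * cos (\<phi> * t), - X * sin (\<theta> * t) - U * sin (\<phi> * t)],
             vector [- X * cos (\<theta> * t) + U * cos (\<phi> * t), - X * sin (\<theta> * t) + U * sin (\<phi> * t)],
             vector [X * cos (\<theta> * t) - W * sin (\<theta> * t), X * sin (\<theta> * t) + W * cos (\<theta> * t)],
             vector [X * cos (\<theta> * t) + W * sin (\<theta> * t), X * sin (\<theta> * t) - W * cos (\<theta> * t)]])"

text \<open>The kinetic energy is constant: the binary contributes (pi/2 + \<theta>)^2 U^2 and the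
  triangle 5/(2R), by \<theta>^2 R^2 = 4/R. The latter and the pair 34 at distance R make 7/(2R).
  Bodies 1 and 2 are at distance U from a vertex, so the cross distances are at least R - U.\<close>

lemma test_path_in_paths_and_action:
  assumes \<theta>: "0 < \<theta>" and R: "R > 1" "\<theta>\<^sup>2 * R ^ 3 = 4"
  shows "test_path \<theta> R \<in> paths \<theta>"
    and "action (test_path \<theta> R) \<le> ennreal ((pi / 2 + \<theta>)\<^sup>2 * 0.43\<^sup>2 + 1 / 0.86 + 7 / (2 * R) + 4 / (R - 0.43))"
proof -
  define X W U \<phi> where "X = sqrt 3 / 4 * R" and "W = R / 2" and "U = (0.43::real)" and "\<phi> = pi / 2 + \<theta>"
  have R0: "R > 0" using R by simp
  define q where "q = test_path \<theta> R"
  have q: "q t $ 1 $ 1 = - X * cos (\<theta> * t) - U * cos (\<phi> * t)" "q t $ 1 $ 2 = - X * sin (\<theta> * t) - U * sin (\<phi> * t)"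
    "q t $ 2 $ 1 = - X * cos (\<theta> * t) + U * cos (\<phi> * t)" "q t $ 2 $ 2 = - X * sin (\<theta> * t) + U * sin (\<phi> * t)"
    "q t $ 3 $ 1 = X * cos (\<theta> * t) - W * sin (\<theta> * t)" "q t $ 3 $ 2 = X * sin (\<theta> * t) + W * cos (\<theta> * t)"
    "q t $ 4 $ 1 = X * cos (\<theta> * t) + W * sin (\<theta> * t)" "q t $ 4 $ 2 = X * sin (\<theta> * t) - W * cos (\<theta> * t)" for t
    unfolding q_def test_path_def Let_def vector_4 vector_2 X_def W_def U_def \<phi>_def by simp_all
  define C1 C2 C3 C4 :: config where
    "C1 = vector [vector [- X, 0], vector [- X, 0], vector [X, W], vector [X, - W]]" and
    "C2 = vector [vector [0, - X], vector [0, - X], vector [- W, X], vector [W, X]]" and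
    "C3 = vector [vector [- U, 0], vector [U, 0], vector [0, 0], vector [0, 0]]" and
    "C4 = vector [vector [0, - U], vector [0, U], vector [0, 0], vector [0, 0]]"
  have qC: "q t = cos (\<theta> * t) *\<^sub>R C1 + sin (\<theta> * t) *\<^sub>R C2 + cos (\<phi> * t) *\<^sub>R C3 + sin (\<phi> * t) *\<^sub>R C4" for t
    unfolding config_eq_iff q vector_add_component vector_scaleR_component C1_def C2_def C3_def C4_def vector_4 vector_2
    by (simp add: algebra_simps)
  define v where "v t = (- \<theta> * sin (\<theta> * t)) *\<^sub>R C1 + (\<theta> * cos (\<theta> * t)) *\<^sub>R C2 + (- \<phi> * sin (\<phi> * t)) *\<^sub>R C3 + (\<phi> * cos (\<phi> * t)) *\<^sub>R C4" for t
  have dc: "((\<lambda>t. cos (a * t) *\<^sub>R C) has_vector_derivative (- a * sin (a * t)) *\<^sub>R C) (at t within S)"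
    and ds: "((\<lambda>t. sin (a * t) *\<^sub>R C) has_vector_derivative (a * cos (a * t)) *\<^sub>R C) (at t within S)"
    for a t S and C :: config
    by (rule has_vector_derivative_scaleR[where g = "\<lambda>_. C" and g' = 0, simplified], auto intro!: derivative_eq_intros)+
  have H: "H1_derivative q v"
  proof (rule H1_derivative_C1)
    show "continuous_on {0..1} v" unfolding v_def by (auto intro!: continuous_intros)
    show "(q has_vector_derivative v t) (at t within {0..1})" for t
      unfolding qC[abs_def] v_def by (intro has_vector_derivative_add dc ds)
  qed
  have vc: "v t $ 1 $ 1 = \<theta> * X * sin (\<theta> * t) + \<phi> * U * sin (\<phi> * t)" "v t $ 1 $ 2 = - (\<theta> * X * cos (\<theta> * t)) - \<phi> * U * cos (\<phi> * t)"
    "v t $ 2 $ 1 = \<theta> * X * sin (\<theta> * t) - \<phi> * U * sin (\<phi> * t)" "v t $ 2 $ 2 = - (\<theta> * X * cos (\<theta> * t)) + \<phi> * U * cos (\<phi> * t)"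
    "v t $ 3 $ 1 = - (\<theta> * X * sin (\<theta> * t)) - \<theta> * W * cos (\<theta> * t)" "v t $ 3 $ 2 = \<theta> * X * cos (\<theta> * t) - \<theta> * W * sin (\<theta> * t)"
    "v t $ 4 $ 1 = - (\<theta> * X * sin (\<theta> * t)) + \<theta> * W * cos (\<theta> * t)" "v t $ 4 $ 2 = \<theta> * X * cos (\<theta> * t) + \<theta> * W * sin (\<theta> * t)" for t
    unfolding v_def vector_add_component vector_scaleR_component C1_def C2_def C3_def C4_def vector_4 vector_2
    by (simp_all add: algebra_simps)
  have pos: "X > 0" "W > 0" "U > 0" using R0 by (auto simp: X_def W_def U_def)
  show mem: "test_path \<theta> R \<in> paths \<theta>"
    unfolding paths_def mem_Collect_eq q_def[symmetric]
  proof (intro conjI ballI)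
    show "q \<in> H1" using H unfolding H1_def by blast
    show "q t \<in> centered" for t
      unfolding centered_def mem_Collect_eq sum_4 vec_eq_iff forall_2 by (simp add: q)
    show "q 0 \<in> Q_S" unfolding mem_Q_S_iff
      by (rule exI[of _ "X - U"], rule exI[of _ W], rule exI[of _ "2 * U"]) (use pos in \<open>simp add: q\<close>)
    show "q 1 \<in> Q_E2 \<theta>" unfolding mem_Q_E2_iff
      by (rule exI[of _ X], rule exI[of _ U], rule exI[of _ W])
        (use pos in \<open>simp add: q \<phi>_def cos_add sin_add\<close>)
  qed
  \<comment> \<open>\<open>2 * X\<close> is the altitude and \<open>W\<close> half the side of the
    equilateral triangle.\<close>
  have X2: "4 * X\<^sup>2 + W\<^sup>2 = R\<^sup>2" by (simp add: X_def W_def power_mult_distrib power_divide)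
  have kin: "1/2 * (\<Sum>i\<in>UNIV. (norm (v t $ i))\<^sup>2) = \<phi>\<^sup>2 * U\<^sup>2 + 5 / (2 * R)" for t
  proof -
    have "(\<Sum>i\<in>UNIV. (norm (v t $ i))\<^sup>2) = 4 * \<theta>\<^sup>2 * X\<^sup>2 * ((sin (\<theta> * t))\<^sup>2 + (cos (\<theta> * t))\<^sup>2)
        + 2 * \<phi>\<^sup>2 * U\<^sup>2 * ((sin (\<phi> * t))\<^sup>2 + (cos (\<phi> * t))\<^sup>2) + 2 * \<theta>\<^sup>2 * W\<^sup>2 * ((sin (\<theta> * t))\<^sup>2 + (cos (\<theta> * t))\<^sup>2)"
      unfolding sum_4 norm_real2 vc by (simp add: power2_eq_square algebra_simps del: sin_cos_squared_add sin_cos_squared_add2 sin_cos_squared_add3)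
    also have "\<dots> = 4 * \<theta>\<^sup>2 * X\<^sup>2 + 2 * \<phi>\<^sup>2 * U\<^sup>2 + 2 * \<theta>\<^sup>2 * W\<^sup>2" by simp
    also have "\<dots> = 2 * \<phi>\<^sup>2 * U\<^sup>2 + 5/4 * (\<theta>\<^sup>2 * R\<^sup>2)"
      by (simp add: X_def W_def power_mult_distrib power_divide)
    also have "\<theta>\<^sup>2 * R\<^sup>2 = 4 / R" using R R0 by (simp add: field_simps eval_nat_numeral)
    finally show ?thesis by (simp add: field_simps)
  qed
  have pot: "potential (q t) \<le> ennreal (1 / (2 * U) + 1 / R + 4 / (R - U))" for t
  proof (rule potential_le)
    have n12: "norm (q t $ 2 - q t $ 1) = 2 * U"
    proof (rule power2_eq_imp_eq)
      have "(norm (q t $ 2 - q t $ 1))\<^sup>2 = (2 * U)\<^sup>2 * ((sin (\<phi> * t))\<^sup>2 + (cos (\<phi> * t))\<^sup>2)"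
        unfolding norm_real2 vector_minus_component q by (simp add: power2_eq_square algebra_simps del: sin_cos_squared_add sin_cos_squared_add2 sin_cos_squared_add3)
      then show "(norm (q t $ 2 - q t $ 1))\<^sup>2 = (2 * U)\<^sup>2" by simp
    qed (use pos in auto)
    then show "2 * U \<le> norm (q t $ 2 - q t $ 1)" by simp
    have "norm (q t $ 3 - q t $ 4) = R"
    proof (rule power2_eq_imp_eq)
      have "(norm (q t $ 3 - q t $ 4))\<^sup>2 = (2 * W)\<^sup>2 * ((sin (\<theta> * t))\<^sup>2 + (cos (\<theta> * t))\<^sup>2)"
        unfolding norm_real2 vector_minus_component q by (simp add: power2_eq_square algebra_simps del: sin_cos_squared_add sin_cos_squared_add2 sin_cos_squared_add3)
      then show "(norm (q t $ 3 - q t $ 4))\<^sup>2 = R\<^sup>2" by (simp add: W_def)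
    qed (use R0 in auto)
    then show "R \<le> norm (q t $ 3 - q t $ 4)" by simp
    define m where "m = (1/2) *\<^sub>R (q t $ 1 + q t $ 2)"
    have n3: "norm (q t $ 3 - m) = R" and n4: "norm (q t $ 4 - m) = R"
    proof -
      have "(norm (q t $ 3 - m))\<^sup>2 = (2 * X * cos (\<theta> * t) - W * sin (\<theta> * t))\<^sup>2 + (2 * X * sin (\<theta> * t) + W * cos (\<theta> * t))\<^sup>2"
        unfolding norm_real2 vector_minus_component m_def vector_scaleR_component vector_add_component q by (simp add: mult.assoc)
      also have "\<dots> = R\<^sup>2" unfolding rotated_norm using X2 by (simp add: power_mult_distrib)
      finally show "norm (q t $ 3 - m) = R" by (rule power2_eq_imp_eq) (use R0 in auto)
      have "(norm (q t $ 4 - m))\<^sup>2 = (2 * X * cos (\<theta> * t) - (- W) * sin (\<theta> * t))\<^sup>2 + (2 * X * sin (\<theta> * t) + (- W) * cos (\<theta> * t))\<^sup>2"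
        unfolding norm_real2 vector_minus_component m_def vector_scaleR_component vector_add_component q by (simp add: mult.assoc)
      also have "\<dots> = R\<^sup>2" unfolding rotated_norm using X2 by (simp add: power_mult_distrib)
      finally show "norm (q t $ 4 - m) = R" by (rule power2_eq_imp_eq) (use R0 in auto)
    qed
    have nm: "norm (q t $ 1 - m) = U" "norm (q t $ 2 - m) = U"
    proof -
      have "q t $ 1 - m = - ((1/2) *\<^sub>R (q t $ 2 - q t $ 1))" "q t $ 2 - m = (1/2) *\<^sub>R (q t $ 2 - q t $ 1)"
        unfolding m_def vec_eq_iff by (simp_all add: field_simps)
      then show "norm (q t $ 1 - m) = U" "norm (q t $ 2 - m) = U" using n12 by simp_all
    qed
    have tri: "norm x - norm y \<le> norm (a - b)" if "x = a - m" "y = b - m" for a b x y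
      using norm_triangle_ineq2[of x y] that by simp
    show "R - U \<le> norm (q t $ 3 - q t $ 1)" "R - U \<le> norm (q t $ 4 - q t $ 1)"
      "R - U \<le> norm (q t $ 3 - q t $ 2)" "R - U \<le> norm (q t $ 4 - q t $ 2)"
      using tri[OF refl refl, of "q t $ 3" "q t $ 1"] tri[OF refl refl, of "q t $ 4" "q t $ 1"]
        tri[OF refl refl, of "q t $ 3" "q t $ 2"] tri[OF refl refl, of "q t $ 4" "q t $ 2"] n3 n4 nm by simp_all
    show "R - U > 0" using R by (simp add: U_def)
  qed (use pos R0 in auto)
  let ?T = "\<phi>\<^sup>2 * U\<^sup>2 + 5 / (2 * R) + (1 / (2 * U) + 1 / R + 4 / (R - U))"
  have "action q = (\<integral>\<^sup>+t\<in>{0..1}. (ennreal (1/2 * (\<Sum>i\<in>UNIV. (norm (v t $ i))\<^sup>2)) + potential (q t)) \<partial>lborel)"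
    by (rule action_eq[OF H])
  also have "\<dots> \<le> (\<integral>\<^sup>+t\<in>{0..1::real}. ennreal ?T \<partial>lborel)"
  proof (intro nn_integral_mono)
    fix t :: real
    have "ennreal (1/2 * (\<Sum>i\<in>UNIV. (norm (v t $ i))\<^sup>2)) + potential (q t)
        \<le> ennreal (\<phi>\<^sup>2 * U\<^sup>2 + 5 / (2 * R)) + ennreal (1 / (2 * U) + 1 / R + 4 / (R - U))"
      unfolding kin by (intro add_left_mono pot)
    also have "\<dots> = ennreal ?T"
      using R pos by (intro ennreal_plus[symmetric]) (auto simp: U_def intro!: add_nonneg_nonneg)
    finally show "(ennreal (1/2 * (\<Sum>i\<in>UNIV. (norm (v t $ i))\<^sup>2)) + potential (q t)) * indicator {0..1} t
        \<le> ennreal ?T * indicator {0..1} t"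
      by (auto split: split_indicator)
  qed
  also have "\<dots> = ennreal ?T" by (simp add: nn_integral_cmult_indicator)
  also have "?T = (pi / 2 + \<theta>)\<^sup>2 * 0.43\<^sup>2 + 1 / 0.86 + 7 / (2 * R) + 4 / (R - 0.43)"
    by (simp add: \<phi>_def U_def field_simps)
  finally show "action (test_path \<theta> R) \<le> ennreal ((pi / 2 + \<theta>)\<^sup>2 * 0.43\<^sup>2 + 1 / 0.86 + 7 / (2 * R) + 4 / (R - 0.43))"
    unfolding q_def .
qed

theorem minimizer_collision_free:
  assumes \<theta>: "0 < \<theta>" "\<theta> \<le> 0.0664 * pi" and P: "P \<in> paths \<theta>" and min: "action P = (INF q \<in> paths \<theta>. action q)"
  shows "action P < \<infinity>" and "\<forall>t\<in>{0..1}. \<not> collision_at P t"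
proof -
  have pi: "pi \<le> 3.1416" using pi_approx(2) by simp
  have \<theta>1: "\<theta> \<le> 0.20861" using \<theta>(2) pi by simp
  define R where "R = root 3 (4 / \<theta>\<^sup>2)"
  have R3: "R ^ 3 = 4 / \<theta>\<^sup>2" using \<theta> by (simp add: R_def)
  then have R: "\<theta>\<^sup>2 * R ^ 3 = 4" using \<theta> by simp
  \<comment> \<open>The relation \<theta>^2 R^3 = 4 turns the upper bound for \<theta> into a lower
    bound for R; numerically 0.20861^2 4.5^3 is about 3.97.\<close>
  have R45: "R \<ge> 4.5"
  proof (rule ccontr)
    assume "\<not> R \<ge> 4.5"
    moreover have "R \<ge> 0" by (simp add: R_def)
    ultimately have "R ^ 3 \<le> 4.5 ^ 3" by (intro power_mono) auto
    moreover have "\<theta>\<^sup>2 \<le> 0.20861\<^sup>2" using \<theta> \<theta>1 by (intro power_mono) auto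
    ultimately have "\<theta>\<^sup>2 * R ^ 3 \<le> 0.20861\<^sup>2 * 4.5 ^ 3" using \<open>R \<ge> 0\<close> by (intro mult_mono) auto
    also have "\<dots> < 4" by (simp add: power2_eq_square eval_nat_numeral)
    finally show False using R by simp
  qed
  let ?T = "(pi / 2 + \<theta>)\<^sup>2 * 0.43\<^sup>2 + 1 / 0.86 + 7 / (2 * R) + 4 / (R - 0.43)"
  have R1: "R > 1" using R45 by simp
  have "action P \<le> action (test_path \<theta> R)"
    unfolding min by (rule INF_lower) (rule test_path_in_paths_and_action(1)[OF \<theta>(1) R1 R])
  also have "\<dots> \<le> ennreal ?T" by (rule test_path_in_paths_and_action(2)[OF \<theta>(1) R1 R])
  finally have up: "action P \<le> ennreal ?T" .
  then show fin: "action P < \<infinity>" by (simp add: order_le_less_trans)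
  have "(pi / 2 + \<theta>)\<^sup>2 \<le> 1.77941\<^sup>2" using pi \<theta> \<theta>1 by (intro power_mono) auto
  then have "(pi / 2 + \<theta>)\<^sup>2 * 0.43\<^sup>2 \<le> 0.5855" by (simp add: power2_eq_square)
  moreover have "1 / 0.86 \<le> (1.1628::real)" by simp
  moreover have "4 / (R - 0.43) \<le> 4 / R + 0.094"
  proof -
    \<comment> \<open>The difference of 4/(R - 0.43) and 4/R is 1.72/(R (R - 0.43)), and 1.72/(4.5 *
      4.07) is just below 0.094.\<close>
    have "4.5 * 4.07 \<le> R * (R - 0.43)" using R45 by (intro mult_mono) auto
    then show ?thesis using R45 by (simp add: field_simps)
  qed
  \<comment> \<open>Here 7/(2R) + 4/R = 15/(2R) cancels, and 0.5855 + 1.1628 + 0.094 = 1.8423 is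
    below 1.884.\<close>
  ultimately have T: "?T < 1.884 + 15 / (2 * R)" by (simp add: field_simps) 
  obtain v where v: "H1_derivative P v" using P by (auto simp: paths_def H1_def)
  show "\<forall>t\<in>{0..1}. \<not> collision_at P t"
  proof (intro ballI notI)
    fix s :: real assume "s \<in> {0..1}" "collision_at P s"
    then have "ennreal (1.884 + 15 / (2 * R)) \<le> action P"
      using \<theta>1 by (intro collision_action_bound[OF P v fin \<theta>(1) _ R45 R]) auto
    then have "ennreal (1.884 + 15 / (2 * R)) \<le> ennreal ?T" using up by simp
    then have "1.884 + 15 / (2 * R) \<le> ?T"
      using R45 by (subst (asm) ennreal_le_iff) (auto intro!: add_nonneg_nonneg)
    then show False using T by simp
  qed
qed

section \<open>First variation\<close>

definition force :: "config \<Rightarrow> config" where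
  "force q = (\<chi> i. \<Sum>j\<in>UNIV - {i}. (1 / norm (q $ j - q $ i) ^ 3) *\<^sub>R (q $ j - q $ i))"

definition collision_free :: "config \<Rightarrow> bool" where
  "collision_free q \<longleftrightarrow> (\<forall>i j. i \<noteq> j \<longrightarrow> q $ i \<noteq> q $ j)"

lemma not_collision_at_iff: "\<not> collision_at q t \<longleftrightarrow> collision_free (q t)"
  by (auto simp: collision_at_def collision_free_def)

text \<open>The term j = i is a multiple of the zero vector. Summing over all indices allows
  reindexing by a permutation.\<close>

lemma force_nth: "force q $ i = (\<Sum>j\<in>UNIV. (1 / norm (q $ j - q $ i) ^ 3) *\<^sub>R (q $ j - q $ i))"
  unfolding force_def vec_lambda_beta by (rule sum.mono_neutral_left) auto

definition newton_potential :: "config \<Rightarrow> real" where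
  "newton_potential q = 1 / norm (q $ 2 - q $ 1) + 1 / norm (q $ 3 - q $ 4) + 1 / norm (q $ 3 - q $ 1)
     + 1 / norm (q $ 4 - q $ 1) + 1 / norm (q $ 3 - q $ 2) + 1 / norm (q $ 4 - q $ 2)"

lemma newton_potential_nonneg: "newton_potential q \<ge> 0" by (simp add: newton_potential_def)

lemma potential_eq_newton_potential:
  assumes "collision_free q"
  shows "potential q = ennreal (newton_potential q)"
proof -
  have "1 / ennreal (norm (q $ j - q $ i)) = ennreal (1 / norm (q $ j - q $ i))" if "i \<noteq> j" for i j
    using assms that divide_ennreal[of 1 "norm (q $ j - q $ i)"] by (simp add: collision_free_def)
  then show ?thesis unfolding potential_eq newton_potential_def by (simp add: ennreal_plus[symmetric] del: ennreal_plus)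
qed

text \<open>By Newton's third law the two contributions of a pair combine, which exhibits the force
  as the gradient of \<open>newton_potential\<close>, pair by pair.\<close>

lemma force_inner:
  "force q \<bullet> h = - (((q $ 2 - q $ 1) \<bullet> (h $ 2 - h $ 1)) / norm (q $ 2 - q $ 1) ^ 3
     + ((q $ 3 - q $ 4) \<bullet> (h $ 3 - h $ 4)) / norm (q $ 3 - q $ 4) ^ 3
     + ((q $ 3 - q $ 1) \<bullet> (h $ 3 - h $ 1)) / norm (q $ 3 - q $ 1) ^ 3
     + ((q $ 4 - q $ 1) \<bullet> (h $ 4 - h $ 1)) / norm (q $ 4 - q $ 1) ^ 3
     + ((q $ 3 - q $ 2) \<bullet> (h $ 3 - h $ 2)) / norm (q $ 3 - q $ 2) ^ 3
     + ((q $ 4 - q $ 2) \<bullet> (h $ 4 - h $ 2)) / norm (q $ 4 - q $ 2) ^ 3)"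
proof -
  have sym: "norm (q $ 1 - q $ 2) = norm (q $ 2 - q $ 1)" "norm (q $ 4 - q $ 3) = norm (q $ 3 - q $ 4)"
    "norm (q $ 1 - q $ 3) = norm (q $ 3 - q $ 1)" "norm (q $ 1 - q $ 4) = norm (q $ 4 - q $ 1)"
    "norm (q $ 2 - q $ 3) = norm (q $ 3 - q $ 2)" "norm (q $ 2 - q $ 4) = norm (q $ 4 - q $ 2)"
    by (simp_all add: norm_minus_commute)
  have a: "b *\<^sub>R (x - y) \<bullet> z = b * (x \<bullet> z) - b * (y \<bullet> z)" for b and x y z :: "real^2"
    by (simp add: inner_diff_left algebra_simps)
  have b: "(x - y) \<bullet> (z - w) / n = 1/n * (x \<bullet> z) - 1/n * (y \<bullet> z) - 1/n * (x \<bullet> w) + 1/n * (y \<bullet> w)"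
    for x y z w :: "real^2" and n :: real
    by (simp add: inner_diff_left inner_diff_right diff_divide_distrib)
  show ?thesis
    unfolding inner_vec_def[of "force q"] force_nth sum_4 sym inner_add_left a b by simp
qed

text \<open>Expressing the inner product through the norms n and m gives an exact remainder
  containing (m - n)^2, which the triangle inequality bounds by the square of |k|. An upper bound
  suffices, as minimality bounds the perturbed action from below.\<close>

lemma inverse_norm_expansion:
  fixes a k :: "'a::real_inner"
  assumes \<delta>: "\<delta> > 0" "norm a \<ge> \<delta>" "norm k \<le> \<delta> / 2"
  shows "1 / norm (a + k) \<le> 1 / norm a - (a \<bullet> k) / norm a ^ 3 + 2 / \<delta> ^ 3 * (norm k)\<^sup>2"
proof -
  define n m where "n = norm a" and "m = norm (a + k)"
  have n: "n \<ge> \<delta>" "n > 0" using \<delta> by (auto simp: n_def)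
  have mn: "\<bar>m - n\<bar> \<le> norm k" unfolding m_def n_def
    using norm_triangle_ineq3[of "a + k" a] by simp
  then have m: "m \<ge> \<delta> / 2" "m > 0" using \<delta> n by auto
  have "m\<^sup>2 = n\<^sup>2 + 2 * (a \<bullet> k) + (norm k)\<^sup>2"
    unfolding m_def n_def power2_norm_eq_inner by (simp add: inner_add inner_commute)
  then have ak: "a \<bullet> k = (m\<^sup>2 - n\<^sup>2 - (norm k)\<^sup>2) / 2" by simp
  have "1 / m - 1 / n + (a \<bullet> k) / n ^ 3 = (m - n)\<^sup>2 * (m + 2 * n) / (2 * m * n ^ 3) - (norm k)\<^sup>2 / (2 * n ^ 3)"
    unfolding ak using n(2) m(2) by (simp add: field_simps power2_eq_square eval_nat_numeral)
  also have "\<dots> \<le> (norm k)\<^sup>2 * (m + 2 * n) / (2 * m * n ^ 3) - (norm k)\<^sup>2 / (2 * n ^ 3)"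
    using n m abs_le_square_iff[of "m - n" "norm k"] mn by (intro diff_right_mono divide_right_mono mult_right_mono) auto
  also have "\<dots> = (norm k)\<^sup>2 / (m * n\<^sup>2)"
    using n(2) m(2) by (simp add: field_simps power2_eq_square eval_nat_numeral)
  also have "\<dots> \<le> (norm k)\<^sup>2 / (\<delta> / 2 * \<delta>\<^sup>2)"
    using n m \<delta> by (intro divide_left_mono mult_mono power_mono mult_pos_pos) auto
  also have "\<dots> = 2 / \<delta> ^ 3 * (norm k)\<^sup>2" by (simp add: field_simps power2_eq_square eval_nat_numeral)
  finally show ?thesis unfolding n_def m_def by simp
qed

lemma norm_vec_power2: "(norm (q::'a::real_normed_vector^'n))\<^sup>2 = (\<Sum>i\<in>UNIV. (norm (q $ i))\<^sup>2)"
  unfolding norm_vec_def L2_set_def by (simp add: sum_nonneg)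

text \<open>The constant 48 is six pairs times 8, since a relative displacement is at most twice the
  norm of \<open>h\<close>.\<close>

lemma newton_potential_expansion:
  assumes \<delta>: "\<delta> > 0" "\<And>i j. i \<noteq> j \<Longrightarrow> norm (q $ j - q $ i) \<ge> \<delta>" and h: "norm h \<le> \<delta> / 4"
  shows "collision_free (q + h)" and "newton_potential (q + h) \<le> newton_potential q + force q \<bullet> h + 48 / \<delta> ^ 3 * (norm h)\<^sup>2"
proof -
  have k: "norm (h $ j - h $ i) \<le> 2 * norm h" for i j
    using norm_triangle_ineq4[of "h $ j" "h $ i"] Finite_Cartesian_Product.norm_nth_le[of h i]
      Finite_Cartesian_Product.norm_nth_le[of h j] by linarith
  then have k2: "norm (h $ j - h $ i) \<le> \<delta> / 2" for i j using k[of j i] h by linarith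
  show "collision_free (q + h)"
    unfolding collision_free_def
  proof (intro allI impI notI)
    fix i j :: 4 assume ij: "i \<noteq> j" and "(q + h) $ i = (q + h) $ j"
    then have "q $ j - q $ i = - (h $ j - h $ i)" by (simp add: algebra_simps)
    then have "norm (q $ j - q $ i) = norm (h $ j - h $ i)" by (metis norm_minus_cancel)
    then show False using \<delta>(1) \<delta>(2)[OF ij] k2[of j i] by linarith
  qed
  have e: "1 / norm ((q + h) $ j - (q + h) $ i) \<le> 1 / norm (q $ j - q $ i)
     - ((q $ j - q $ i) \<bullet> (h $ j - h $ i)) / norm (q $ j - q $ i) ^ 3 + 8 / \<delta> ^ 3 * (norm h)\<^sup>2" if "i \<noteq> j" for i j
  proof -
    have eq: "(q + h) $ j - (q + h) $ i = (q $ j - q $ i) + (h $ j - h $ i)" by simp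
    have "2 / \<delta> ^ 3 * (norm (h $ j - h $ i))\<^sup>2 \<le> 2 / \<delta> ^ 3 * (2 * norm h)\<^sup>2"
      using \<delta> k by (intro mult_left_mono power_mono) auto
    also have "\<dots> = 8 / \<delta> ^ 3 * (norm h)\<^sup>2" by (simp add: power_mult_distrib)
    finally show ?thesis
      using inverse_norm_expansion[OF \<delta>(1) \<delta>(2)[OF that] k2] unfolding eq by (meson add_left_mono order.trans)
  qed
  show "newton_potential (q + h) \<le> newton_potential q + force q \<bullet> h + 48 / \<delta> ^ 3 * (norm h)\<^sup>2"
    using e[of 1 2] e[of 4 3] e[of 1 3] e[of 1 4] e[of 2 3] e[of 2 4]
    unfolding newton_potential_def force_inner by simp
qed

lemma continuous_on_newton_potential:
  assumes "continuous_on S q" "\<And>t. t \<in> S \<Longrightarrow> collision_free (q t)"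
  shows "continuous_on S (\<lambda>t. newton_potential (q t))"
  unfolding newton_potential_def using assms
  by (auto intro!: continuous_intros simp: collision_free_def)

lemma continuous_on_force:
  assumes c: "continuous_on S q" and f: "\<And>t. t \<in> S \<Longrightarrow> collision_free (q t)"
  shows "continuous_on S (\<lambda>t. force (q t))"
  unfolding force_def
proof (intro continuous_on_vec_lambda continuous_on_sum)
  fix i j :: 4 assume "j \<in> UNIV - {i}"
  then show "continuous_on S (\<lambda>t. (1 / norm (q t $ j - q t $ i) ^ 3) *\<^sub>R (q t $ j - q t $ i))"
    using f by (auto intro!: continuous_intros c simp: collision_free_def)
qed

lemma action_collision_free:
  assumes H: "H1_derivative q v" and f: "\<And>t. t \<in> {0..1} \<Longrightarrow> collision_free (q t)"
  shows "set_integrable lborel {0..1} (\<lambda>t. (norm (v t))\<^sup>2 / 2 + newton_potential (q t))"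
    and "action q = ennreal (LINT t:{0..1}|lborel. (norm (v t))\<^sup>2 / 2 + newton_potential (q t))"
proof -
  show I: "set_integrable lborel {0..1} (\<lambda>t. (norm (v t))\<^sup>2 / 2 + newton_potential (q t))"
    by (intro set_integral_add(1) set_integrable_divide H1_derivative_norm_square_integrable[OF H]
        borel_integrable_atLeastAtMost' continuous_on_newton_potential H1_derivative_continuous[OF H] f)
  have "action q = (\<integral>\<^sup>+t. ennreal (indicator {0..1} t *\<^sub>R ((norm (v t))\<^sup>2 / 2 + newton_potential (q t))) \<partial>lborel)"
    unfolding action_eq[OF H]
  proof (intro nn_integral_cong)
    fix t :: real
    show "(ennreal (1/2 * (\<Sum>i\<in>UNIV. (norm (v t $ i))\<^sup>2)) + potential (q t)) * indicator {0..1} t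
      = ennreal (indicator {0..1} t *\<^sub>R ((norm (v t))\<^sup>2 / 2 + newton_potential (q t)))"
      using f[of t] newton_potential_nonneg[of "q t"]
      by (auto simp: potential_eq_newton_potential norm_vec_power2[symmetric] ennreal_plus[symmetric] simp del: ennreal_plus split: split_indicator)
  qed
  also have "\<dots> = ennreal (LINT t:{0..1}|lborel. (norm (v t))\<^sup>2 / 2 + newton_potential (q t))"
    unfolding set_lebesgue_integral_def
    by (rule nn_integral_eq_integral) (use I newton_potential_nonneg in \<open>auto simp: set_integrable_def indicator_def\<close>)
  finally show "action q = ennreal (LINT t:{0..1}|lborel. (norm (v t))\<^sup>2 / 2 + newton_potential (q t))" .
qed

lemma collision_free_separation:
  fixes q :: "real \<Rightarrow> config"
  assumes c: "continuous_on {0..1} q" and f: "\<And>t. t \<in> {0..1} \<Longrightarrow> collision_free (q t)"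
  obtains \<delta> where "\<delta> > 0" "\<And>t i j. t \<in> {0..1} \<Longrightarrow> i \<noteq> j \<Longrightarrow> norm (q t $ j - q t $ i) \<ge> \<delta>"
proof -
  have "\<exists>d>0. \<forall>t\<in>{0..1}. i \<noteq> j \<longrightarrow> norm (q t $ j - q t $ i) \<ge> d" for i j
  proof (cases "i = j")
    case False
    have "continuous_on {0..1} (\<lambda>t. norm (q t $ j - q t $ i))"
      by (intro continuous_on_norm continuous_on_diff continuous_on_component c)
    from continuous_attains_inf[OF compact_Icc _ this] obtain t0 where
      t0: "t0 \<in> {0..1}" "\<And>t. t \<in> {0..1} \<Longrightarrow> norm (q t0 $ j - q t0 $ i) \<le> norm (q t $ j - q t $ i)" by auto
    have "norm (q t0 $ j - q t0 $ i) > 0" using f[OF t0(1)] False by (auto simp: collision_free_def)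
    then show ?thesis using t0(2) by blast
  qed (auto intro: exI[of _ 1])
  then obtain d where d: "\<And>i j. d i j > 0" "\<And>i j t. t \<in> {0..1} \<Longrightarrow> i \<noteq> j \<Longrightarrow> norm (q t $ j - q t $ i) \<ge> d i j"
    by metis
  define \<delta> where "\<delta> = Min (range (case_prod d))"
  have "\<delta> \<in> range (case_prod d)" unfolding \<delta>_def by (rule Min_in) auto
  then have "\<delta> > 0" using d(1) by auto
  moreover have "\<delta> \<le> d i j" for i j
    unfolding \<delta>_def by (rule Min_le) (auto intro: image_eqI[of _ _ "(i, j)"])
  ultimately show ?thesis using that d(2) by (meson order.trans)
qed

text \<open>By polarization from the square-integrability of \<open>v\<close>, \<open>w\<close> and
  their sum.\<close>

lemma set_integrable_inner_H1:
  fixes v w :: "real \<Rightarrow> 'a::euclidean_space"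
  assumes "H1_derivative q v" "H1_derivative p w"
  shows "set_integrable lborel {0..1} (\<lambda>t. v t \<bullet> w t)"
proof -
  have l: "bounded_linear (\<lambda>z::'a\<times>'a. fst z + snd z)"
    by (intro bounded_linear_add bounded_linear_fst bounded_linear_snd)
  have s: "H1_derivative (\<lambda>t. q t + p t) (\<lambda>t. v t + w t)"
    using H1_derivative_linear[OF H1_derivative_Pair[OF assms] l] by simp
  have "set_integrable lborel {0..1} (\<lambda>t. ((norm (v t + w t))\<^sup>2 - (norm (v t))\<^sup>2 - (norm (w t))\<^sup>2) / 2)"
    by (intro set_integrable_divide set_integral_diff(1) H1_derivative_norm_square_integrable[OF s]
        H1_derivative_norm_square_integrable[OF assms(1)] H1_derivative_norm_square_integrable[OF assms(2)])
  also have "(\<lambda>t. ((norm (v t + w t))\<^sup>2 - (norm (v t))\<^sup>2 - (norm (w t))\<^sup>2) / 2) = (\<lambda>t. v t \<bullet> w t)"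
    unfolding power2_norm_eq_inner by (simp add: fun_eq_iff inner_add inner_commute)
  finally show ?thesis .
qed

lemma H1_derivative_add_scale:
  fixes q p :: "real \<Rightarrow> 'a::euclidean_space"
  assumes "H1_derivative q v" "H1_derivative p w"
  shows "H1_derivative (\<lambda>t. q t + e *\<^sub>R p t) (\<lambda>t. v t + e *\<^sub>R w t)"
proof -
  have l: "bounded_linear (\<lambda>z::'a\<times>'a. fst z + e *\<^sub>R snd z)"
    by (intro bounded_linear_add bounded_linear_fst bounded_linear_const_scaleR bounded_linear_snd)
  show ?thesis using H1_derivative_linear[OF H1_derivative_Pair[OF assms] l] by simp
qed

text \<open>Minimality and the one-sided expansion give 0 \<le> e B + e^2 C for small
  \<open>e\<close> of either sign, which forces the integral B to vanish without differentiating the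
  action.\<close>

proposition first_variation:
  assumes q: "H1_derivative q v" and f: "\<And>t. t \<in> {0..1} \<Longrightarrow> collision_free (q t)"
    and p: "H1_derivative p w" and e0: "e0 > 0"
    and min: "\<And>e. \<bar>e\<bar> \<le> e0 \<Longrightarrow> action q \<le> action (\<lambda>t. q t + e *\<^sub>R p t)"
  shows "(LINT t:{0..1}|lborel. v t \<bullet> w t + force (q t) \<bullet> p t) = 0"
proof -
  note cq = H1_derivative_continuous[OF q] and cp = H1_derivative_continuous[OF p]
  obtain \<delta> where \<delta>: "\<delta> > 0" "\<And>t i j. t \<in> {0..1} \<Longrightarrow> i \<noteq> j \<Longrightarrow> norm (q t $ j - q t $ i) \<ge> \<delta>"
    by (rule collision_free_separation[OF cq]) (use f in auto)
  obtain K0 where K0: "\<And>t. t \<in> {0..1} \<Longrightarrow> norm (p t) \<le> K0"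
    using compact_imp_bounded[OF compact_continuous_image[OF cp compact_Icc]]
    unfolding bounded_iff by (meson imageI)
  define K where "K = max K0 1"
  have K: "K > 0" "\<And>t. t \<in> {0..1} \<Longrightarrow> norm (p t) \<le> K" using K0 by (auto simp: K_def max.coboundedI1)
  define B where "B = (LINT t:{0..1}|lborel. v t \<bullet> w t + force (q t) \<bullet> p t)"
  define C where "C = (LINT t:{0..1}|lborel. (norm (w t))\<^sup>2 / 2 + 48 / \<delta> ^ 3 * K\<^sup>2)"
  have IB: "set_integrable lborel {0..1} (\<lambda>t. v t \<bullet> w t + force (q t) \<bullet> p t)"
    by (intro set_integral_add(1) set_integrable_inner_H1[OF q p] borel_integrable_atLeastAtMost'
        continuous_on_inner continuous_on_force cq cp f)
  have IC: "set_integrable lborel {0..1} (\<lambda>t. (norm (w t))\<^sup>2 / 2 + 48 / \<delta> ^ 3 * K\<^sup>2)"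
    by (intro set_integral_add(1) set_integrable_divide H1_derivative_norm_square_integrable[OF p] set_integrable_const_Icc)
  have I0: "set_integrable lborel {0..1} (\<lambda>t. (norm (v t))\<^sup>2 / 2 + newton_potential (q t))"
    "action q = ennreal (LINT t:{0..1}|lborel. (norm (v t))\<^sup>2 / 2 + newton_potential (q t))"
    using action_collision_free[OF q] f by blast+
  have key: "0 \<le> e * B + e\<^sup>2 * C" if e: "\<bar>e\<bar> \<le> e0" "\<bar>e\<bar> \<le> \<delta> / (4 * K)" for e
  proof -
    let ?q = "\<lambda>t. q t + e *\<^sub>R p t"
    have h: "norm (e *\<^sub>R p t) \<le> \<delta> / 4" "norm (e *\<^sub>R p t) \<le> \<bar>e\<bar> * K" if "t \<in> {0..1}" for t
    proof -
      show 1: "norm (e *\<^sub>R p t) \<le> \<bar>e\<bar> * K" using K(2)[OF that] by (auto intro: mult_left_mono)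
      have "\<bar>e\<bar> * K \<le> \<delta> / 4" using e(2) K(1) by (simp add: field_simps)
      then show "norm (e *\<^sub>R p t) \<le> \<delta> / 4" using 1 by simp
    qed
    have f': "collision_free (?q t)" if "t \<in> {0..1}" for t
      by (rule newton_potential_expansion(1)[OF \<delta>(1) \<delta>(2)[OF that] h(1)[OF that]])
    note H = H1_derivative_add_scale[OF q p, of e]
    have I1: "set_integrable lborel {0..1} (\<lambda>t. (norm (v t + e *\<^sub>R w t))\<^sup>2 / 2 + newton_potential (?q t))"
      "action ?q = ennreal (LINT t:{0..1}|lborel. (norm (v t + e *\<^sub>R w t))\<^sup>2 / 2 + newton_potential (?q t))"
      using action_collision_free[OF H] f' by blast+
    have "action q \<le> action ?q" by (rule min[OF e(1)])
    then have "(LINT t:{0..1}|lborel. (norm (v t))\<^sup>2 / 2 + newton_potential (q t))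
        \<le> (LINT t:{0..1}|lborel. (norm (v t + e *\<^sub>R w t))\<^sup>2 / 2 + newton_potential (?q t))"
      unfolding I0(2) I1(2)
      by (subst (asm) ennreal_le_iff) (auto simp: set_lebesgue_integral_def newton_potential_nonneg intro!: integral_nonneg_AE)
    also have "\<dots> \<le> (LINT t:{0..1}|lborel. ((norm (v t))\<^sup>2 / 2 + newton_potential (q t)) + e * (v t \<bullet> w t + force (q t) \<bullet> p t)
        + e\<^sup>2 * ((norm (w t))\<^sup>2 / 2 + 48 / \<delta> ^ 3 * K\<^sup>2))"
    proof (rule set_integral_mono)
      show "set_integrable lborel {0..1} (\<lambda>t. (norm (v t + e *\<^sub>R w t))\<^sup>2 / 2 + newton_potential (?q t))" by (rule I1(1))
      show "set_integrable lborel {0..1} (\<lambda>t. ((norm (v t))\<^sup>2 / 2 + newton_potential (q t)) + e * (v t \<bullet> w t + force (q t) \<bullet> p t)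
        + e\<^sup>2 * ((norm (w t))\<^sup>2 / 2 + 48 / \<delta> ^ 3 * K\<^sup>2))"
        by (intro set_integral_add(1) I0(1) set_integrable_mult_right IB IC)
      fix t :: real assume t: "t \<in> {0..1}"
      have "newton_potential (?q t) \<le> newton_potential (q t) + force (q t) \<bullet> (e *\<^sub>R p t) + 48 / \<delta> ^ 3 * (norm (e *\<^sub>R p t))\<^sup>2"
        by (rule newton_potential_expansion(2)[OF \<delta>(1) \<delta>(2)[OF t] h(1)[OF t]])
      also have "48 / \<delta> ^ 3 * (norm (e *\<^sub>R p t))\<^sup>2 \<le> 48 / \<delta> ^ 3 * (\<bar>e\<bar> * K)\<^sup>2"
        using \<delta>(1) h(2)[OF t] by (intro mult_left_mono power_mono) auto
      finally have "newton_potential (?q t) \<le> newton_potential (q t) + e * (force (q t) \<bullet> p t) + e\<^sup>2 * (48 / \<delta> ^ 3 * K\<^sup>2)"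
        by (simp add: power_mult_distrib algebra_simps)
      moreover have "(norm (v t + e *\<^sub>R w t))\<^sup>2 = (norm (v t))\<^sup>2 + 2 * e * (v t \<bullet> w t) + e\<^sup>2 * (norm (w t))\<^sup>2"
        unfolding power2_norm_eq_inner by (simp add: inner_add inner_commute power2_eq_square algebra_simps)
      ultimately show "(norm (v t + e *\<^sub>R w t))\<^sup>2 / 2 + newton_potential (?q t) \<le> ((norm (v t))\<^sup>2 / 2 + newton_potential (q t)) + e * (v t \<bullet> w t + force (q t) \<bullet> p t)
        + e\<^sup>2 * ((norm (w t))\<^sup>2 / 2 + 48 / \<delta> ^ 3 * K\<^sup>2)"
        unfolding distrib_left by linarith
    qed
    also have "\<dots> = (LINT t:{0..1}|lborel. (norm (v t))\<^sup>2 / 2 + newton_potential (q t)) + e * B + e\<^sup>2 * C"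
      unfolding B_def C_def
      by (subst set_integral_add(2), (intro set_integral_add(1) I0(1) set_integrable_mult_right IB IC)+,
          subst set_integral_add(2), (intro set_integral_add(1) I0(1) set_integrable_mult_right IB IC)+) simp
    finally show ?thesis by simp
  qed
  have C0: "C \<ge> 0" unfolding C_def set_lebesgue_integral_def using \<delta>(1)
    by (intro integral_nonneg_AE AE_I2) auto
  define d where "d = min e0 (\<delta> / (4 * K))"
  have d: "d > 0" using e0 \<delta>(1) K(1) by (simp add: d_def)
  have "B = 0"
  proof (rule ccontr)
    assume "B \<noteq> 0"
    \<comment> \<open>Small enough for the linear term to beat e^2 C; its sign is then chosen
      opposite to that of \<open>B\<close>.\<close>
    define e where "e = min d (\<bar>B\<bar> / (2 * (C + 1)))"
    have e: "e > 0" "e \<le> d" "e \<le> \<bar>B\<bar> / (2 * (C + 1))" using d \<open>B \<noteq> 0\<close> C0 by (auto simp: e_def)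
    have "0 \<le> (- sgn B * e) * B + (- sgn B * e)\<^sup>2 * C"
      using e by (intro key) (auto simp: abs_mult d_def abs_sgn_eq \<open>B \<noteq> 0\<close>)
    also have "\<dots> = e * (e * C - \<bar>B\<bar>)"
      using \<open>B \<noteq> 0\<close> by (simp add: power_mult_distrib sgn_if power2_eq_square algebra_simps)
    finally have "\<bar>B\<bar> \<le> e * C" using e(1) by (simp add: zero_le_mult_iff)
    also have "\<dots> \<le> \<bar>B\<bar> / (2 * (C + 1)) * C" using e(3) C0 by (rule mult_right_mono)
    also have "\<dots> = \<bar>B\<bar> * (C / (2 * (C + 1)))" by simp
    also have "\<dots> < \<bar>B\<bar> * 1" using \<open>B \<noteq> 0\<close> C0 by (intro mult_strict_left_mono) (auto simp: field_simps)
    finally show False by simp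
  qed
  then show ?thesis unfolding B_def .
qed

section \<open>Symmetries of the boundary configurations\<close>

definition rot :: "real \<Rightarrow> real^2 \<Rightarrow> real^2" where
  "rot \<alpha> x = vector [x $ 1 * cos \<alpha> - x $ 2 * sin \<alpha>, x $ 1 * sin \<alpha> + x $ 2 * cos \<alpha>]"

text \<open>The mirror line has inclination \<alpha>/2: \<open>reflect 0\<close> fixes the first
  axis and \<open>reflect (2 * \<theta>)\<close> the line of inclination \<theta>.\<close>

definition reflect :: "real \<Rightarrow> real^2 \<Rightarrow> real^2" where
  "reflect \<alpha> x = vector [x $ 1 * cos \<alpha> + x $ 2 * sin \<alpha>, x $ 1 * sin \<alpha> - x $ 2 * cos \<alpha>]"

text \<open>Body i receives the position of body \<open>\<pi> i\<close>, so permutations compose in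
  the order opposite to that of the isometries.\<close>

definition act :: "(real^2 \<Rightarrow> real^2) \<Rightarrow> (4 \<Rightarrow> 4) \<Rightarrow> config \<Rightarrow> config" where
  "act L \<pi> q = (\<chi> i. L (q $ \<pi> i))"

lemma real2_eq_iff: "(x::real^2) = y \<longleftrightarrow> x $ 1 = y $ 1 \<and> x $ 2 = y $ 2"
  unfolding vec_eq_iff forall_2 ..

lemma rot_nth [simp]: "rot \<alpha> x $ 1 = x $ 1 * cos \<alpha> - x $ 2 * sin \<alpha>" "rot \<alpha> x $ 2 = x $ 1 * sin \<alpha> + x $ 2 * cos \<alpha>"
  unfolding rot_def vector_2 by simp_all

lemma reflect_nth [simp]: "reflect \<alpha> x $ 1 = x $ 1 * cos \<alpha> + x $ 2 * sin \<alpha>" "reflect \<alpha> x $ 2 = x $ 1 * sin \<alpha> - x $ 2 * cos \<alpha>"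
  unfolding reflect_def vector_2 by simp_all

lemma rot_0 [simp]: "rot 0 = id"
  by (simp add: fun_eq_iff real2_eq_iff)

lemma rot_2pi: "rot (2 * pi * of_int k) = id"
  by (simp add: fun_eq_iff real2_eq_iff cos_int_2pin sin_int_2pin)

lemma rot_add: "rot (\<alpha> + \<beta>) = rot \<alpha> \<circ> rot \<beta>"
  by (simp add: fun_eq_iff real2_eq_iff cos_add sin_add algebra_simps)

lemma reflect_reflect: "reflect \<alpha> \<circ> reflect \<beta> = rot (\<alpha> - \<beta>)"
  by (simp add: fun_eq_iff real2_eq_iff cos_diff sin_diff algebra_simps)

lemma orthogonal_transformation_rot: "orthogonal_transformation (rot \<alpha>)"
  unfolding orthogonal_transformation
proof (intro conjI allI)
  show "linear (rot \<alpha>)" by (rule linearI) (simp_all add: real2_eq_iff algebra_simps)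
  show "norm (rot \<alpha> x) = norm x" for x
    unfolding norm_real2_eq rot_nth rotated_norm ..
qed

lemma orthogonal_transformation_reflect: "orthogonal_transformation (reflect \<alpha>)"
  unfolding orthogonal_transformation
proof (intro conjI allI)
  show "linear (reflect \<alpha>)" by (rule linearI) (simp_all add: real2_eq_iff algebra_simps)
  show "norm (reflect \<alpha> x) = norm x" for x
    unfolding norm_real2_eq reflect_nth using rotated_norm[of "x $ 1" \<alpha> "- (x $ 2)"] by simp
qed

lemma act_act: "act L \<pi> (act L' \<pi>' q) = act (L \<circ> L') (\<pi>' \<circ> \<pi>) q"
  by (simp add: act_def vec_eq_iff)

lemma act_id [simp]: "act id id q = q"
  by (simp add: act_def vec_eq_iff)

text \<open>Instances are the two boundary reflections and all powers of the screw motion.\<close>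

locale symmetry =
  fixes L :: "real^2 \<Rightarrow> real^2" and \<pi> :: "4 \<Rightarrow> 4"
  assumes L: "orthogonal_transformation L" and \<pi>: "bij \<pi>"
begin

lemma lin: "linear L" and norm_L: "norm (L x) = norm x"
  using L by (auto simp: orthogonal_transformation)

lemma linear_act: "linear (act L \<pi>)"
  by (rule linearI) (simp_all add: act_def vec_eq_iff linear_add[OF lin] linear_scale[OF lin])

lemma bounded_linear_act: "bounded_linear (act L \<pi>)"
  using linear_act by (simp add: linear_conv_bounded_linear)

lemma act_inner: "act L \<pi> q \<bullet> act L \<pi> h = q \<bullet> h"
proof -
  have "act L \<pi> q \<bullet> act L \<pi> h = (\<Sum>i\<in>UNIV. q $ \<pi> i \<bullet> h $ \<pi> i)"
    using L unfolding inner_vec_def[where 'a = "real^2"] act_def vec_lambda_beta orthogonal_transformation_def by simp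
  also have "\<dots> = (\<Sum>i\<in>UNIV. q $ i \<bullet> h $ i)" by (rule sum.reindex_bij_betw[OF \<pi>])
  finally show ?thesis unfolding inner_vec_def[where 'a = "real^2"] .
qed

lemma act_centered: "q \<in> centered \<Longrightarrow> act L \<pi> q \<in> centered"
proof -
  assume "q \<in> centered"
  then have "L (\<Sum>i\<in>UNIV. q $ i) = 0" by (simp add: centered_def linear_0[OF lin])
  then have "(\<Sum>i\<in>UNIV. L (q $ i)) = 0" by (simp add: linear_sum[OF lin])
  moreover have "(\<Sum>i\<in>UNIV. L (q $ \<pi> i)) = (\<Sum>i\<in>UNIV. L (q $ i))" by (rule sum.reindex_bij_betw[OF \<pi>])
  ultimately show ?thesis by (simp add: centered_def act_def)
qed

lemma act_collision_free: "collision_free (act L \<pi> q) \<longleftrightarrow> collision_free q"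
proof -
  have "inj L" using orthogonal_transformation_inj[OF L] .
  then have "L x = L y \<longleftrightarrow> x = y" for x y by (auto dest: injD)
  moreover have "\<pi> i = \<pi> j \<longleftrightarrow> i = j" for i j using \<pi> by (auto dest: bij_is_inj injD)
  moreover have "\<exists>i'. i = \<pi> i'" for i using \<pi> by (metis bij_pointE)
  ultimately show ?thesis unfolding collision_free_def act_def vec_lambda_beta by metis
qed

text \<open>A linear isometry passes through the interaction, and since the masses are equal a
  permutation only reindexes the sum.\<close>

lemma act_force: "force (act L \<pi> q) = act L \<pi> (force q)"
proof -
  have "force (act L \<pi> q) $ i = act L \<pi> (force q) $ i" for i
  proof -
    let ?f = "\<lambda>j. (1 / norm (q $ j - q $ \<pi> i) ^ 3) *\<^sub>R (q $ j - q $ \<pi> i)"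
    have "force (act L \<pi> q) $ i = (\<Sum>j\<in>UNIV. L (?f (\<pi> j)))"
      unfolding force_nth act_def vec_lambda_beta
      by (intro sum.cong refl) (simp only: linear_diff[OF lin, symmetric] norm_L linear_scale[OF lin])
    also have "\<dots> = (\<Sum>j\<in>UNIV. L (?f j))" by (rule sum.reindex_bij_betw[OF \<pi>])
    also have "\<dots> = act L \<pi> (force q) $ i"
      unfolding act_def vec_lambda_beta force_nth by (simp only: linear_sum[OF lin])
    finally show ?thesis .
  qed
  then show ?thesis by (simp add: vec_eq_iff)
qed

end

section \<open>The boundary sets inside the fixed spaces of two reflections\<close>

definition swap12 :: "4 \<Rightarrow> 4" where "swap12 i = (if i = 1 then 2 else if i = 2 then 1 else i)"
definition swap34 :: "4 \<Rightarrow> 4" where "swap34 i = (if i = 3 then 4 else if i = 4 then 3 else i)"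

lemma swap_simps [simp]:
  "swap12 1 = 2" "swap12 2 = 1" "swap12 3 = 3" "swap12 4 = 4"
  "swap34 1 = 1" "swap34 2 = 2" "swap34 3 = 4" "swap34 4 = 3"
  by (simp_all add: swap12_def swap34_def)

lemma swap_comp: "swap12 \<circ> swap12 = id" "swap34 \<circ> swap34 = id" "swap12 \<circ> swap34 = swap34 \<circ> swap12"
  by (simp_all add: fun_eq_iff forall_4)

lemma bij_swap: "bij swap12" "bij swap34"
  using swap_comp(1,2) by (auto intro: o_bij)

abbreviation \<sigma>\<^sub>S :: "config \<Rightarrow> config" where "\<sigma>\<^sub>S \<equiv> act (reflect 0) swap34"
abbreviation \<sigma>\<^sub>E :: "real \<Rightarrow> config \<Rightarrow> config" where "\<sigma>\<^sub>E \<theta> \<equiv> act (reflect (2 * \<theta>)) (swap34 \<circ> swap12)"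

interpretation S: symmetry "reflect 0" swap34
  by unfold_locales (intro orthogonal_transformation_reflect bij_swap)+

interpretation E: symmetry "reflect (2 * \<theta>)" "swap34 \<circ> swap12" for \<theta>
  by unfold_locales (intro orthogonal_transformation_reflect bij_comp bij_swap)+

lemma involution: "\<sigma>\<^sub>S (\<sigma>\<^sub>S q) = q" "\<sigma>\<^sub>E \<theta> (\<sigma>\<^sub>E \<theta> q) = q"
proof -
  have "(swap34 \<circ> swap12) \<circ> (swap34 \<circ> swap12) = id" by (simp add: fun_eq_iff forall_4)
  then show "\<sigma>\<^sub>S (\<sigma>\<^sub>S q) = q" "\<sigma>\<^sub>E \<theta> (\<sigma>\<^sub>E \<theta> q) = q"
    by (simp_all add: act_act reflect_reflect swap_comp)
qed

lemma centered_iff: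
  "q \<in> centered \<longleftrightarrow> q $ 1 $ 1 + q $ 2 $ 1 + q $ 3 $ 1 + q $ 4 $ 1 = 0 \<and> q $ 1 $ 2 + q $ 2 $ 2 + q $ 3 $ 2 + q $ 4 $ 2 = 0"
  unfolding centered_def mem_Collect_eq sum_4 real2_eq_iff by simp

lemma \<sigma>\<^sub>S_fixed_iff:
  "\<sigma>\<^sub>S q = q \<longleftrightarrow> q $ 1 $ 2 = 0 \<and> q $ 2 $ 2 = 0 \<and> q $ 3 $ 1 = q $ 4 $ 1 \<and> q $ 3 $ 2 = - q $ 4 $ 2"
  unfolding act_def config_eq_iff vec_lambda_beta swap_simps reflect_nth by (simp, linarith)

text \<open>Bodies 1 and 2 determine a and c, body 3 determines b, and centering forces the abscissa
  (2a + c)/2. As part of a fixed space cut out by two inequalities, the set yields both the natural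
  boundary condition and the extension by reflection.\<close>

lemma mem_Q_S_iff_fixed:
  "q \<in> Q_S \<longleftrightarrow> q \<in> centered \<and> \<sigma>\<^sub>S q = q \<and> q $ 3 $ 2 \<ge> 0 \<and> q $ 2 $ 1 - q $ 1 $ 1 \<ge> 0" (is "_ \<longleftrightarrow> ?R")
proof
  assume "q \<in> Q_S"
  then obtain a b c where "b \<ge> 0" "c \<ge> 0" "q$1$1 = - a - c" "q$1$2 = 0" "q$2$1 = - a" "q$2$2 = 0"
     "q$3$1 = (2 * a + c) / 2" "q$3$2 = b" "q$4$1 = (2 * a + c) / 2" "q$4$2 = - b"
    unfolding mem_Q_S_iff by blast
  then show ?R unfolding centered_iff \<sigma>\<^sub>S_fixed_iff by simp
next
  assume ?R
  then show "q \<in> Q_S" unfolding mem_Q_S_iff centered_iff \<sigma>\<^sub>S_fixed_iff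
    by (intro exI[of _ "- q $ 2 $ 1"] exI[of _ "q $ 3 $ 2"] exI[of _ "q $ 2 $ 1 - q $ 1 $ 1"]) simp
qed

text \<open>Coordinates with respect to the mirror line of inclination \<theta>, in which its
  reflection is diagonal.\<close>

definition along :: "real \<Rightarrow> real^2 \<Rightarrow> real" where "along \<theta> x = x $ 1 * cos \<theta> + x $ 2 * sin \<theta>"
definition across :: "real \<Rightarrow> real^2 \<Rightarrow> real" where "across \<theta> x = x $ 2 * cos \<theta> - x $ 1 * sin \<theta>"

lemma along_across_linear:
  "along \<theta> (x + y) = along \<theta> x + along \<theta> y" "across \<theta> (x + y) = across \<theta> x + across \<theta> y"
  "along \<theta> (x - y) = along \<theta> x - along \<theta> y" "across \<theta> (x - y) = across \<theta> x - across \<theta> y"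
  "along \<theta> (r *\<^sub>R x) = r * along \<theta> x" "across \<theta> (r *\<^sub>R x) = r * across \<theta> x" "along \<theta> 0 = 0" "across \<theta> 0 = 0"
  by (simp_all add: along_def across_def algebra_simps)

lemma along_across_reflect: "along \<theta> (reflect (2 * \<theta>) x) = along \<theta> x" "across \<theta> (reflect (2 * \<theta>) x) = - across \<theta> x"
proof -
  have c: "cos \<theta> = cos (2 * \<theta>) * cos \<theta> + sin (2 * \<theta>) * sin \<theta>" and s: "sin \<theta> = sin (2 * \<theta>) * cos \<theta> - cos (2 * \<theta>) * sin \<theta>"
    using cos_diff[of "2 * \<theta>" \<theta>] sin_diff[of "2 * \<theta>" \<theta>] by simp_all
  have "along \<theta> (reflect (2 * \<theta>) x) = x $ 1 * (cos (2 * \<theta>) * cos \<theta> + sin (2 * \<theta>) * sin \<theta>) + x $ 2 * (sin (2 * \<theta>) * cos \<theta> - cos (2 * \<theta>) * sin \<theta>)"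
    unfolding along_def reflect_nth by (simp only: algebra_simps)
  then show "along \<theta> (reflect (2 * \<theta>) x) = along \<theta> x" unfolding along_def c[symmetric] s[symmetric] .
  have "across \<theta> (reflect (2 * \<theta>) x) = x $ 1 * (sin (2 * \<theta>) * cos \<theta> - cos (2 * \<theta>) * sin \<theta>) - x $ 2 * (cos (2 * \<theta>) * cos \<theta> + sin (2 * \<theta>) * sin \<theta>)"
    unfolding across_def reflect_nth by (simp only: algebra_simps)
  then show "across \<theta> (reflect (2 * \<theta>) x) = - across \<theta> x" unfolding across_def c[symmetric] s[symmetric] by simp
qed

lemma along_across_inverse: "x $ 1 = along \<theta> x * cos \<theta> - across \<theta> x * sin \<theta>" "x $ 2 = along \<theta> x * sin \<theta> + across \<theta> x * cos \<theta>"
proof -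
  have "along \<theta> x * cos \<theta> - across \<theta> x * sin \<theta> = x $ 1 * ((sin \<theta>)\<^sup>2 + (cos \<theta>)\<^sup>2)"
    "along \<theta> x * sin \<theta> + across \<theta> x * cos \<theta> = x $ 2 * ((sin \<theta>)\<^sup>2 + (cos \<theta>)\<^sup>2)"
    by (simp_all add: along_def across_def power2_eq_square algebra_simps del: sin_cos_squared_add sin_cos_squared_add2 sin_cos_squared_add3)
  then show "x $ 1 = along \<theta> x * cos \<theta> - across \<theta> x * sin \<theta>" "x $ 2 = along \<theta> x * sin \<theta> + across \<theta> x * cos \<theta>" by simp_all
qed

lemma along_across_eq_iff: "x = y \<longleftrightarrow> along \<theta> x = along \<theta> y \<and> across \<theta> x = across \<theta> y"
proof
  assume "along \<theta> x = along \<theta> y \<and> across \<theta> x = across \<theta> y"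
  then show "x = y" unfolding real2_eq_iff using along_across_inverse[of x \<theta>] along_across_inverse[of y \<theta>] by simp
qed simp

lemma real2_eq_along_across: "x $ 1 = r * cos \<theta> - s * sin \<theta> \<and> x $ 2 = r * sin \<theta> + s * cos \<theta> \<longleftrightarrow> along \<theta> x = r \<and> across \<theta> x = s"
proof
  assume h: "x $ 1 = r * cos \<theta> - s * sin \<theta> \<and> x $ 2 = r * sin \<theta> + s * cos \<theta>"
  have "along \<theta> x = r * ((sin \<theta>)\<^sup>2 + (cos \<theta>)\<^sup>2)" "across \<theta> x = s * ((sin \<theta>)\<^sup>2 + (cos \<theta>)\<^sup>2)"
    unfolding along_def across_def conjunct1[OF h] conjunct2[OF h]
    by (simp_all add: power2_eq_square algebra_simps del: sin_cos_squared_add sin_cos_squared_add2 sin_cos_squared_add3)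
  then show "along \<theta> x = r \<and> across \<theta> x = s" by simp
qed (use along_across_inverse[of x \<theta>] in auto)

lemma \<sigma>\<^sub>E_fixed_iff:
  "\<sigma>\<^sub>E \<theta> q = q \<longleftrightarrow> along \<theta> (q $ 1) = along \<theta> (q $ 2) \<and> across \<theta> (q $ 1) = - across \<theta> (q $ 2) \<and>
     along \<theta> (q $ 3) = along \<theta> (q $ 4) \<and> across \<theta> (q $ 3) = - across \<theta> (q $ 4)"
  unfolding act_def vec_eq_iff[where 'a = "real^2"] vec_lambda_beta forall_4 along_across_eq_iff[of _ _ \<theta>] along_across_reflect
  by auto

lemma mem_Q_E2_iff_fixed:
  "q \<in> Q_E2 \<theta> \<longleftrightarrow> q \<in> centered \<and> \<sigma>\<^sub>E \<theta> q = q \<and> across \<theta> (q $ 2) \<ge> 0 \<and> across \<theta> (q $ 3) \<ge> 0" (is "_ \<longleftrightarrow> ?R")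
proof -
  have "q \<in> Q_E2 \<theta> \<longleftrightarrow> (\<exists>a b c. b \<ge> 0 \<and> c \<ge> 0 \<and> (along \<theta> (q $ 1) = - a \<and> across \<theta> (q $ 1) = - b) \<and>
     (along \<theta> (q $ 2) = - a \<and> across \<theta> (q $ 2) = b) \<and> (along \<theta> (q $ 3) = a \<and> across \<theta> (q $ 3) = c) \<and>
     (along \<theta> (q $ 4) = a \<and> across \<theta> (q $ 4) = - c))" (is "_ \<longleftrightarrow> ?M")
    unfolding mem_Q_E2_iff real2_eq_along_across[symmetric] by (simp add: conj_assoc)
  also have "?M \<longleftrightarrow> ?R"
  proof
    assume ?M
    then show ?R
      by (auto simp: centered_def sum_4 \<sigma>\<^sub>E_fixed_iff along_across_linear along_across_eq_iff[of "_ + _" _ \<theta>])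
  next
    assume r: ?R
    then have "q $ 1 + q $ 2 + q $ 3 + q $ 4 = 0" by (simp add: centered_def sum_4)
    then have "along \<theta> (q $ 1 + q $ 2 + q $ 3 + q $ 4) = 0" by (simp only: along_across_linear(7))
    then have "along \<theta> (q $ 1) + along \<theta> (q $ 2) + along \<theta> (q $ 3) + along \<theta> (q $ 4) = 0" by (simp only: along_across_linear)
    moreover have "along \<theta> (q $ 2) = along \<theta> (q $ 1)" "across \<theta> (q $ 1) = - across \<theta> (q $ 2)" "along \<theta> (q $ 4) = along \<theta> (q $ 3)" "across \<theta> (q $ 4) = - across \<theta> (q $ 3)"
      using r unfolding \<sigma>\<^sub>E_fixed_iff by auto
    ultimately show ?M using r
      by (intro exI[of _ "along \<theta> (q $ 3)"] exI[of _ "across \<theta> (q $ 2)"] exI[of _ "across \<theta> (q $ 3)"]) auto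
  qed
  finally show ?thesis .
qed

section \<open>Regularity of the minimizer\<close>

lemma positive_perturbation:
  fixes x y :: real
  assumes "x > 0"
  shows "\<exists>e0>0. \<forall>e. \<bar>e\<bar> \<le> e0 \<longrightarrow> x + e * y \<ge> 0"
proof (intro exI[of _ "x / (\<bar>y\<bar> + 1)"] conjI allI impI)
  fix e assume e: "\<bar>e\<bar> \<le> x / (\<bar>y\<bar> + 1)"
  have "\<bar>e * y\<bar> \<le> x / (\<bar>y\<bar> + 1) * \<bar>y\<bar>" unfolding abs_mult using e by (rule mult_right_mono) simp
  also have "\<dots> \<le> x" using assms by (simp add: field_simps)
  finally show "x + e * y \<ge> 0" by linarith
qed (use assms in simp)

lemma centered_add_scale: "p \<in> centered \<Longrightarrow> q \<in> centered \<Longrightarrow> p + e *\<^sub>R q \<in> centered"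
proof -
  assume "p \<in> centered" "q \<in> centered"
  then have "(\<Sum>i\<in>UNIV. p $ i) + e *\<^sub>R (\<Sum>i\<in>UNIV. q $ i) = 0" by (simp add: centered_def)
  then show ?thesis by (simp add: centered_def sum.distrib scaleR_sum_right)
qed

text \<open>Only the two order conditions could obstruct variations of both signs. Equality in one
  of them would, for a fixed configuration, place 3 on 4 or 1 on 2, so without collisions both are
  strict and persist.\<close>

lemma Q_S_perturbation:
  assumes q: "q \<in> Q_S" "collision_free q" and h: "h \<in> centered" "\<sigma>\<^sub>S h = h"
  shows "\<exists>e0>0. \<forall>e. \<bar>e\<bar> \<le> e0 \<longrightarrow> q + e *\<^sub>R h \<in> Q_S"
proof -
  note Q = q(1)[unfolded mem_Q_S_iff_fixed]
  have "q $ 3 \<noteq> q $ 4" "q $ 1 \<noteq> q $ 2" using q(2) unfolding collision_free_def by simp_all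
  then have pos: "q $ 3 $ 2 > 0" "q $ 2 $ 1 - q $ 1 $ 1 > 0"
    using Q unfolding \<sigma>\<^sub>S_fixed_iff real2_eq_iff by linarith+
  obtain e1 where e1: "e1 > 0" "\<And>e. \<bar>e\<bar> \<le> e1 \<Longrightarrow> q $ 3 $ 2 + e * h $ 3 $ 2 \<ge> 0"
    using positive_perturbation[OF pos(1)] by blast
  obtain e2 where e2: "e2 > 0" "\<And>e. \<bar>e\<bar> \<le> e2 \<Longrightarrow> q $ 2 $ 1 - q $ 1 $ 1 + e * (h $ 2 $ 1 - h $ 1 $ 1) \<ge> 0"
    using positive_perturbation[OF pos(2)] by blast
  have "q + e *\<^sub>R h \<in> Q_S" if "\<bar>e\<bar> \<le> min e1 e2" for e
  proof -
    have "\<sigma>\<^sub>S (q + e *\<^sub>R h) = q + e *\<^sub>R h"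
      using Q h(2) linear_add[OF S.linear_act, of q "e *\<^sub>R h"] linear_scale[OF S.linear_act, of e h] by simp
    then show ?thesis unfolding mem_Q_S_iff_fixed
      using Q centered_add_scale[OF _ h(1), of q e] e1(2)[of e] e2(2)[of e] that by (simp add: algebra_simps)
  qed
  then show ?thesis using e1 e2 by (intro exI[of _ "min e1 e2"]) auto
qed

lemma Q_E2_perturbation:
  assumes q: "q \<in> Q_E2 \<theta>" "collision_free q" and h: "h \<in> centered" "\<sigma>\<^sub>E \<theta> h = h"
  shows "\<exists>e0>0. \<forall>e. \<bar>e\<bar> \<le> e0 \<longrightarrow> q + e *\<^sub>R h \<in> Q_E2 \<theta>"
proof -
  note Q = q(1)[unfolded mem_Q_E2_iff_fixed]
  have "q $ 3 \<noteq> q $ 4" "q $ 1 \<noteq> q $ 2" using q(2) unfolding collision_free_def by simp_all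
  then have pos: "across \<theta> (q $ 2) > 0" "across \<theta> (q $ 3) > 0"
    using Q unfolding \<sigma>\<^sub>E_fixed_iff along_across_eq_iff[of _ _ \<theta>] by linarith+
  obtain e1 where e1: "e1 > 0" "\<And>e. \<bar>e\<bar> \<le> e1 \<Longrightarrow> across \<theta> (q $ 2) + e * across \<theta> (h $ 2) \<ge> 0"
    using positive_perturbation[OF pos(1)] by blast
  obtain e2 where e2: "e2 > 0" "\<And>e. \<bar>e\<bar> \<le> e2 \<Longrightarrow> across \<theta> (q $ 3) + e * across \<theta> (h $ 3) \<ge> 0"
    using positive_perturbation[OF pos(2)] by blast
  have "q + e *\<^sub>R h \<in> Q_E2 \<theta>" if "\<bar>e\<bar> \<le> min e1 e2" for e
  proof -
    have "\<sigma>\<^sub>E \<theta> (q + e *\<^sub>R h) = q + e *\<^sub>R h"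
      using Q h(2) linear_add[OF E.linear_act, of \<theta> q "e *\<^sub>R h"] linear_scale[OF E.linear_act, of \<theta> e h] by simp
    then show ?thesis unfolding mem_Q_E2_iff_fixed
      using Q centered_add_scale[OF _ h(1), of q e] e1(2)[of e] e2(2)[of e] that by (simp add: along_across_linear)
  qed
  then show ?thesis using e1 e2 by (intro exI[of _ "min e1 e2"]) auto
qed

lemma paths_perturbation:
  assumes P: "P \<in> paths \<theta>" "collision_free (P 0)" "collision_free (P 1)"
    and p: "H1_derivative p w" "\<And>t. t \<in> {0..1} \<Longrightarrow> p t \<in> centered" "\<sigma>\<^sub>S (p 0) = p 0" "\<sigma>\<^sub>E \<theta> (p 1) = p 1"
  shows "\<exists>e0>0. \<forall>e. \<bar>e\<bar> \<le> e0 \<longrightarrow> (\<lambda>t. P t + e *\<^sub>R p t) \<in> paths \<theta>"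
proof -
  obtain v where v: "H1_derivative P v" using P(1) by (auto simp: paths_def H1_def)
  have c: "p 0 \<in> centered" "p 1 \<in> centered" using p(2) by simp_all
  obtain e1 where e1: "e1 > 0" "\<And>e. \<bar>e\<bar> \<le> e1 \<Longrightarrow> P 0 + e *\<^sub>R p 0 \<in> Q_S"
    using Q_S_perturbation[OF _ P(2) c(1) p(3)] P(1) unfolding paths_def by blast
  obtain e2 where e2: "e2 > 0" "\<And>e. \<bar>e\<bar> \<le> e2 \<Longrightarrow> P 1 + e *\<^sub>R p 1 \<in> Q_E2 \<theta>"
    using Q_E2_perturbation[OF _ P(3) c(2) p(4)] P(1) unfolding paths_def by blast
  have "(\<lambda>t. P t + e *\<^sub>R p t) \<in> paths \<theta>" if "\<bar>e\<bar> \<le> min e1 e2" for e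
    unfolding paths_def H1_def mem_Collect_eq
    using H1_derivative_add_scale[OF v p(1), of e] P(1) p(2) e1(2)[of e] e2(2)[of e] that
    by (auto simp: paths_def intro: centered_add_scale)
  then show ?thesis using e1 e2 by (intro exI[of _ "min e1 e2"]) auto
qed

text \<open>Mutual forces are antisymmetric. This keeps the primitives of the force centered, so
  that test curves built from them are admissible.\<close>

lemma force_centered: "force q \<in> centered"
proof -
  define g where "g i j = (1 / norm (q $ j - q $ i) ^ 3) *\<^sub>R (q $ j - q $ i)" for i j
  have g: "g j i = - g i j" for i j unfolding g_def by (simp add: norm_minus_commute[of "q $ j"] algebra_simps)
  have "(\<Sum>i\<in>UNIV. \<Sum>j\<in>UNIV. g i j) = (\<Sum>i\<in>UNIV. \<Sum>j\<in>UNIV. g j i)" by (rule sum.swap)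
  also have "\<dots> = (\<Sum>i\<in>UNIV. \<Sum>j\<in>UNIV. - g i j)" by (intro sum.cong refl g)
  also have "\<dots> = - (\<Sum>i\<in>UNIV. \<Sum>j\<in>UNIV. g i j)" by (simp only: sum_negf)
  finally have "(\<Sum>i\<in>UNIV. \<Sum>j\<in>UNIV. g i j) = 0" unfolding eq_neg_iff_add_eq_0 by (simp flip: scaleR_2)
  then show ?thesis unfolding centered_def mem_Collect_eq force_nth g_def .
qed

lemma integral_centered:
  fixes f :: "real \<Rightarrow> config"
  assumes f: "continuous_on {a..b} f" "\<And>s. s \<in> {a..b} \<Longrightarrow> f s \<in> centered"
  shows "integral {a..b} f \<in> centered"
proof -
  have l: "bounded_linear (\<lambda>q::config. \<Sum>i\<in>UNIV. q $ i)"
    by (intro bounded_linear_sum bounded_linear_vec_nth)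
  have "(\<Sum>i\<in>UNIV. integral {a..b} f $ i) = integral {a..b} ((\<lambda>q. \<Sum>i\<in>UNIV. q $ i) \<circ> f)"
    by (rule integral_linear[OF integrable_continuous_interval[OF f(1)] l, symmetric])
  also have "\<dots> = integral {a..b} (\<lambda>_. 0)"
    by (rule integral_cong) (use f(2) in \<open>simp add: centered_def\<close>)
  finally show ?thesis by (simp add: centered_def)
qed

lemma H1_integration_by_parts:
  fixes p w q v :: "real \<Rightarrow> 'a::euclidean_space"
  assumes p: "H1_derivative p w" and q: "H1_derivative q v"
  shows "set_integrable lborel {0..1} (\<lambda>t. q t \<bullet> w t + p t \<bullet> v t)"
    and "p 1 \<bullet> q 1 - p 0 \<bullet> q 0 = (LINT t:{0..1}|lborel. q t \<bullet> w t + p t \<bullet> v t)"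
proof -
  define F where "F z = fst z \<bullet> snd z" for z :: "'a \<times> 'a"
  define F' where "F' z = (snd z, fst z)" for z :: "'a \<times> 'a"
  have F: "(F has_derivative (\<lambda>h. F' z \<bullet> h)) (at z)" for z
    unfolding F_def by (auto intro!: derivative_eq_intros simp: F'_def inner_prod_def inner_commute)
  have F': "continuous_on UNIV F'" unfolding F'_def by (auto intro!: continuous_intros)
  note C = H1_chain_rule[OF H1_derivative_Pair[OF p q] F F' order_refl zero_le_one order_refl]
  show "set_integrable lborel {0..1} (\<lambda>t. q t \<bullet> w t + p t \<bullet> v t)"
    using C(1) by (simp add: F'_def inner_prod_def)
  show "p 1 \<bullet> q 1 - p 0 \<bullet> q 0 = (LINT t:{0..1}|lborel. q t \<bullet> w t + p t \<bullet> v t)"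
    using C(2) by (simp add: F_def F'_def inner_prod_def)
qed

lemma H1_derivative_primitive:
  fixes f :: "real \<Rightarrow> 'a::euclidean_space"
  assumes "continuous_on {0..1} f"
  shows "H1_derivative (\<lambda>t. integral {0..t} f) f"
  by (rule H1_derivative_C1[OF assms]) (rule integral_has_vector_derivative[OF assms])

text \<open>The natural boundary condition at an end says that the velocity is orthogonal to the fixed space
  of the symmetry \<open>\<sigma>\<close> there; testing it with the fixed vector \<open>V + \<sigma> V\<close> gives \<open>\<sigma> V = - V\<close>.\<close>

proposition minimizer_smooth:
  assumes P: "P \<in> paths \<theta>" and min: "\<And>q. q \<in> paths \<theta> \<Longrightarrow> action P \<le> action q"
    and f: "\<And>t. t \<in> {0..1} \<Longrightarrow> collision_free (P t)"
  obtains V where "\<And>t. t \<in> {0..1} \<Longrightarrow> (P has_vector_derivative V t) (at t within {0..1})"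
    and "\<And>t. t \<in> {0..1} \<Longrightarrow> (V has_vector_derivative force (P t)) (at t within {0..1})"
    and "\<sigma>\<^sub>S (V 0) = - V 0" and "\<sigma>\<^sub>E \<theta> (V 1) = - V 1"
proof -
  have FV: "(LINT t:{0..1}|lborel. v t \<bullet> w t + force (P t) \<bullet> p t) = 0"
    if "H1_derivative P v" "H1_derivative p w" "\<And>t. t \<in> {0..1} \<Longrightarrow> p t \<in> centered" "\<sigma>\<^sub>S (p 0) = p 0" "\<sigma>\<^sub>E \<theta> (p 1) = p 1"
    for p v w
  proof -
    have "collision_free (P 0)" "collision_free (P 1)" using f by simp_all
    from paths_perturbation[OF P this that(2,3,4,5)]
    obtain e0 where e0: "e0 > 0" "\<And>e. \<bar>e\<bar> \<le> e0 \<Longrightarrow> (\<lambda>t. P t + e *\<^sub>R p t) \<in> paths \<theta>" by blast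
    show ?thesis by (rule first_variation[OF that(1) f that(2) e0(1)]) (auto intro: min e0(2))
  qed
  obtain v where v: "H1_derivative P v" using P by (auto simp: paths_def H1_def)
  have Pc: "P t \<in> centered" if "t \<in> {0..1}" for t using P that by (simp add: paths_def)
  have cf: "continuous_on {0..1} (\<lambda>t. force (P t))"
    by (rule continuous_on_force[OF H1_derivative_continuous[OF v] f])
  define p where "p t = integral {0..t} (\<lambda>s. force (P s))" for t
  have Hp: "H1_derivative p (\<lambda>t. force (P t))" unfolding p_def by (rule H1_derivative_primitive[OF cf])
  have cp: "continuous_on {0..1} p" by (rule H1_derivative_continuous[OF Hp])
  define I where "I t = integral {0..t} p" for t
  have HI: "H1_derivative I p" unfolding I_def by (rule H1_derivative_primitive[OF cp])
  have I0: "I 0 = 0" "p 0 = 0" by (simp_all add: I_def p_def)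
  have pc: "p t \<in> centered" if "t \<in> {0..1}" for t
    unfolding p_def using that by (intro integral_centered continuous_on_subset[OF cf] force_centered) auto
  have Ic: "I t \<in> centered" if "t \<in> {0..1}" for t
    unfolding I_def using that by (intro integral_centered continuous_on_subset[OF cp] pc) auto
  define c where "c = P 1 - P 0 - I 1"
  have cs: "x - y \<in> centered" if "x \<in> centered" "y \<in> centered" for x y :: config
    using centered_add_scale[OF that, of "-1"] by simp
  have z: "0 \<in> (centered :: config set)" by (simp add: centered_def)
  have cc: "c \<in> centered" unfolding c_def by (intro cs Pc Ic) auto
  \<comment> \<open>The device of du Bois-Reymond: \<open>\<eta>\<close> compares P with the curve P
    0 + I t + t c, whose acceleration is \<open>force (P t)\<close>. The constant \<open>c\<close>
    makes the end points agree, and the difference itself becomes the test curve.\<close>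
  define \<eta> where "\<eta> t = P t - P 0 - I t - t *\<^sub>R c" for t
  define w where "w t = v t - p t - c" for t
  have Hc: "H1_derivative (\<lambda>t. P 0 + t *\<^sub>R c) (\<lambda>_. c)"
    by (rule H1_derivative_C1) (auto intro!: derivative_eq_intros)
  have "H1_derivative (\<lambda>t. (P t + (-1) *\<^sub>R I t) + (-1) *\<^sub>R (P 0 + t *\<^sub>R c)) (\<lambda>t. (v t + (-1) *\<^sub>R p t) + (-1) *\<^sub>R c)"
    by (intro H1_derivative_add_scale v HI Hc)
  then have H\<eta>: "H1_derivative \<eta> w" unfolding \<eta>_def[abs_def] w_def[abs_def] by (simp add: algebra_simps)
  have \<eta>0: "\<eta> 0 = 0" "\<eta> 1 = 0" by (simp_all add: \<eta>_def I0 c_def)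
  have \<eta>c: "\<eta> t \<in> centered" if "t \<in> {0..1}" for t
    unfolding \<eta>_def using that centered_add_scale[OF z cc, of t] by (intro cs Pc Ic) auto
  have fix0: "\<sigma>\<^sub>S 0 = 0" "\<sigma>\<^sub>E \<theta> 0 = 0" using linear_0[OF S.linear_act] linear_0[OF E.linear_act] by auto
  note F1 = FV[OF v H\<eta> \<eta>c, unfolded \<eta>0, OF _ fix0]
  note parts = H1_integration_by_parts[OF Hp H\<eta>] H1_integration_by_parts[OF Hc H\<eta>]
  \<comment> \<open>Integrating the derivative of the inner product of \<open>p\<close> and
    \<open>\<eta>\<close> removes the force from the first variation.\<close>
  have "(LINT t:{0..1}|lborel. (v t \<bullet> w t + force (P t) \<bullet> \<eta> t) - (\<eta> t \<bullet> force (P t) + p t \<bullet> w t)) = 0"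
  proof -
    have "set_integrable lborel {0..1} (\<lambda>t. v t \<bullet> w t + force (P t) \<bullet> \<eta> t)"
      by (intro set_integral_add(1) set_integrable_inner_H1[OF v H\<eta>] borel_integrable_atLeastAtMost'
          continuous_on_inner cf H1_derivative_continuous[OF H\<eta>])
    then show ?thesis using parts(1,2) F1 \<eta>0 by (subst set_integral_diff(2)) simp_all
  qed
  moreover have "(v t \<bullet> w t + force (P t) \<bullet> \<eta> t) - (\<eta> t \<bullet> force (P t) + p t \<bullet> w t) = (norm (w t))\<^sup>2 + c \<bullet> w t" for t
  proof -
    have "(norm (w t))\<^sup>2 + c \<bullet> w t = (w t + c) \<bullet> w t" by (simp add: power2_norm_eq_inner inner_add_left)
    also have "w t + c = v t - p t" by (simp add: w_def)
    finally show ?thesis using inner_commute[of "force (P t)" "\<eta> t"] by (simp add: inner_diff_left)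
  qed
  ultimately have 1: "(LINT t:{0..1}|lborel. (norm (w t))\<^sup>2 + c \<bullet> w t) = 0" by simp
  \<comment> \<open>\<open>\<eta>\<close> vanishes at both ends, so the integral of its derivative
    against a constant is zero.\<close>
  have 2: "(LINT t:{0..1}|lborel. c \<bullet> w t) = 0" and ci: "set_integrable lborel {0..1} (\<lambda>t. c \<bullet> w t)"
  proof -
    have l: "bounded_linear (\<lambda>x::config. c \<bullet> x)" by (rule bounded_linear_inner_right)
    note H = H1_derivative_linear[OF H\<eta> l]
    show "set_integrable lborel {0..1} (\<lambda>t. c \<bullet> w t)" by (rule H1_derivative_set_integrable[OF H])
    show "(LINT t:{0..1}|lborel. c \<bullet> w t) = 0"
      using H1_derivative_increment[OF H, of 0 1] \<eta>0 by simp
  qed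
  have wi: "set_integrable lborel {0..1} (\<lambda>t. (norm (w t))\<^sup>2)" by (rule H1_derivative_norm_square_integrable[OF H\<eta>])
  have "(LINT t:{0..1}|lborel. (norm (w t))\<^sup>2) = 0"
    using 1 2 unfolding set_integral_add(2)[OF wi ci] by simp
  then have "AE t in lborel. indicator {0..1} t *\<^sub>R (norm (w t))\<^sup>2 = 0"
    using wi unfolding set_lebesgue_integral_def set_integrable_def
    by (subst (asm) integral_nonneg_eq_0_iff_AE) auto
  then have w0: "AE t\<in>{0..1} in lborel. w t = 0"
    by eventually_elim (auto split: split_indicator_asm)
  have \<eta>z: "\<eta> t = 0" if t: "t \<in> {0..1}" for t
  proof -
    have "(LINT s:{0..t}|lborel. w s) = (LINT s::real|lborel. 0)"
      unfolding set_lebesgue_integral_def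
    proof (rule integral_cong_AE)
      have "set_integrable lborel {0..t} w"
        using t by (auto intro: set_integrable_subset[OF H1_derivative_set_integrable[OF H\<eta>]])
      then show "(\<lambda>s. indicator {0..t} s *\<^sub>R w s) \<in> borel_measurable lborel"
        unfolding set_integrable_def by (rule borel_measurable_integrable)
      show "AE s in lborel. indicator {0..t} s *\<^sub>R w s = 0"
        using w0 by eventually_elim (use t in \<open>auto split: split_indicator\<close>)
    qed simp
    then show ?thesis using H1_derivative_integral[OF H\<eta> t] \<eta>0 by simp
  qed
  define V where "V t = p t + c" for t
  have PV: "(P has_vector_derivative V t) (at t within {0..1})" if t: "t \<in> {0..1}" for t
  proof -
    have "((\<lambda>t. P 0 + I t + t *\<^sub>R c) has_vector_derivative 0 + p t + c) (at t within {0..1})"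
      unfolding I_def
      by (intro has_vector_derivative_add integral_has_vector_derivative[OF cp t] has_vector_derivative_const)
        (auto intro!: derivative_eq_intros)
    then have "((\<lambda>t. P 0 + I t + t *\<^sub>R c) has_vector_derivative V t) (at t within {0..1})" by (simp add: V_def)
    moreover have "P s = P 0 + I s + s *\<^sub>R c" if "s \<in> {0..1}" for s
      using \<eta>z[OF that] unfolding \<eta>_def by (simp add: algebra_simps)
    ultimately show ?thesis by (rule has_vector_derivative_transform[OF t, rotated])
  qed
  have VF: "(V has_vector_derivative force (P t)) (at t within {0..1})" if t: "t \<in> {0..1}" for t
  proof -
    have "((\<lambda>t. p t + c) has_vector_derivative force (P t) + 0) (at t within {0..1})"
      unfolding p_def
      by (intro has_vector_derivative_add integral_has_vector_derivative[OF cf t] has_vector_derivative_const)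
    then show ?thesis by (simp add: V_def[abs_def])
  qed
  have HV: "H1_derivative V (\<lambda>t. force (P t))" by (rule H1_derivative_C1[OF cf VF])
  have HP: "H1_derivative P V"
    by (rule H1_derivative_C1[OF H1_derivative_continuous[OF HV] PV])
  have Vc: "V t \<in> centered" if "t \<in> {0..1}" for t
    unfolding V_def using centered_add_scale[OF pc[OF that] cc, of 1] by simp
  \<comment> \<open>For the smooth velocity the integrand of the first variation is the derivative
    of the inner product of V and q; only boundary terms remain.\<close>
  have bdry: "V 1 \<bullet> q 1 = V 0 \<bullet> q 0"
    if "H1_derivative q u" "\<And>t. t \<in> {0..1} \<Longrightarrow> q t \<in> centered" "\<sigma>\<^sub>S (q 0) = q 0" "\<sigma>\<^sub>E \<theta> (q 1) = q 1" for q u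
    using FV[OF HP that] H1_integration_by_parts(2)[OF HV that(1)]
    by (simp add: inner_commute add.commute)
  have orth: "\<sigma> V' = - V'" if "V' \<bullet> (V' + \<sigma> V') = 0" "\<sigma> V' \<bullet> \<sigma> V' = V' \<bullet> V'" for \<sigma> and V' :: config
  proof -
    have "(V' + \<sigma> V') \<bullet> (V' + \<sigma> V') = 2 * (V' \<bullet> (V' + \<sigma> V'))"
      using that(2) by (simp add: inner_add inner_commute)
    then have "V' + \<sigma> V' = 0" using that(1) by simp
    then show ?thesis by (simp add: eq_neg_iff_add_eq_0 add.commute)
  qed
  have "\<sigma>\<^sub>S (V 0) = - V 0"
  proof (rule orth[OF _ S.act_inner])
    define h where "h = V 0 + \<sigma>\<^sub>S (V 0)"
    have hc: "h \<in> centered" unfolding h_def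
      using centered_add_scale[OF Vc S.act_centered[OF Vc], of 0 0 1] by simp
    have h: "\<sigma>\<^sub>S h = h" unfolding h_def by (simp add: linear_add[OF S.linear_act] involution)
    \<comment> \<open>The factor equals 1 at this end and 0 at the other, which isolates one
      boundary condition.\<close>
    have "H1_derivative (\<lambda>t. (1 - t) *\<^sub>R h) (\<lambda>_. - h)"
      by (rule H1_derivative_C1) (auto intro!: derivative_eq_intros)
    from bdry[OF this] show "V 0 \<bullet> h = 0"
      using h fix0 centered_add_scale[OF z hc] by simp
  qed
  moreover have "\<sigma>\<^sub>E \<theta> (V 1) = - V 1"
  proof (rule orth[OF _ E.act_inner])
    define h where "h = V 1 + \<sigma>\<^sub>E \<theta> (V 1)"
    have hc: "h \<in> centered" unfolding h_def
      using centered_add_scale[OF Vc E.act_centered[OF Vc], of 1 1 1] by simp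
    have h: "\<sigma>\<^sub>E \<theta> h = h" unfolding h_def by (simp add: linear_add[OF E.linear_act] involution)
    have "H1_derivative (\<lambda>t. t *\<^sub>R h) (\<lambda>_. h)"
      by (rule H1_derivative_C1) (auto intro!: derivative_eq_intros)
    from bdry[OF this] show "V 1 \<bullet> h = 0"
      using h fix0 centered_add_scale[OF z hc] by simp
  qed
  ultimately show ?thesis using that[OF PV VF] by blast
qed

section \<open>Extension to all times\<close>

text \<open>At the joint both one-sided derivatives equal d; elsewhere one of the two intervals
  already contains a neighbourhood within {a..c}.\<close>

lemma has_vector_derivative_Icc_Un:
  fixes f :: "real \<Rightarrow> 'a::real_normed_vector"
  assumes l: "x \<in> {a..b} \<Longrightarrow> (f has_vector_derivative d) (at x within {a..b})"
    and r: "x \<in> {b..c} \<Longrightarrow> (f has_vector_derivative d) (at x within {b..c})"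
    and x: "x \<in> {a..c}" and ab: "a \<le> b" "b \<le> c"
  shows "(f has_vector_derivative d) (at x within {a..c})"
proof -
  have U: "{a..c} = {a..b} \<union> {b..c}" using ab by auto
  consider "x < b" | "x = b" | "x > b" by linarith
  then show ?thesis
  proof cases
    case 1
    have "at x within {a..c} = at x within {a..b}"
      by (rule at_within_nhd[of _ "{..<b}"]) (use 1 ab in auto)
    then show ?thesis using l x 1 by auto
  next
    case 2
    then have "(f has_vector_derivative d) (at x within {a..b})" "(f has_vector_derivative d) (at x within {b..c})"
      using l r ab by auto
    then show ?thesis unfolding U has_vector_derivative_def has_derivative_within
      by (blast intro: Lim_Un)
  next
    case 3
    have "at x within {a..c} = at x within {b..c}"
      by (rule at_within_nhd[of _ "{b<..}"]) (use 3 ab in auto)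
    then show ?thesis using r x 3 by auto
  qed
qed

section \<open>The screw motion and the extended path\<close>

lemma rot_reflect: "rot \<alpha> \<circ> reflect \<beta> = reflect (\<alpha> + \<beta>)"
  by (simp add: fun_eq_iff real2_eq_iff cos_add sin_add algebra_simps)

text \<open>The m-th power of \<open>\<sigma>\<^sub>E \<theta> \<circ> \<sigma>\<^sub>S\<close>, for
  negative m as well. The two exchanges of 3 and 4 cancel, so each factor exchanges 1 and 2 only and
  the parity of m decides.\<close>

definition screw :: "real \<Rightarrow> int \<Rightarrow> config \<Rightarrow> config" where
  "screw \<theta> m = act (rot (2 * \<theta> * of_int m)) (if even m then id else swap12)"

lemma screw_symmetry: "symmetry (rot (2 * \<theta> * of_int m)) (if even m then id else swap12)"
  by unfold_locales (auto intro: orthogonal_transformation_rot bij_swap)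

lemma screw_add: "screw \<theta> (m + n) q = screw \<theta> m (screw \<theta> n q)"
proof -
  have "rot (2 * \<theta> * of_int (m + n)) = rot (2 * \<theta> * of_int m) \<circ> rot (2 * \<theta> * of_int n)"
    unfolding rot_add[symmetric] by (simp add: algebra_simps)
  then show ?thesis by (auto simp: screw_def act_act swap_comp)
qed

lemma screw_\<sigma>\<^sub>S: "screw \<theta> 1 (\<sigma>\<^sub>S q) = \<sigma>\<^sub>E \<theta> q"
  by (simp add: screw_def act_act rot_reflect)

lemma screw_0: "screw \<theta> 0 q = q"
  by (simp add: screw_def)

lemma screw_2: "screw \<theta> 2 q = act (rot (4 * \<theta>)) id q"
  by (simp add: screw_def)

text \<open>Even extension across \<open>t = 0\<close> by \<open>\<sigma>\<^sub>S\<close>; composing with the reflection at \<open>t = 1\<close>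
  gives the screw motion \<open>\<sigma>\<^sub>E \<sigma>\<^sub>S\<close> that advances time by 2.\<close>

definition even_ext :: "(real \<Rightarrow> config) \<Rightarrow> real \<Rightarrow> config" where
  "even_ext P s = (if s \<ge> 0 then P s else \<sigma>\<^sub>S (P (- s)))"

text \<open>The floor selects the m with 2m - 1 \<le> t < 2m + 1. The base path is a parameter
  because positions, velocities and forces are extended in the same way.\<close>

definition screw_ext :: "real \<Rightarrow> (real \<Rightarrow> config) \<Rightarrow> real \<Rightarrow> config" where
  "screw_ext \<theta> E t = (let m = \<lfloor>(t + 1) / 2\<rfloor> in screw \<theta> m (E (t - 2 * of_int m)))"

lemma even_ext_derivative:
  assumes P: "\<And>t. t \<in> {0..1} \<Longrightarrow> (P has_vector_derivative V t) (at t within {0..1})"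
    and P0: "\<sigma>\<^sub>S (P 0) = P 0" and V0: "\<sigma>\<^sub>S (V 0) = - V 0" and s: "s \<in> {-1..1}"
  shows "(even_ext P has_vector_derivative (if s \<ge> 0 then V s else - \<sigma>\<^sub>S (V (- s)))) (at s within {-1..1})"
proof (rule has_vector_derivative_Icc_Un[of _ "-1" 0 _ _ 1])
  assume t: "s \<in> {0..1}"
  show "(even_ext P has_vector_derivative (if s \<ge> 0 then V s else - \<sigma>\<^sub>S (V (- s)))) (at s within {0..1})"
    using t by (intro has_vector_derivative_transform[OF t _ P[OF t, THEN has_vector_derivative_eq_rhs]]) (auto simp: even_ext_def)
next
  assume t: "s \<in> {-1..0}"
  have im: "uminus ` {-1..0} = {0..1::real}" by (simp add: image_uminus_atLeastAtMost)
  have "((P \<circ> uminus) has_vector_derivative (-1) *\<^sub>R V (- s)) (at s within {-1..0})"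
    by (rule vector_diff_chain_within) (use t P[of "- s"] in \<open>auto simp: im intro!: derivative_eq_intros\<close>)
  then have d: "((\<lambda>y. \<sigma>\<^sub>S ((P \<circ> uminus) y)) has_vector_derivative \<sigma>\<^sub>S ((-1) *\<^sub>R V (- s))) (at s within {-1..0})"
    by (rule bounded_linear.has_vector_derivative[OF S.bounded_linear_act])
  \<comment> \<open>At s = 0 both branches apply; they agree because the reflection reverses
    \<open>V 0\<close>.\<close>
  have e: "\<sigma>\<^sub>S ((-1) *\<^sub>R V (- s)) = (if s \<ge> 0 then V s else - \<sigma>\<^sub>S (V (- s)))"
    using t V0 linear_neg[OF S.linear_act] by auto
  show "(even_ext P has_vector_derivative (if s \<ge> 0 then V s else - \<sigma>\<^sub>S (V (- s)))) (at s within {-1..0})"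
    by (rule has_vector_derivative_transform[OF t _ d[unfolded e]]) (use P0 in \<open>auto simp: even_ext_def\<close>)
qed (use s in auto)

text \<open>At the right end of the interval the floor already gives m + 1. The matching condition
  reconciles the two expressions, so that one-sided derivatives exist up to the joints.\<close>

lemma screw_ext_eq:
  assumes E: "E 1 = screw \<theta> 1 (E (-1))" and t: "t \<in> {2 * of_int m - 1..2 * of_int m + 1}"
  shows "screw_ext \<theta> E t = screw \<theta> m (E (t - 2 * of_int m))"
proof (cases "t = 2 * of_int m + 1")
  case True
  have "\<lfloor>(t + 1) / 2\<rfloor> = m + 1" unfolding True by (simp add: floor_eq_iff)
  then show ?thesis using E True by (simp add: screw_ext_def screw_add)
next
  case False
  then have "\<lfloor>(t + 1) / 2\<rfloor> = m" using t by (simp add: floor_eq_iff field_simps)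
  then show ?thesis by (simp add: screw_ext_def)
qed

text \<open>Each piece is a fixed linear image of the shifted base path; the matching condition on W
  makes the one-sided derivatives agree at the joints. The lemma serves first for positions, then
  for velocities.\<close>

lemma screw_ext_derivative:
  assumes E: "E 1 = screw \<theta> 1 (E (-1))" and W: "W 1 = screw \<theta> 1 (W (-1))"
    and d: "\<And>s. s \<in> {-1..1} \<Longrightarrow> (E has_vector_derivative W s) (at s within {-1..1})"
  shows "(screw_ext \<theta> E has_vector_derivative screw_ext \<theta> W t) (at t)"
proof -
  have piece: "(screw_ext \<theta> E has_vector_derivative screw_ext \<theta> W t) (at t within {2 * of_int m - 1..2 * of_int m + 1})"
    if t: "t \<in> {2 * of_int m - 1..2 * of_int m + 1}" for t m
  proof -
    have im: "(\<lambda>s. s - 2 * of_int m) ` {2 * of_int m - 1..2 * of_int m + 1} = {-1..1::real}"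
      by (auto simp: image_iff intro!: bexI[of _ "_ + 2 * of_int m"])
    have "((E \<circ> (\<lambda>s. s - 2 * of_int m)) has_vector_derivative 1 *\<^sub>R W (t - 2 * of_int m)) (at t within {2 * of_int m - 1..2 * of_int m + 1})"
    proof (rule vector_diff_chain_within)
      show "((\<lambda>s. s - 2 * of_int m) has_vector_derivative 1) (at t within {2 * of_int m - 1..2 * of_int m + 1})"
        by (auto intro!: derivative_eq_intros)
      show "(E has_vector_derivative W (t - 2 * of_int m)) (at (t - 2 * of_int m) within (\<lambda>s. s - 2 * of_int m) ` {2 * of_int m - 1..2 * of_int m + 1})"
        unfolding im using t by (intro d) auto
    qed
    from bounded_linear.has_vector_derivative[OF symmetry.bounded_linear_act[OF screw_symmetry] this, of \<theta> m]
    have "((\<lambda>s. screw \<theta> m (E (s - 2 * of_int m))) has_vector_derivative screw \<theta> m (W (t - 2 * of_int m)))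
       (at t within {2 * of_int m - 1..2 * of_int m + 1})" by (simp add: screw_def)
    then show ?thesis
      unfolding screw_ext_eq[OF W t]
      by (rule has_vector_derivative_transform[OF t, rotated]) (rule screw_ext_eq[OF E])
  qed
  define m where "m = \<lfloor>(t + 1) / 2\<rfloor>"
  have m: "2 * of_int m - 1 \<le> t" "t < 2 * of_int m + 1" 
    using floor_correct[of "(t + 1) / 2"] unfolding m_def by (auto simp: field_simps)
  show ?thesis
  proof (cases "t = 2 * of_int m - 1")
    case True
    \<comment> \<open>A joint: the pieces with indices m - 1 and m are glued.\<close>
    have "(screw_ext \<theta> E has_vector_derivative screw_ext \<theta> W t) (at t within {t - 2..t + 2})"
    proof (rule has_vector_derivative_Icc_Un[of _ "t - 2" t _ _ "t + 2"])
      show "(screw_ext \<theta> E has_vector_derivative screw_ext \<theta> W t) (at t within {t - 2..t})"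
      proof -
        have e: "2 * of_int (m - 1) - 1 = t - 2" "2 * of_int (m - 1) + 1 = t" using True by simp_all
        show ?thesis using piece[of t "m - 1"] unfolding e by simp
      qed
      show "(screw_ext \<theta> E has_vector_derivative screw_ext \<theta> W t) (at t within {t..t + 2})"
      proof -
        have e: "2 * of_int m - 1 = t" "2 * of_int m + 1 = t + 2" using True by simp_all
        show ?thesis using piece[of t m] unfolding e by simp
      qed
    qed auto
    then show ?thesis by (simp add: at_within_Icc_at)
  next
    case False
    then show ?thesis using piece[of t m] m by (simp add: at_within_Icc_at)
  qed
qed

text \<open>Time 4 is two screw steps, in which the exchanges of 1 and 2 cancel and a pure rotation
  remains.\<close>

lemma screw_ext_4: "screw_ext \<theta> E (t + 4) = act (rot (4 * \<theta>)) id (screw_ext \<theta> E t)"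
proof -
  have m: "\<lfloor>(t + 4 + 1) / 2\<rfloor> = 2 + \<lfloor>(t + 1) / 2\<rfloor>"
  proof -
    have "(t + 4 + 1) / 2 = (t + 1) / 2 + of_int 2" by simp
    then show ?thesis by (metis add.commute floor_add_int)
  qed
  show ?thesis unfolding screw_ext_def Let_def m screw_add screw_2 by (simp add: algebra_simps)
qed

text \<open>In a frame turning at rate \<theta> the motion has period 4. If \<theta>/pi is rational,
  finitely many periods complete whole turns; otherwise 1/4 and \<theta>/(2 pi) are independent
  frequencies.\<close>

lemma relative_periodic_dichotomy:
  fixes Q :: "real \<Rightarrow> config"
  assumes Q: "\<And>t. Q (t + 4) = act (rot (4 * \<theta>)) id (Q t)" and c: "continuous_on UNIV Q"
  shows "periodic Q \<or> quasi_periodic Q"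
proof (cases "\<theta> / pi \<in> \<rat>")
  case True
  then obtain a b :: int where ab: "b > 0" "\<theta> / pi = of_int a / of_int b"
    by (metis Rats_cases' )
  have shift: "Q (t + 4 * real n) = act (rot (4 * \<theta> * real n)) id (Q t)" for t n
  proof (induction n)
    case (Suc n)
    have "Q (t + 4 * real (Suc n)) = Q ((t + 4 * real n) + 4)" by (simp add: algebra_simps)
    also have "\<dots> = act (rot (4 * \<theta> + 4 * \<theta> * real n)) id (Q t)"
      by (simp only: Q Suc.IH act_act rot_add comp_id)
    also have "4 * \<theta> + 4 * \<theta> * real n = 4 * \<theta> * real (Suc n)" by (simp add: algebra_simps)
    finally show ?case .
  qed (simp add: act_def vec_eq_iff)
  \<comment> \<open>After b blocks of length 4 the total angle is 4 pi a, a whole number of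
    turns.\<close>
  have e: "4 * \<theta> * real (nat b) = 2 * pi * of_int (2 * a)" using ab by (simp add: field_simps)
  have "Q (t + 4 * real (nat b)) = Q t" for t using shift[of t "nat b"] unfolding e rot_2pi act_id .
  moreover have "4 * real (nat b) > 0" using ab by simp
  ultimately show ?thesis unfolding periodic_def by blast
next
  case False
  \<comment> \<open>\<open>x 0\<close> is the phase within the period 4 and \<open>x 1\<close> the
    rotation counted in turns. \<open>F\<close> undoes the angle 4 \<theta> x 0 accumulated by
    \<open>Q\<close> and turns by 2 pi x 1 instead; along the orbit the two angles cancel.\<close>
  define \<omega> :: "nat \<Rightarrow> real" where "\<omega> i = (if i = 0 then 1 / 4 else \<theta> / (2 * pi))" for i
  define F :: "(nat \<Rightarrow> real) \<Rightarrow> config" where "F x = act (rot (2 * pi * x 1 - 4 * \<theta> * x 0)) id (Q (4 * x 0))" for x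
  have "quasi_periodic Q"
    unfolding quasi_periodic_def
  proof (intro exI[of _ "2::nat"] exI[of _ \<omega>] exI[of _ F] conjI allI impI)
    fix z :: "nat \<Rightarrow> int" and i :: nat
    assume "(\<Sum>i<2. of_int (z i) * \<omega> i) = 0" and i: "i < 2"
    then have z: "of_int (z 0) / 4 + of_int (z 1) * (\<theta> / (2 * pi)) = (0::real)"
      by (simp add: \<omega>_def eval_nat_numeral)
    have "z 1 = 0"
    proof (rule ccontr)
      assume "z 1 \<noteq> 0"
      then have "\<theta> / pi = - of_int (z 0) / (2 * of_int (z 1))" using z by (simp add: field_simps)
      then have "\<theta> / pi \<in> \<rat>" by simp
      then show False using False by simp
    qed
    then show "z i = 0" using z i by (cases "i = 0") (auto simp: less_2_cases_iff)
  next
    have "continuous_on UNIV (\<lambda>x::nat \<Rightarrow> real. Q (4 * x 0))"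
      by (rule continuous_on_compose2[OF c]) (auto intro!: continuous_intros)
    then have cQ: "continuous_on UNIV (\<lambda>x::nat \<Rightarrow> real. Q (4 * x 0) $ i $ k)" for i k
      by (intro continuous_on_component)
    \<comment> \<open>In coordinates the rotation reduces continuity of \<open>F\<close> to that of
      real functions.\<close>
    have rot_alt: "rot a y = (\<chi> k. if k = 1 then y $ 1 * cos a - y $ 2 * sin a else y $ 1 * sin a + y $ 2 * cos a)" for a y
      by (simp add: real2_eq_iff)
    have ca: "continuous_on UNIV (\<lambda>x::nat \<Rightarrow> real. 2 * pi * x 1 - 4 * \<theta> * x 0)"
      by (auto intro!: continuous_intros)
    have "continuous_on UNIV F"
      unfolding F_def act_def rot_alt
    proof (intro continuous_on_vec_lambda)
      fix i :: 4 and k :: 2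
      show "continuous_on UNIV (\<lambda>x::nat \<Rightarrow> real. if k = 1 then Q (4 * x 0) $ id i $ 1 * cos (2 * pi * x 1 - 4 * \<theta> * x 0) - Q (4 * x 0) $ id i $ 2 * sin (2 * pi * x 1 - 4 * \<theta> * x 0)
           else Q (4 * x 0) $ id i $ 1 * sin (2 * pi * x 1 - 4 * \<theta> * x 0) + Q (4 * x 0) $ id i $ 2 * cos (2 * pi * x 1 - 4 * \<theta> * x 0))"
        by (cases "k = 1") (auto intro!: continuous_on_add continuous_on_diff continuous_on_mult continuous_on_cos continuous_on_sin cQ ca)
    qed
    then show "continuous_on {x. \<forall>i\<ge>2. x i = 0} F" by (rule continuous_on_subset) simp
  next
    fix x :: "nat \<Rightarrow> real" and i :: nat
    assume i: "i < 2"
    show "F (x(i := x i + 1)) = F x"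
    proof (cases "i = 0")
      case True
      have "Q (4 * (x 0 + 1)) = act (rot (4 * \<theta>)) id (Q (4 * x 0))" using Q[of "4 * x 0"] by (simp add: algebra_simps)
      then show ?thesis unfolding F_def True
        by (simp add: act_act rot_add[symmetric] algebra_simps)
    next
      case False
      then have "i = 1" using i by simp
      moreover have "rot (2 * pi * (x 1 + 1) - 4 * \<theta> * x 0) = rot (2 * pi * x 1 - 4 * \<theta> * x 0)"
        using rot_add[of "2 * pi * x 1 - 4 * \<theta> * x 0" "2 * pi * of_int 1"] rot_2pi[of 1] by (simp add: algebra_simps)
      ultimately show ?thesis unfolding F_def by simp
    qed
  next
    show "Q t = F (\<lambda>i. if i < 2 then \<omega> i * t else 0)" for t
      by (simp add: F_def \<omega>_def)
  qed simp
  then show ?thesis ..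
qed

theorem theorem1p2:
  fixes \<theta> :: real and P :: "real \<Rightarrow> config"
  assumes "0 < \<theta>" and "\<theta> \<le> 0.0664 * pi"
    and "P \<in> paths \<theta>"
    and "action P = (INF q \<in> paths \<theta>. action q)"
  shows "(\<forall>t\<in>{0..1}. \<not> collision_at P t) \<and>
    (\<exists>Q. is_orbit Q \<and> (\<forall>t\<in>{0..1}. Q t = P t) \<and> (periodic Q \<or> quasi_periodic Q))"
proof
  show nc: "\<forall>t\<in>{0..1}. \<not> collision_at P t" by (rule minimizer_collision_free(2)[OF assms])
  have f: "collision_free (P t)" if "t \<in> {0..1}" for t using nc that by (simp add: not_collision_at_iff)
  have min: "action P \<le> action q" if "q \<in> paths \<theta>" for q unfolding assms(4) using that by (rule INF_lower)
  obtain V where PV: "\<And>t. t \<in> {0..1} \<Longrightarrow> (P has_vector_derivative V t) (at t within {0..1})"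
    and VF: "\<And>t. t \<in> {0..1} \<Longrightarrow> (V has_vector_derivative force (P t)) (at t within {0..1})"
    and V0: "\<sigma>\<^sub>S (V 0) = - V 0" and V1: "\<sigma>\<^sub>E \<theta> (V 1) = - V 1"
    using minimizer_smooth[OF assms(3) min f] by blast
  have "P 0 \<in> Q_S" "P 1 \<in> Q_E2 \<theta>" using assms(3) by (auto simp: paths_def)
  then have P0: "\<sigma>\<^sub>S (P 0) = P 0" and P1: "\<sigma>\<^sub>E \<theta> (P 1) = P 1"
    unfolding mem_Q_S_iff_fixed mem_Q_E2_iff_fixed by auto
  define E where "E = even_ext P"
  \<comment> \<open>On the reflected half, time reversal contributes the minus sign.\<close>
  define W where "W s = (if s \<ge> 0 then V s else - \<sigma>\<^sub>S (V (- s)))" for s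
  have EW: "(E has_vector_derivative W s) (at s within {-1..1})" if "s \<in> {-1..1}" for s
    unfolding E_def W_def by (rule even_ext_derivative[OF PV P0 V0 that])
  have Ef: "collision_free (E s)" if "s \<in> {-1..1}" for s
    using f that by (simp add: E_def even_ext_def S.act_collision_free)
  have WF: "(W has_vector_derivative force (E s)) (at s within {-1..1})" if s: "s \<in> {-1..1}" for s
  proof (rule has_vector_derivative_Icc_Un[of _ "-1" 0 _ _ 1])
    assume t: "s \<in> {0..1}"
    have "(V has_vector_derivative force (E s)) (at s within {0..1})"
      using VF[OF t] t by (simp add: E_def even_ext_def)
    then show "(W has_vector_derivative force (E s)) (at s within {0..1})"
      by (rule has_vector_derivative_transform[OF t, rotated]) (simp add: W_def)
  next
    assume t: "s \<in> {-1..0}"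
    have im: "uminus ` {-1..0} = {0..1::real}" by (simp add: image_uminus_atLeastAtMost)
    have "((V \<circ> uminus) has_vector_derivative (-1) *\<^sub>R force (P (- s))) (at s within {-1..0})"
      by (rule vector_diff_chain_within) (use t VF[of "- s"] in \<open>auto simp: im intro!: derivative_eq_intros\<close>)
    then have "((\<lambda>y. \<sigma>\<^sub>S ((V \<circ> uminus) y)) has_vector_derivative \<sigma>\<^sub>S ((-1) *\<^sub>R force (P (- s)))) (at s within {-1..0})"
      by (rule bounded_linear.has_vector_derivative[OF S.bounded_linear_act])
    then have "((\<lambda>y. - \<sigma>\<^sub>S ((V \<circ> uminus) y)) has_vector_derivative - \<sigma>\<^sub>S ((-1) *\<^sub>R force (P (- s)))) (at s within {-1..0})"
      by (rule has_vector_derivative_minus)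
    also have "- \<sigma>\<^sub>S ((-1) *\<^sub>R force (P (- s))) = force (E s)"
      using t P0 linear_neg[OF S.linear_act] by (auto simp: E_def even_ext_def S.act_force[symmetric])
    finally show "(W has_vector_derivative force (E s)) (at s within {-1..0})"
      by (rule has_vector_derivative_transform[OF t, rotated]) (use V0 in \<open>auto simp: W_def\<close>)
  qed (use s in auto)
  \<comment> \<open>The screw after \<open>\<sigma>\<^sub>S\<close> is
    \<open>\<sigma>\<^sub>E \<theta>\<close>, which fixes \<open>P 1\<close>. It reverses
    \<open>V 1\<close>, and for velocities this sign cancels the one in \<open>W\<close>.\<close>
  have E1: "E 1 = screw \<theta> 1 (E (-1))" by (simp add: E_def even_ext_def screw_\<sigma>\<^sub>S P1)
  have "screw \<theta> 1 (- \<sigma>\<^sub>S (V 1)) = - screw \<theta> 1 (\<sigma>\<^sub>S (V 1))"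
    unfolding screw_def by (rule linear_neg[OF symmetry.linear_act[OF screw_symmetry]])
  then have W1: "W 1 = screw \<theta> 1 (W (-1))" by (simp add: W_def screw_\<sigma>\<^sub>S V1)
  define Q where "Q = screw_ext \<theta> E"
  define v where "v = screw_ext \<theta> W"
  have Qv: "(Q has_vector_derivative v t) (at t)" for t
    unfolding Q_def v_def by (rule screw_ext_derivative[OF E1 W1 EW])
  \<comment> \<open>The force commutes with the symmetries, so extending it from \<open>E\<close> by
    the screw motion gives the force along \<open>Q\<close>; the derivative lemma then applies
    again, to \<open>W\<close>.\<close>
  have FE: "screw_ext \<theta> (\<lambda>s. force (E s)) t = force (Q t)" for t
    unfolding Q_def screw_ext_def Let_def screw_def by (rule symmetry.act_force[OF screw_symmetry, symmetric])
  have "force (E 1) = screw \<theta> 1 (force (E (-1)))"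
    unfolding E1 screw_def by (rule symmetry.act_force[OF screw_symmetry])
  then have vF: "(v has_vector_derivative force (Q t)) (at t)" for t
    unfolding FE[symmetric] v_def by (rule screw_ext_derivative[OF W1 _ WF])
  have Qf: "collision_free (Q t)" for t
  proof -
    have "t - 2 * of_int \<lfloor>(t + 1) / 2\<rfloor> \<in> {-1..1}" using floor_correct[of "(t + 1) / 2"] by (auto simp: field_simps)
    then show ?thesis
      unfolding Q_def screw_ext_def Let_def screw_def symmetry.act_collision_free[OF screw_symmetry] by (rule Ef)
  qed
  have "is_orbit Q"
    unfolding is_orbit_def not_collision_at_iff
  proof (intro conjI allI exI[of _ v])
    show "((\<lambda>s. Q s $ i) has_vector_derivative v t $ i) (at t)" for t i
      by (rule bounded_linear.has_vector_derivative[OF bounded_linear_vec_nth Qv])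
    show "((\<lambda>s. v s $ i) has_vector_derivative
          (\<Sum>j\<in>UNIV - {i}. (1 / norm (Q t $ j - Q t $ i) ^ 3) *\<^sub>R (Q t $ j - Q t $ i))) (at t)" for t i
      using bounded_linear.has_vector_derivative[OF bounded_linear_vec_nth vF, of i t] by (simp add: force_def)
  qed (rule Qf)
  moreover have "Q t = P t" if t: "t \<in> {0..1}" for t
  proof -
    have "Q t = screw \<theta> 0 (E (t - 2 * of_int 0))"
      unfolding Q_def by (rule screw_ext_eq[OF E1]) (use t in auto)
    then show ?thesis using t by (simp add: screw_0 E_def even_ext_def)
  qed
  moreover have "periodic Q \<or> quasi_periodic Q"
  proof (rule relative_periodic_dichotomy)
    show "Q (t + 4) = act (rot (4 * \<theta>)) id (Q t)" for t unfolding Q_def by (rule screw_ext_4)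
    show "continuous_on UNIV Q"
      using Qv has_vector_derivative_continuous by (blast intro: continuous_at_imp_continuous_on)
  qed
  ultimately show "\<exists>Q. is_orbit Q \<and> (\<forall>t\<in>{0..1}. Q t = P t) \<and> (periodic Q \<or> quasi_periodic Q)" by blast
qed

end
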